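(* In the setting of the context: (a) If two fixed continuous potentials $z_h,\tilde z_h$ have the same full external trace on $\partial\Omega_h$, then on the same variation space their exactly integrated global gauge Hessians coincide: $\mathcal C_h^I[z_h]=\mathcal C_h^I[\tilde z_h]$. (b) If both are in addition cellwise compatible, their numerical reference forms coincide: $K_h(y_h)+\mathcal C_h^Q[z_h]=K_h(y_h)+\mathcal C_h^Q[\tilde z_h]$. (c) More generally, if $z_h$ is cellwise compatible and $\tilde z_h$ (not necessarily compatible) has the same full external trace, then the compatible reference form of $z_h$ equals the defect-corrected reference form of $\tilde z_h$: $K_h(y_h)+\mathcal C_h^Q[z_h]=K_h(y_h)+\mathcal C_h^Q[\tilde z_h]-\Delta_h[\tilde z_h]$, where $\Delta_h[\tilde z_h]=\mathcal C_h^Q[\tilde z_h]-\mathcal C_h^I[\tilde z_h]$. (d) On the parent tetrahedron $\widehat T$ with the symmetric four-point rule $Q_4$, with candidates and variations in $[\mathbb P_2]^3$, $$\{z\in[\mathbb P_2]^3:\ \mathcal T(z;u,v)=0\ \ \forall u,v\in[\mathbb P_2]^3\}=[\mathbb P_1]^3 .$$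
   Context: Matrices: $A:B=\operatorname{tr}(A^TB)$; $\operatorname{cof}A$ is the matrix of signed $2\times2$ minors; $A\times B=\operatorname{cof}(A+B)-\operatorname{cof}A-\operatorname{cof}B$. Mesh and spaces: $\Omega_h\subset\mathbb R^3$ is a connected bounded Lipschitz domain partitioned into finitely many conforming cells $K_e=X_e(\widehat K_e)$; each $X_e$ is an orientation-preserving one-to-one map of a parent cell with bounded first derivatives and inverse derivatives, the maps agreeing on shared faces. A subscript $e$ denotes pullback by $X_e$; $D_\xi$ is the parent derivative (rows are components), $J_{X,e}=D_\xi X_e$, $J_{y,e}=D_\xi y_e$, $J_{z,e}=D_\xi z_e$; $F=J_yJ_X^{-1}$. All fields are continuous and piecewise regular (e.g. piecewise polynomial pullbacks). The global variation space $V_h$ is a finite-dimensional conforming subspace of $H^1(\Omega_h;\mathbb R^3)$ of continuous fields with pullbacks in local spaces $\widehat V_e$, vanishing on an essential boundary part $\Gamma_D\subset\partial\Omega_h$. Quadrature: $\mathcal I_e[f]=\int_{\widehat K_e}f\,d\xi$, $\mathcal Q_e[f]=\sum_qw_{eq}f(\xi_{eq})$ fixed, $\mathcal T_e(z;u,v)=(\mathcal Q_e-\mathcal I_e)[D_\xi z:(D_\xi u\times D_\xi v)]$. A potential $z_h$ is cellwise compatible if $\mathcal T_e(z_e;u,v)=0$ for every $e$ and all $u,v\in\widehat V_e$. Gauge: $\mathcal C_h^I[z_h]$ and $\mathcal C_h^Q[z_h]$ are the Hessian matrices on $V_h$, with $z_h$ held fixed, of $y_h\mapsto\sum_e\mathcal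 I_e[J_{z,e}:\operatorname{cof}J_{y,e}]$ and $y_h\mapsto\sum_e\mathcal Q_e[J_{z,e}:\operatorname{cof}J_{y,e}]$. Energy: $K_h(y_h)=D^2E_h(y_h)$ along $V_h$, where $E_h(y_h)=\sum_e\mathcal Q_e[\det J_{X,e}W_{\mathrm{iso},e}(F)]+\sum_e\frac{\kappa_e}{2V_e^Q}c_e(y_h)^2$, $W_{\mathrm{iso},e}(F)=c_{1,e}(J^{-2/3}F:F-3)+c_{2,e}(J^{-4/3}\operatorname{cof}F:\operatorname{cof}F-3)$ with $J=\det F>0$, $c_{1,e},c_{2,e}\ge0$, $c_{1,e}+c_{2,e}>0$, $\kappa_e\ge0$, $V_e^Q=\mathcal Q_e[\det J_{X,e}]>0$, $c_e(y_h)=\mathcal Q_e[\det J_{y,e}-\det J_{X,e}]$. For (d): $\widehat T=\{\xi\in\mathbb R^3:\xi_i\ge0,\ \xi_1+\xi_2+\xi_3\le1\}$; $\mathbb P_r$ is the space of polynomials of total degree at most $r$; $Q_4$ has weight $1/24$ at each of the four points whose barycentric coordinates are the permutations of $\bigl(\frac{5+3\sqrt5}{20},\frac{5-\sqrt5}{20},\frac{5-\sqrt5}{20},\frac{5-\sqrt5}{20}\bigr)$; and $\mathcal T(z;u,v)=Q_4[Dz:(Du\times Dv)]-\int_{\widehat T}Dz:(Du\times Dv)\,d\xi$. *)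

theory Defs
  imports "HOL-Analysis.Analysis"
begin

section \<open>Matrix algebra\<close>

definition frob :: "real^3^3 \<Rightarrow> real^3^3 \<Rightarrow> real"  (infixl \<open>\<bullet>\<bullet>\<close> 70) where
  "A \<bullet>\<bullet> B = trace (transpose A ** B)"

text \<open>Arithmetic on the index type 3 is modulo 3. Taking the two remaining rows and columns
  in cyclic order produces the sign of the minor.\<close>

definition cof :: "real^3^3 \<Rightarrow> real^3^3" where
  "cof A = (\<chi> i j. A $ (i + 1) $ (j + 1) * A $ (i + 2) $ (j + 2)
                  - A $ (i + 1) $ (j + 2) * A $ (i + 2) $ (j + 1))"

definition cross_mat :: "real^3^3 \<Rightarrow> real^3^3 \<Rightarrow> real^3^3"  (infixl \<open>\<times>\<times>\<close> 75) where
  "A \<times>\<times> B = cof (A + B) - cof A - cof B"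


section \<open>Regularity of fields and domains\<close>

definition C1_on :: "(real^3) set \<Rightarrow> (real^3 \<Rightarrow> real^3) \<Rightarrow> bool" where
  "C1_on K f \<longleftrightarrow> (\<forall>\<xi>\<in>K. f differentiable (at \<xi> within K)) \<and>
     continuous_on K (\<lambda>\<xi>. jacobian f (at \<xi> within K))"

text \<open>Near each boundary point the domain is the strict epigraph, in some unit direction \<open>n\<close>,
  of a Lipschitz function on the plane orthogonal to \<open>n\<close>.\<close>

definition lipschitz_domain :: "(real^3) set \<Rightarrow> bool" where
  "lipschitz_domain \<Omega> \<longleftrightarrow> open \<Omega> \<and> \<Omega> \<noteq> {} \<and>
     (\<forall>p\<in>frontier \<Omega>. \<exists>n \<gamma> L r. norm n = 1 \<and> L-lipschitz_on {y. y \<bullet> n = 0} \<gamma> \<and> r > 0 \<and>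
        \<Omega> \<inter> ball p r = {x \<in> ball p r. \<gamma> (x - (x \<bullet> n) *\<^sub>R n) < x \<bullet> n})"

text \<open>Compactly supported \<open>C\<^sup>1\<close> test functions determine the same weak gradients as
  compactly supported smooth ones.\<close>

definition test_function :: "(real^3) set \<Rightarrow> (real^3 \<Rightarrow> real) \<Rightarrow> bool" where
  "test_function \<Omega> \<psi> \<longleftrightarrow> (\<forall>x. \<psi> differentiable (at x)) \<and>
     (\<forall>j. continuous_on UNIV (\<lambda>x. frechet_derivative \<psi> (at x) (axis j 1))) \<and>
     (\<exists>K. compact K \<and> K \<subseteq> \<Omega> \<and> (\<forall>x. x \<notin> K \<longrightarrow> \<psi> x = 0))"

definition square_integrable_on :: "(real^3) set \<Rightarrow> (real^3 \<Rightarrow> 'a::euclidean_space) \<Rightarrow> bool" where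
  "square_integrable_on \<Omega> f \<longleftrightarrow> set_borel_measurable lebesgue \<Omega> f \<and>
     set_integrable lebesgue \<Omega> (\<lambda>x. (norm (f x))\<^sup>2)"

definition in_H1 :: "(real^3) set \<Rightarrow> (real^3 \<Rightarrow> real^3) \<Rightarrow> bool" where
  "in_H1 \<Omega> u \<longleftrightarrow> square_integrable_on \<Omega> u \<and>
     (\<exists>G :: real^3 \<Rightarrow> real^3^3. square_integrable_on \<Omega> G \<and>
        (\<forall>\<psi> i j. test_function \<Omega> \<psi> \<longrightarrow>
           (LINT x:\<Omega>|lebesgue. u x $ i * frechet_derivative \<psi> (at x) (axis j 1))
             = - (LINT x:\<Omega>|lebesgue. G x $ i $ j * \<psi> x)))"

definition field_subspace :: "(real^3 \<Rightarrow> real^3) set \<Rightarrow> bool" where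
  "field_subspace S \<longleftrightarrow> (\<lambda>x. 0) \<in> S \<and> (\<forall>u\<in>S. \<forall>v\<in>S. (\<lambda>x. u x + v x) \<in> S) \<and>
     (\<forall>c. \<forall>u\<in>S. (\<lambda>x. c *\<^sub>R u x) \<in> S)"

definition lincomb :: "('n::finite \<Rightarrow> real^3 \<Rightarrow> real^3) \<Rightarrow> real^'n \<Rightarrow> real^3 \<Rightarrow> real^3" where
  "lincomb \<phi> a x = (\<Sum>i\<in>UNIV. a $ i *\<^sub>R \<phi> i x)"


section \<open>Quadrature\<close>

definition quad :: "nat \<Rightarrow> (nat \<Rightarrow> real) \<Rightarrow> (nat \<Rightarrow> real^3) \<Rightarrow> (real^3 \<Rightarrow> real) \<Rightarrow> real" where
  "quad n w p f = (\<Sum>q<n. w q * f (p q))"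

definition defect ::
  "(real^3) set \<Rightarrow> ((real^3 \<Rightarrow> real) \<Rightarrow> real) \<Rightarrow>
     (real^3 \<Rightarrow> real^3) \<Rightarrow> (real^3 \<Rightarrow> real^3) \<Rightarrow> (real^3 \<Rightarrow> real^3) \<Rightarrow> real" where
  "defect K Q z u v =
     (let g = (\<lambda>\<xi>. jacobian z (at \<xi> within K) \<bullet>\<bullet>
                   (jacobian u (at \<xi> within K) \<times>\<times> jacobian v (at \<xi> within K)))
      in Q g - integral K g)"


section \<open>Discrete setting\<close>

text \<open>Fields on the mesh are total functions of which only the values on the closed domain
  matter. The variation space is the linear span of the family \<open>shape\<close>, typically a basis;
  independence is not required, so the zero space is included.\<close>

record ('e, 'n) fe_model =
  Omega :: "(real^3) set"
  Gamma_D :: "(real^3) set"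
  cells :: "'e set"
  parent :: "'e \<Rightarrow> (real^3) set"
  cell_map :: "'e \<Rightarrow> real^3 \<Rightarrow> real^3"
  qnum :: "'e \<Rightarrow> nat"
  qweight :: "'e \<Rightarrow> nat \<Rightarrow> real"
  qnode :: "'e \<Rightarrow> nat \<Rightarrow> real^3"
  local_space :: "'e \<Rightarrow> (real^3 \<Rightarrow> real^3) set"
  shape :: "'n \<Rightarrow> real^3 \<Rightarrow> real^3"
  c1 :: "'e \<Rightarrow> real"
  c2 :: "'e \<Rightarrow> real"
  kappa :: "'e \<Rightarrow> real"

definition var_space :: "('e, 'n::finite) fe_model \<Rightarrow> (real^3 \<Rightarrow> real^3) set" where
  "var_space M = range (lincomb (shape M))"

definition pullback :: "('e, 'n::finite) fe_model \<Rightarrow> 'e \<Rightarrow> (real^3 \<Rightarrow> real^3) \<Rightarrow> real^3 \<Rightarrow> real^3" where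
  "pullback M e u = u \<circ> cell_map M e"

definition JX :: "('e, 'n::finite) fe_model \<Rightarrow> 'e \<Rightarrow> real^3 \<Rightarrow> real^3^3" where
  "JX M e \<xi> = jacobian (cell_map M e) (at \<xi> within parent M e)"

definition Jf :: "('e, 'n::finite) fe_model \<Rightarrow> (real^3 \<Rightarrow> real^3) \<Rightarrow> 'e \<Rightarrow> real^3 \<Rightarrow> real^3^3" where
  "Jf M u e \<xi> = jacobian (pullback M e u) (at \<xi> within parent M e)"

definition defgrad :: "('e, 'n::finite) fe_model \<Rightarrow> (real^3 \<Rightarrow> real^3) \<Rightarrow> 'e \<Rightarrow> real^3 \<Rightarrow> real^3^3" where
  "defgrad M y e \<xi> = Jf M y e \<xi> ** matrix_inv (JX M e \<xi>)"

definition exact_int :: "('e, 'n::finite) fe_model \<Rightarrow> 'e \<Rightarrow> (real^3 \<Rightarrow> real) \<Rightarrow> real" where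
  "exact_int M e f = integral (parent M e) f"

definition quad_int :: "('e, 'n::finite) fe_model \<Rightarrow> 'e \<Rightarrow> (real^3 \<Rightarrow> real) \<Rightarrow> real" where
  "quad_int M e = quad (qnum M e) (qweight M e) (qnode M e)"

definition VQ :: "('e, 'n::finite) fe_model \<Rightarrow> 'e \<Rightarrow> real" where
  "VQ M e = quad_int M e (\<lambda>\<xi>. det (JX M e \<xi>))"

definition regular_field :: "('e, 'n::finite) fe_model \<Rightarrow> (real^3 \<Rightarrow> real^3) \<Rightarrow> bool" where
  "regular_field M u \<longleftrightarrow> continuous_on (closure (Omega M)) u \<and>
     (\<forall>e\<in>cells M. C1_on (parent M e) (pullback M e u))"

definition conforming_mesh :: "('e, 'n::finite) fe_model \<Rightarrow> bool" where
  "conforming_mesh M \<longleftrightarrow>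
     connected (Omega M) \<and> bounded (Omega M) \<and> lipschitz_domain (Omega M) \<and>
     finite (cells M) \<and>
     (\<forall>e\<in>cells M. polytope (parent M e) \<and> interior (parent M e) \<noteq> {} \<and>
        C1_on (parent M e) (cell_map M e) \<and>
        inj_on (cell_map M e) (parent M e) \<and>
        (\<forall>\<xi>\<in>parent M e. det (JX M e \<xi>) > 0) \<and>
        (\<exists>B. \<forall>\<xi>\<in>parent M e. norm (JX M e \<xi>) \<le> B \<and> norm (matrix_inv (JX M e \<xi>)) \<le> B)) \<and>
     closure (Omega M) = (\<Union>e\<in>cells M. cell_map M e ` parent M e) \<and>
     (\<forall>e\<in>cells M. \<forall>f\<in>cells M. e \<noteq> f \<longrightarrow>
        cell_map M e ` interior (parent M e) \<inter> cell_map M f ` interior (parent M f) = {} \<and>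
        \<comment> \<open>the shared face is possibly empty; \<open>\<alpha>\<close> identifies its two parent copies\<close>
        (\<exists>G H \<alpha> \<beta>. G face_of parent M e \<and> H face_of parent M f \<and>
           cell_map M e ` G = cell_map M e ` parent M e \<inter> cell_map M f ` parent M f \<and>
           homeomorphism H G \<alpha> \<beta> \<and> (\<forall>\<xi>\<in>H. cell_map M f \<xi> = cell_map M e (\<alpha> \<xi>))))"

definition conforming_space :: "('e, 'n::finite) fe_model \<Rightarrow> bool" where
  "conforming_space M \<longleftrightarrow>
     Gamma_D M \<subseteq> frontier (Omega M) \<and>
     (\<forall>e\<in>cells M. field_subspace (local_space M e) \<and>
        (\<forall>u\<in>local_space M e. C1_on (parent M e) u)) \<and>
     (\<forall>u\<in>var_space M. regular_field M u \<and> in_H1 (Omega M) u \<and>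
        (\<forall>x\<in>Gamma_D M. u x = 0) \<and>
        (\<forall>e\<in>cells M. \<exists>v\<in>local_space M e. \<forall>\<xi>\<in>parent M e. pullback M e u \<xi> = v \<xi>))"

definition fe_setting :: "('e, 'n::finite) fe_model \<Rightarrow> bool" where
  "fe_setting M \<longleftrightarrow> conforming_mesh M \<and> conforming_space M \<and>
     (\<forall>e\<in>cells M. (\<forall>q<qnum M e. qnode M e q \<in> parent M e) \<and> VQ M e > 0 \<and>
        c1 M e \<ge> 0 \<and> c2 M e \<ge> 0 \<and> c1 M e + c2 M e > 0 \<and> kappa M e \<ge> 0)"

definition same_trace ::
  "('e, 'n::finite) fe_model \<Rightarrow> (real^3 \<Rightarrow> real^3) \<Rightarrow> (real^3 \<Rightarrow> real^3) \<Rightarrow> bool" where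
  "same_trace M z z' \<longleftrightarrow> (\<forall>x\<in>frontier (Omega M). z x = z' x)"

definition cellwise_compatible :: "('e, 'n::finite) fe_model \<Rightarrow> (real^3 \<Rightarrow> real^3) \<Rightarrow> bool" where
  "cellwise_compatible M z \<longleftrightarrow>
     (\<forall>e\<in>cells M. \<forall>u\<in>local_space M e. \<forall>v\<in>local_space M e.
        defect (parent M e) (quad_int M e) (pullback M e z) u v = 0)"


section \<open>Hessians along the variation space\<close>

definition gradient :: "(real^'n \<Rightarrow> real) \<Rightarrow> real^'n \<Rightarrow> real^'n" where
  "gradient f a = (\<chi> j. frechet_derivative f (at a) (axis j 1))"

definition hessian :: "(real^'n \<Rightarrow> real) \<Rightarrow> real^'n \<Rightarrow> real^'n^'n" where
  "hessian f a = jacobian (gradient f) (at a)"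

definition var_hessian ::
  "('e, 'n::finite) fe_model \<Rightarrow> ((real^3 \<Rightarrow> real^3) \<Rightarrow> real) \<Rightarrow> (real^3 \<Rightarrow> real^3) \<Rightarrow> real^'n^'n" where
  "var_hessian M \<Phi> y = hessian (\<lambda>a. \<Phi> (\<lambda>x. y x + lincomb (shape M) a x)) 0"

text \<open>The gauge functionals are quadratic in \<open>y\<close>, so their Hessians do not depend on the base
  point \<open>y\<close>, which is nevertheless kept as an argument.\<close>

definition gauge_I :: "('e, 'n::finite) fe_model \<Rightarrow> (real^3 \<Rightarrow> real^3) \<Rightarrow> (real^3 \<Rightarrow> real^3) \<Rightarrow> real^'n^'n" where
  "gauge_I M z y =
     var_hessian M (\<lambda>y. \<Sum>e\<in>cells M. exact_int M e (\<lambda>\<xi>. Jf M z e \<xi> \<bullet>\<bullet> cof (Jf M y e \<xi>))) y"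

definition gauge_Q :: "('e, 'n::finite) fe_model \<Rightarrow> (real^3 \<Rightarrow> real^3) \<Rightarrow> (real^3 \<Rightarrow> real^3) \<Rightarrow> real^'n^'n" where
  "gauge_Q M z y =
     var_hessian M (\<lambda>y. \<Sum>e\<in>cells M. quad_int M e (\<lambda>\<xi>. Jf M z e \<xi> \<bullet>\<bullet> cof (Jf M y e \<xi>))) y"

definition gauge_defect :: "('e, 'n::finite) fe_model \<Rightarrow> (real^3 \<Rightarrow> real^3) \<Rightarrow> (real^3 \<Rightarrow> real^3) \<Rightarrow> real^'n^'n" where
  "gauge_defect M z y = gauge_Q M z y - gauge_I M z y"


section \<open>Stored energy\<close>

definition W_iso :: "real \<Rightarrow> real \<Rightarrow> real^3^3 \<Rightarrow> real" where
  "W_iso a b F = a * (det F powr (- 2 / 3) * (F \<bullet>\<bullet> F) - 3)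
               + b * (det F powr (- 4 / 3) * (cof F \<bullet>\<bullet> cof F) - 3)"

definition vol_constraint :: "('e, 'n::finite) fe_model \<Rightarrow> 'e \<Rightarrow> (real^3 \<Rightarrow> real^3) \<Rightarrow> real" where
  "vol_constraint M e y = quad_int M e (\<lambda>\<xi>. det (Jf M y e \<xi>) - det (JX M e \<xi>))"

definition energy :: "('e, 'n::finite) fe_model \<Rightarrow> (real^3 \<Rightarrow> real^3) \<Rightarrow> real" where
  "energy M y =
     (\<Sum>e\<in>cells M. quad_int M e (\<lambda>\<xi>. det (JX M e \<xi>) * W_iso (c1 M e) (c2 M e) (defgrad M y e \<xi>)))
   + (\<Sum>e\<in>cells M. kappa M e / (2 * VQ M e) * (vol_constraint M e y)\<^sup>2)"

definition K_h :: "('e, 'n::finite) fe_model \<Rightarrow> (real^3 \<Rightarrow> real^3) \<Rightarrow> real^'n^'n" where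
  "K_h M y = var_hessian M (energy M) y"

text \<open>The energy only sees the deformation gradient at the quadrature nodes.\<close>

definition admissible_deformation :: "('e, 'n::finite) fe_model \<Rightarrow> (real^3 \<Rightarrow> real^3) \<Rightarrow> bool" where
  "admissible_deformation M y \<longleftrightarrow> regular_field M y \<and>
     (\<forall>e\<in>cells M. \<forall>q<qnum M e. det (defgrad M y e (qnode M e q)) > 0)"


section \<open>The symmetric four-point rule on the parent tetrahedron\<close>

definition T_hat :: "(real^3) set" where
  "T_hat = {\<xi>. (\<forall>i. \<xi> $ i \<ge> 0) \<and> \<xi> $ 1 + \<xi> $ 2 + \<xi> $ 3 \<le> 1}"

definition tet_vertex :: "nat \<Rightarrow> real^3" where
  "tet_vertex m = [0, axis 1 1, axis 2 1, axis 3 1] ! m"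

definition Q4_node :: "nat \<Rightarrow> real^3" where
  "Q4_node q = (\<Sum>m<4. (if m = q then (5 + 3 * sqrt 5) / 20 else (5 - sqrt 5) / 20) *\<^sub>R tet_vertex m)"

definition Q4 :: "(real^3 \<Rightarrow> real) \<Rightarrow> real" where
  "Q4 = quad 4 (\<lambda>q. 1 / 24) Q4_node"

definition poly_fields :: "nat \<Rightarrow> (real^3 \<Rightarrow> real^3) set" where
  "poly_fields r = {f. \<forall>l. \<exists>c :: nat \<Rightarrow> nat \<Rightarrow> nat \<Rightarrow> real. \<forall>x.
     f x $ l = (\<Sum>(i, j, k) \<in> {(i, j, k). i + j + k \<le> r}. c i j k * x $ 1 ^ i * x $ 2 ^ j * x $ 3 ^ k)}"

end

theory Submission
  imports Defs
begin

text \<open>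
  The integrand \<open>J\<^sub>z : (J\<^sub>u \<times> J\<^sub>v)\<close> is a signed sum of triple products \<open>\<nabla>a \<bullet> (\<nabla>b \<times> \<nabla>c)\<close> of gradients of
  components, and it is multiplied by the Jacobian determinant under a change of variables. Summed over
  the cells, the difference of two potentials with the same trace therefore contributes integrals of
  \<open>\<nabla>a \<bullet> (\<nabla>b \<times> \<nabla>c)\<close> over the domain with \<open>a\<close> vanishing on its boundary. With difference quotients in place
  of gradients, and suitably shifted arguments, such an integral is exactly zero; since the fields are Lipschitz
  and differentiable almost everywhere, dominated convergence gives the same for the gradients. Only first
  derivatives occur, and no boundary integrals. Compatibility says that the Hessians of the quadrature
  and of the exact functional agree, which reduces (b) and (c) to (a).

  For (d), the four-point rule is exact on quadratic polynomials, so only the constant Hessians of the three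
  fields enter the defect, through a trilinear form that is nondegenerate in its first argument.
\<close>

section \<open>Triple products of matrix rows\<close>


text \<open>The classical argument, that the divergence of \<open>a\<close> times the cross product
  of the gradients of \<open>b\<close> and \<open>c\<close> is their triple product, uses second
  derivatives of \<open>b\<close> and \<open>c\<close>; here the gradients are only continuous on
  each cell and may jump across faces. Finite differences turn the product rule into an exact
  algebraic identity, and the price is a bound on the difference quotients that is uniform in the
  step. This bound shapes the proof. It needs Lipschitz estimates along segments of the domain
  although cell images are curved, which come from a two-sided Lipschitz estimate for the cell maps.
  It also needs care at the boundary, where the zero extensions of \<open>b\<close> and
  \<open>c\<close> may jump: \<open>a\<close> is cut off in a layer whose width is proportional to
  the step. One-sidedness of a Lipschitz domain rules out slits, across which an open cell image
  could extend. On the tetrahedron everything hinges on one number, the error (3 sqrt 5 - 5) / 4800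
  of the rule on the cube of a coordinate, which is not zero.\<close>

lemma frob_eq_sum_rows: "A \<bullet>\<bullet> B = (\<Sum>l\<in>UNIV. A $ l \<bullet> B $ l)"
  unfolding frob_def trace_def transpose_def matrix_matrix_mult_def inner_vec_def
  by (subst sum.swap) simp

text \<open>At \<open>l = 3\<close> the cyclic successors \<open>l + 1\<close> and
  \<open>l + 2\<close> appear as the numerals 4 and 5.\<close>

lemma three_wraparound: "(4::3) = 1" "(5::3) = 2"
  by simp_all

lemma cross_mat_row:
  "(A \<times>\<times> B) $ l = cross3 (A $ (l + 1)) (B $ (l + 2)) + cross3 (B $ (l + 1)) (A $ (l + 2))"
  by (simp add: vec_eq_iff forall_3 cross_mat_def cof_def cross3_def vector_def three_wraparound algebra_simps)

lemma cof_row: "cof A $ l = cross3 (A $ (l + 1)) (A $ (l + 2))"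
  by (simp add: vec_eq_iff forall_3 cof_def cross3_def vector_def three_wraparound algebra_simps)

text \<open>Passage from matrices to scalar functions: for Jacobians, each summand is a triple
  product of gradients with one component taken from each field.\<close>

lemma frob_cross_mat:
  "A \<bullet>\<bullet> (B \<times>\<times> C) = (\<Sum>l\<in>UNIV. A $ l \<bullet> cross3 (B $ (l + 1)) (C $ (l + 2))
      + A $ l \<bullet> cross3 (C $ (l + 1)) (B $ (l + 2)))"
  by (simp add: frob_eq_sum_rows cross_mat_row inner_add_right)

lemma cross_mat_self: "A \<times>\<times> A = 2 *\<^sub>R cof A"
  by (simp add: vec_eq_iff cross_mat_row cof_row)

text \<open>Moving \<open>M\<close> to the other side of the inner product leaves
  \<open>transpose M *v cross3 (M *v b) (M *v c)\<close>, which is \<open>det M\<close> times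
  \<open>cross3 b c\<close>.\<close>

lemma triple_product_matrix_mult:
  "(M *v a) \<bullet> cross3 (M *v b) (M *v c) = det M * (a \<bullet> cross3 b c)"
proof -
  have "(M *v a) \<bullet> cross3 (M *v b) (M *v c) = a \<bullet> (transpose M *v cross3 (M *v b) (M *v c))"
    by (metis dot_lmul_matrix inner_commute transpose_matrix_vector)
  then show ?thesis by (simp only: cross_matrix_mult inner_scaleR_right)
qed

lemma matrix_mult_row: "((A :: real^'n^'m) ** X) $ l = transpose X *v (A $ l)"
  by (simp add: vec_eq_iff matrix_matrix_mult_def matrix_vector_mult_def transpose_def mult.commute[of "X $ _ $ _"])

text \<open>With the Jacobian of a cell map for \<open>X\<close>, the chain rule produces exactly
  the volume factor of the change of variables and no other metric term.\<close>

lemma frob_cross_mat_mult: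
  "(A ** X) \<bullet>\<bullet> ((B ** X) \<times>\<times> (C ** X)) = det X * (A \<bullet>\<bullet> (B \<times>\<times> C))"
  by (simp add: frob_cross_mat matrix_mult_row triple_product_matrix_mult sum_distrib_left distrib_left
      del: transpose_matrix_vector)

section \<open>Vanishing of the integral of a triple product of gradients\<close>

text \<open>\<open>cup b c s t x - cup b c t s x\<close> is the cubical cup product of the coboundaries of \<open>b\<close> and \<open>c\<close> on the
  parallelogram at \<open>x\<close> spanned by \<open>s\<close> and \<open>t\<close>. It is a cocycle, which is why its product with the coboundary
  of \<open>a\<close> telescopes.\<close>

definition cup :: "('a::real_vector \<Rightarrow> real) \<Rightarrow> ('a \<Rightarrow> real) \<Rightarrow> 'a \<Rightarrow> 'a \<Rightarrow> 'a \<Rightarrow> real" where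
  "cup b c s t x = (b (x + s) - b x) * (c (x + s + t) - c (x + s))"

text \<open>Discrete counterpart of the determinant of the three gradients, expanded along the
  gradient of \<open>a\<close>. Each face term sits at the far end of its edge, as the product rule
  in \<open>cup3_telescope\<close> requires.\<close>

definition cup3 :: "('a::real_vector \<Rightarrow> real) \<Rightarrow> ('a \<Rightarrow> real) \<Rightarrow> ('a \<Rightarrow> real) \<Rightarrow> 'a \<Rightarrow> 'a \<Rightarrow> 'a \<Rightarrow> 'a \<Rightarrow> real" where
  "cup3 a b c r s t x =
     (a (x + r) - a x) * (cup b c s t (x + r) - cup b c t s (x + r))
   + (a (x + s) - a x) * (cup b c t r (x + s) - cup b c r t (x + s))
   + (a (x + t) - a x) * (cup b c r s (x + t) - cup b c s r (x + t))"

text \<open>The brackets belong to the six faces of the parallelepiped spanned by \<open>r\<close>,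
  \<open>s\<close>, \<open>t\<close>: the exterior derivative of a wedge of two differentials
  vanishes, here without any limit.\<close>

lemma cup_closed:
  "(cup b c s t x - cup b c t s x) - (cup b c s t (x + r) - cup b c t s (x + r))
   + ((cup b c t r x - cup b c r t x) - (cup b c t r (x + s) - cup b c r t (x + s)))
   + ((cup b c r s x - cup b c s r x) - (cup b c r s (x + t) - cup b c s r (x + t))) = 0"
  unfolding cup_def by (simp add: algebra_simps)

text \<open>Discrete product rule: for a face term \<open>g\<close>, the shift difference of
  \<open>a * g\<close> is the difference of \<open>a\<close> times the shifted \<open>g\<close>,
  plus \<open>a x\<close> times the difference of \<open>g\<close>. The latter parts cancel by
  \<open>cup_closed\<close>.\<close>

lemma cup3_telescope:
  "cup3 a b c r s t x =
     (a (x + r) * (cup b c s t (x + r) - cup b c t s (x + r)) - a x * (cup b c s t x - cup b c t s x))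
   + (a (x + s) * (cup b c t r (x + s) - cup b c r t (x + s)) - a x * (cup b c t r x - cup b c r t x))
   + (a (x + t) * (cup b c r s (x + t) - cup b c s r (x + t)) - a x * (cup b c r s x - cup b c s r x))"
  using arg_cong[OF cup_closed[of b c s t x r], of "\<lambda>y. a x * y"]
  unfolding cup3_def by (simp add: algebra_simps)

section \<open>Exact vanishing of the discrete integral\<close>

lemma has_integral_shift_diff:
  fixes f :: "'a::euclidean_space \<Rightarrow> real"
  assumes "integrable lborel f"
  shows "((\<lambda>x. f (x + r) - f x) has_integral 0) UNIV"
proof -
  have i: "integrable lborel (\<lambda>x. f (r + x))"
    using assms by (subst (asm) lborel_distr_plus[symmetric, of r]) (rule integrable_distr; simp)
  have e: "(\<integral>x. f (r + x) \<partial>lborel) = (\<integral>x. f x \<partial>lborel)"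
    using assms by (subst (2) lborel_distr_plus[symmetric, of r]) (simp add: integral_distr)
  have "((\<lambda>x. f (r + x) - f x) has_integral (\<integral>x. f (r + x) - f x \<partial>lborel)) UNIV"
    using i assms by (intro has_integral_integral_lborel) auto
  with i assms e show ?thesis by (simp add: add.commute)
qed

lemma integrable_bounded_support:
  fixes f :: "'a::euclidean_space \<Rightarrow> real"
  assumes "f \<in> borel_measurable borel" "\<And>x. \<bar>f x\<bar> \<le> B" "bounded S" "\<And>x. x \<notin> S \<Longrightarrow> f x = 0"
  shows "integrable lborel f"
proof -
  obtain R where "\<forall>x\<in>S. norm x \<le> R" using assms(3) bounded_iff by blast
  then have R: "S \<subseteq> cball 0 R" by auto
  have "integrable lborel (\<lambda>x. indicator (cball 0 R) x *\<^sub>R B)"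
    by (intro borel_integrable_compact) auto
  then show ?thesis
  proof (rule Bochner_Integration.integrable_bound)
    show "AE x in lborel. norm (f x) \<le> norm (indicator (cball 0 R) x *\<^sub>R B)"
    proof (rule AE_I2)
      fix x
      show "norm (f x) \<le> norm (indicator (cball 0 R) x *\<^sub>R B)"
        using assms(2)[of x] assms(4)[of x] R by (cases "x \<in> S") auto
    qed
  qed (use assms(1) in simp)
qed

text \<open>Every telescoping product carries the factor \<open>a\<close>, so its bounded support
  makes the products integrable although \<open>b\<close> and \<open>c\<close> are merely
  bounded.\<close>

lemma has_integral_cup3:
  fixes a b c :: "'a::euclidean_space \<Rightarrow> real"
  assumes [measurable]: "a \<in> borel_measurable borel" "b \<in> borel_measurable borel" "c \<in> borel_measurable borel"
    and B: "\<And>x. \<bar>a x\<bar> \<le> B" "\<And>x. \<bar>b x\<bar> \<le> B" "\<And>x. \<bar>c x\<bar> \<le> B"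
    and S: "bounded S" "\<And>x. x \<notin> S \<Longrightarrow> a x = 0"
  shows "(cup3 a b c r s t has_integral 0) UNIV"
proof -
  have B0: "0 \<le> B" using B(1)[of 0] by simp
  have cup_bound: "\<bar>cup b c s t x\<bar> \<le> 2 * B * (2 * B)" for s t x
    unfolding cup_def abs_mult
    by (intro mult_mono) (use B(2)[of x] B(2)[of "x + s"] B(3)[of "x + s"] B(3)[of "x + s + t"] B0 in auto)
  have "integrable lborel (\<lambda>x. a x * (cup b c s t x - cup b c t s x))" for s t
  proof (rule integrable_bounded_support[OF _ _ S(1)])
    show "\<bar>a x * (cup b c s t x - cup b c t s x)\<bar> \<le> B * (2 * (2 * B * (2 * B)))" for x
      unfolding abs_mult using B(1)[of x] cup_bound[of s t x] cup_bound[of t s x] B0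
      by (intro mult_mono) auto
  qed (use S(2) in \<open>auto simp: cup_def\<close>)
  note h = has_integral_shift_diff[OF this]
  have "cup3 a b c r s t = (\<lambda>x.
     (a (x + r) * (cup b c s t (x + r) - cup b c t s (x + r)) - a x * (cup b c s t x - cup b c t s x))
   + (a (x + s) * (cup b c t r (x + s) - cup b c r t (x + s)) - a x * (cup b c t r x - cup b c r t x))
   + (a (x + t) * (cup b c r s (x + t) - cup b c s r (x + t)) - a x * (cup b c r s x - cup b c s r x)))"
    using cup3_telescope by blast
  then show ?thesis
    using has_integral_add[OF has_integral_add[OF h[of r s t] h[of s t r]] h[of t r s]] by simp
qed


text \<open>The base point moves with the step, so this is not the definition of the derivative. It
  is the difference of the quotients in the directions \<open>u + v\<close> and \<open>u\<close>,
  both based at \<open>x\<close>; hence differentiability at the single point \<open>x\<close>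
  suffices.\<close>

lemma has_derivative_difference_quotient:
  fixes f :: "'a::real_normed_vector \<Rightarrow> real"
  assumes f: "(f has_derivative D) (at x)" and h: "h \<longlonglongrightarrow> 0" "\<And>n. h n \<noteq> 0"
  shows "(\<lambda>n. (f (x + h n *\<^sub>R (u + v)) - f (x + h n *\<^sub>R u)) / h n) \<longlonglongrightarrow> D v"
proof -
  have q: "(\<lambda>n. (f (x + h n *\<^sub>R w) - f x) / h n) \<longlonglongrightarrow> D w" for w
  proof -
    have "((\<lambda>t. f (x + t *\<^sub>R w)) has_derivative (\<lambda>t. D (t *\<^sub>R w))) (at 0)"
      by (rule has_derivative_compose[of "\<lambda>t. x + t *\<^sub>R w" "\<lambda>t. t *\<^sub>R w" 0 UNIV f D])
         (use f in \<open>auto intro!: derivative_eq_intros\<close>)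
    then have "((\<lambda>t. f (x + t *\<^sub>R w)) has_field_derivative D w) (at 0)"
      using has_derivative_linear[OF f] by (simp add: has_field_derivative_def linear_cmul mult_commute_abs)
    then have "((\<lambda>t. (f (x + t *\<^sub>R w) - f x) / t) \<longlongrightarrow> D w) (at 0)"
      by (simp add: has_field_derivative_iff)
    moreover have "filterlim h (at 0) sequentially"
      using h by (intro filterlim_atI) auto
    ultimately show ?thesis by (rule filterlim_compose)
  qed
  have "D (u + v) - D u = D v"
    using linear_add[OF has_derivative_linear[OF f]] by simp
  then show ?thesis
    using tendsto_diff[OF q[of "u + v"] q[of u]] by (simp add: diff_divide_distrib)
qed

text \<open>The Lipschitz hypotheses are asymmetric with zero extensions in mind: \<open>a\<close>
  remains Lipschitz across the boundary, whereas \<open>b\<close> and \<open>c\<close> may jump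
  there and are controlled only along segments inside \<open>\<Omega>\<close>.\<close>

lemma has_integral_triple_gradient_zero:
  fixes a b c :: "real^3 \<Rightarrow> real"
  assumes \<Omega>: "open \<Omega>" "bounded \<Omega>"
    and meas: "a \<in> borel_measurable borel" "b \<in> borel_measurable borel" "c \<in> borel_measurable borel"
    and B: "\<And>x. \<bar>a x\<bar> \<le> B" "\<And>x. \<bar>b x\<bar> \<le> B" "\<And>x. \<bar>c x\<bar> \<le> B"
    and a0: "\<And>x. x \<notin> \<Omega> \<Longrightarrow> a x = 0"
    and La: "\<And>x y. \<bar>a x - a y\<bar> \<le> L * dist x y"
    and Lb: "\<And>x y. closed_segment x y \<subseteq> \<Omega> \<Longrightarrow> \<bar>b x - b y\<bar> \<le> L * dist x y"
    and Lc: "\<And>x y. closed_segment x y \<subseteq> \<Omega> \<Longrightarrow> \<bar>c x - c y\<bar> \<le> L * dist x y"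
    and N: "negligible N"
    and da: "\<And>x. x \<in> \<Omega> - N \<Longrightarrow> (a has_derivative (\<lambda>v. a' x \<bullet> v)) (at x)"
    and db: "\<And>x. x \<in> \<Omega> - N \<Longrightarrow> (b has_derivative (\<lambda>v. b' x \<bullet> v)) (at x)"
    and dc: "\<And>x. x \<in> \<Omega> - N \<Longrightarrow> (c has_derivative (\<lambda>v. c' x \<bullet> v)) (at x)"
  shows "((\<lambda>x. a' x \<bullet> cross3 (b' x) (c' x)) has_integral 0) \<Omega>"
proof -
  define \<delta> where "\<delta> x = infdist x (- \<Omega>)" for x
  have \<delta>_diff: "\<delta> x \<le> \<delta> y + dist x y" for x y
    unfolding \<delta>_def by (rule infdist_triangle)
  have compl: "- \<Omega> \<noteq> {}" "closed (- \<Omega>)"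
    using \<Omega> not_bounded_UNIV by (metis Compl_empty_eq double_complement) (use \<Omega> in auto)
  have in_\<Omega>: "y \<in> \<Omega>" if "dist x y < \<delta> x" for x y
    using that infdist_le[of y "- \<Omega>" x] unfolding \<delta>_def by force
  have a_le: "\<bar>a x\<bar> \<le> L * \<delta> x" for x
  proof -
    obtain p where "p \<in> - \<Omega>" "infdist x (- \<Omega>) = dist x p"
      using infdist_attains_inf compl by blast
    then show ?thesis using La[of x p] a0[of p] by (simp add: \<delta>_def)
  qed
  have L0: "0 \<le> L"
    using La[of 0 "axis 1 1"] by (simp add: dist_norm)
  \<comment> \<open>Where \<open>cut h\<close> varies over a step of length \<open>h\<close>, all points within \<open>3 * h\<close> lie in the domain, so the
    Lipschitz bounds apply to \<open>b\<close> and \<open>c\<close>; since \<open>\<bar>a\<bar> \<le> L * \<delta>\<close>, the jump of the cut-off is still of order \<open>h\<close>.\<close>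
  define cut where "cut h x = (if 4 * h < \<delta> x then a x else 0)" for h x
  \<comment> \<open>In the mixed cases one end is within \<open>4 * h\<close> of the complement, so
    the other is within \<open>5 * h\<close>, and there \<open>a_le\<close> bounds the jump by
    \<open>5 * (L * h)\<close>.\<close>
  have cut_diff: "\<bar>cut h (x + r) - cut h x\<bar> \<le> 5 * (L * h)" if "norm r \<le> h" for h x r
  proof -
    have h0: "0 \<le> h" using that norm_ge_zero order_trans by blast
    have r: "dist (x + r) x \<le> h" "dist x (x + r) \<le> h" using that by (auto simp: dist_norm)
    consider "4 * h < \<delta> x" "4 * h < \<delta> (x + r)" | "\<not> 4 * h < \<delta> x" "4 * h < \<delta> (x + r)"
      | "4 * h < \<delta> x" "\<not> 4 * h < \<delta> (x + r)" | "\<not> 4 * h < \<delta> x" "\<not> 4 * h < \<delta> (x + r)"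
      by blast
    then show ?thesis
    proof cases
      case 1
      have "\<bar>a (x + r) - a x\<bar> \<le> L * h"
        using La[of "x + r" x] mult_left_mono[OF r(1) L0] by linarith
      moreover have "0 \<le> L * h" using h0 L0 by simp
      ultimately show ?thesis using 1 by (simp add: cut_def)
    next
      case 2
      then have "\<delta> (x + r) \<le> 5 * h" using \<delta>_diff[of "x + r" x] r by simp
      then show ?thesis
        using 2 a_le[of "x + r"] mult_left_mono[OF _ L0, of "\<delta> (x + r)" "5 * h"] by (simp add: cut_def)
    next
      case 3
      then have "\<delta> x \<le> 5 * h" using \<delta>_diff[of x "x + r"] r by simp
      then show ?thesis
        using 3 a_le[of x] mult_left_mono[OF _ L0, of "\<delta> x" "5 * h"] by (simp add: cut_def)
    next
      case 4
      then show ?thesis using h0 L0 by (simp add: cut_def)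
    qed
  qed
  \<comment> \<open>One step is lost from the threshold \<open>4 * h\<close> when only the far end
    passes it; the remaining \<open>3 * h\<close> covers the three steps \<open>r\<close>,
    \<open>s\<close>, \<open>t\<close> together.\<close>
  have near: "cball x (3 * h) \<subseteq> \<Omega>" if "norm r \<le> h" "cut h (x + r) \<noteq> cut h x" for h x r
  proof -
    have "4 * h < \<delta> x \<or> 4 * h < \<delta> (x + r)" using that(2) by (auto simp: cut_def split: if_splits)
    moreover have "\<delta> (x + r) \<le> \<delta> x + h" using \<delta>_diff[of "x + r" x] that(1) by (simp add: dist_norm)
    ultimately have "3 * h < \<delta> x" using that(1) norm_ge_zero[of r] by linarith
    then show ?thesis using in_\<Omega>[of x] by fastforce
  qed
  \<comment> \<open>The order \<open>h ^ 3\<close> matches the division in \<open>F\<close> below.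
    The 10 is 5 for the jump of the cut-off times 2 for the two cup products, each at most
    \<open>(L * h) * (L * h)\<close>.\<close>
  have term_bound: "\<bar>(cut h (x + r) - cut h x) * (cup b c s t (x + r) - cup b c t s (x + r))\<bar>
      \<le> 10 * (L * h) ^ 3 * indicator \<Omega> x" if rst: "norm r \<le> h" "norm s \<le> h" "norm t \<le> h" for h x r s t
  proof (cases "cut h (x + r) = cut h x")
    case True
    then show ?thesis using L0 order_trans[OF norm_ge_zero rst(1)] by simp
  next
    case False
    have h0: "0 \<le> h" using that norm_ge_zero order_trans by blast
    note ball = near[OF rst(1) False]
    have dist_r: "norm (x - (x + r)) \<le> 3 * h" using rst h0 by simp
    have dist_rs: "norm (x - (x + r + s)) \<le> 3 * h" if "norm s \<le> h" for s
    proof -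
      have "x - (x + r + s) = - (r + s)" by simp
      then have "norm (x - (x + r + s)) = norm (r + s)" by (simp only: norm_minus_cancel)
      then show ?thesis using that rst h0 norm_triangle_ineq[of r s] by linarith
    qed
    have dist_rst: "norm (x - (x + r + s + t)) \<le> 3 * h" if "norm s \<le> h" "norm t \<le> h" for s t
    proof -
      have "x - (x + r + s + t) = - (r + s + t)" by simp
      then have "norm (x - (x + r + s + t)) = norm (r + s + t)" by (simp only: norm_minus_cancel)
      then show ?thesis using that rst h0 norm_triangle_ineq[of r s] norm_triangle_ineq[of "r + s" t] by linarith
    qed
    have seg: "closed_segment p q \<subseteq> \<Omega>" if "norm (x - p) \<le> 3 * h" "norm (x - q) \<le> 3 * h" for p q
      using closed_segment_subset[of p "cball x (3 * h)" q] that ball by (auto simp: dist_norm)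
    have cup_le: "\<bar>cup b c s t (x + r)\<bar> \<le> (L * h) * (L * h)" if st: "norm s \<le> h" "norm t \<le> h" for s t
    proof -
      have "\<bar>b (x + r + s) - b (x + r)\<bar> \<le> L * norm s"
        using Lb[OF seg[OF dist_rs[OF st(1)] dist_r]] by (simp add: dist_norm)
      moreover have "\<bar>c (x + r + s + t) - c (x + r + s)\<bar> \<le> L * norm t"
        using Lc[OF seg[OF dist_rst[OF st] dist_rs[OF st(1)]]] by (simp add: dist_norm)
      moreover have "L * norm s \<le> L * h" "L * norm t \<le> L * h" using st L0 by (auto intro: mult_left_mono)
      ultimately show ?thesis
        unfolding cup_def abs_mult by (intro mult_mono) (use L0 h0 in auto)
    qed
    have "\<bar>cup b c s t (x + r) - cup b c t s (x + r)\<bar> \<le> 2 * ((L * h) * (L * h))"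
      using cup_le[OF rst(2,3)] cup_le[OF rst(3,2)] by linarith
    then have "\<bar>(cut h (x + r) - cut h x) * (cup b c s t (x + r) - cup b c t s (x + r))\<bar>
        \<le> (5 * (L * h)) * (2 * ((L * h) * (L * h)))"
      unfolding abs_mult using cut_diff[OF rst(1)] L0 h0 by (intro mult_mono) auto
    moreover have "x \<in> \<Omega>" using ball h0 by auto
    ultimately show ?thesis by (simp add: power3_eq_cube algebra_simps)
  qed
  let ?e = "\<lambda>i. axis i 1 :: real^3"
  define F where "F h x = cup3 (cut h) b c (h *\<^sub>R ?e 1) (h *\<^sub>R ?e 2) (h *\<^sub>R ?e 3) x / h ^ 3" for h x
  \<comment> \<open>Three summands of size 10 each; after division the bound is independent of
    \<open>h\<close>, as dominated convergence requires.\<close>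
  have F_bound: "\<bar>F h x\<bar> \<le> 30 * L ^ 3 * indicator \<Omega> x" if "0 < h" for h x
  proof -
    have "\<bar>cup3 (cut h) b c (h *\<^sub>R ?e 1) (h *\<^sub>R ?e 2) (h *\<^sub>R ?e 3) x\<bar> \<le> 30 * (L * h) ^ 3 * indicator \<Omega> x"
    proof -
      have three: "\<bar>u + v + w\<bar> \<le> 3 * b" if "\<bar>u\<bar> \<le> b" "\<bar>v\<bar> \<le> b" "\<bar>w\<bar> \<le> b" for u v w b :: real
        using that by linarith
      have e: "norm (h *\<^sub>R ?e i) \<le> h" for i using \<open>0 < h\<close> by simp
      show ?thesis
        unfolding cup3_def
        using three[OF term_bound[OF e[of 1] e[of 2] e[of 3]] term_bound[OF e[of 2] e[of 3] e[of 1]]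
          term_bound[OF e[of 3] e[of 1] e[of 2]], of x] by (simp add: mult.assoc)
    qed
    then show ?thesis
      using that by (simp add: F_def abs_mult power_mult_distrib divide_le_eq algebra_simps)
  qed
  have F_int: "(F h has_integral 0) \<Omega>" if "0 < h" for h
  proof -
    \<comment> \<open>\<open>cut h\<close> may jump where \<open>\<delta>\<close> equals
      \<open>4 * h\<close>; \<open>has_integral_cup3\<close> asks only for measurability and
      bounds.\<close>
    have "cut h \<in> borel_measurable borel"
    proof -
      have "continuous_on UNIV \<delta>" unfolding \<delta>_def by (intro continuous_intros)
      then have "\<delta> \<in> borel_measurable borel" by (rule borel_measurable_continuous_onI)
      with meas(1) show ?thesis unfolding cut_def by measurable
    qed
    moreover have "\<bar>cut h x\<bar> \<le> B" for x using B(1)[of x] by (auto simp: cut_def)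
    moreover have "cut h x = 0" if "x \<notin> \<Omega>" for x using a0[OF that] by (simp add: cut_def)
    ultimately have "(cup3 (cut h) b c (h *\<^sub>R ?e 1) (h *\<^sub>R ?e 2) (h *\<^sub>R ?e 3) has_integral 0) UNIV"
      by (intro has_integral_cup3[where S = \<Omega> and B = B] meas B \<Omega>) auto
    then have "(F h has_integral 0) UNIV"
      unfolding F_def by (drule_tac has_integral_divide[where c = "h ^ 3"]) simp
    moreover have "F h x = 0" if "x \<notin> \<Omega>" for x
      using F_bound[OF \<open>0 < h\<close>, of x] that by simp
    then have "{x. x \<notin> \<Omega> \<and> F h x \<noteq> 0} = {}" by auto
    ultimately show ?thesis
      using has_integral_spike_set_eq[of UNIV \<Omega> "F h" 0] by simp
  qed
  define h where "h n = inverse (real (Suc n))" for n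
  have h: "h \<longlonglongrightarrow> 0" "\<And>n. 0 < h n"
    using LIMSEQ_inverse_real_of_nat by (simp_all add: h_def[abs_def])
  have F_lim: "(\<lambda>n. F (h n) x) \<longlonglongrightarrow> a' x \<bullet> cross3 (b' x) (c' x)" if x: "x \<in> \<Omega> - N" for x
  proof -
    have hn: "\<And>n. h n \<noteq> 0" using h(2) by (metis less_irrefl)
    have \<delta>x: "0 < \<delta> x" unfolding \<delta>_def using x compl by (intro infdist_pos_not_in_closed) auto
    \<comment> \<open>A fifth leaves distance more than \<open>4 * h n\<close> after one step, so
      the cut-off is inactive at all four points where \<open>cup3\<close> evaluates its first
      argument.\<close>
    have "\<forall>\<^sub>F n in sequentially. h n < \<delta> x / 5" using h(1) \<delta>x by (intro order_tendstoD) auto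
    then have cut_eq: "\<forall>\<^sub>F n in sequentially. cut (h n) x = a x \<and> (\<forall>i. cut (h n) (x + h n *\<^sub>R ?e i) = a (x + h n *\<^sub>R ?e i))"
    proof eventually_elim
      case (elim n)
      have "4 * h n < \<delta> (x + h n *\<^sub>R ?e i)" for i
        using \<delta>_diff[of x "x + h n *\<^sub>R ?e i"] elim h(2)[of n] by (simp add: dist_norm)
      then show ?case using elim h(2)[of n] by (simp add: cut_def)
    qed
    note qa = has_derivative_difference_quotient[OF da[OF x] h(1) hn, of 0, simplified]
    note qb = has_derivative_difference_quotient[OF db[OF x] h(1) hn]
    note qc = has_derivative_difference_quotient[OF dc[OF x] h(1) hn]
    have summand: "(\<lambda>n. (a (x + h n *\<^sub>R r) - a x) * (cup b c (h n *\<^sub>R s) (h n *\<^sub>R t) (x + h n *\<^sub>R r)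
          - cup b c (h n *\<^sub>R t) (h n *\<^sub>R s) (x + h n *\<^sub>R r)) / h n ^ 3)
        \<longlonglongrightarrow> (a' x \<bullet> r) * ((b' x \<bullet> s) * (c' x \<bullet> t) - (b' x \<bullet> t) * (c' x \<bullet> s))" for r s t
    proof -
      have "(\<lambda>n. (a (x + h n *\<^sub>R r) - a x) / h n *
           ((b (x + h n *\<^sub>R (r + s)) - b (x + h n *\<^sub>R r)) / h n * ((c (x + h n *\<^sub>R (r + s + t)) - c (x + h n *\<^sub>R (r + s))) / h n)
          - (b (x + h n *\<^sub>R (r + t)) - b (x + h n *\<^sub>R r)) / h n * ((c (x + h n *\<^sub>R (r + t + s)) - c (x + h n *\<^sub>R (r + t))) / h n)))
        \<longlonglongrightarrow> (a' x \<bullet> r) * ((b' x \<bullet> s) * (c' x \<bullet> t) - (b' x \<bullet> t) * (c' x \<bullet> s))"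
        by (intro tendsto_intros qa qb qc)
      moreover have "(a (x + h n *\<^sub>R r) - a x) / h n *
           ((b (x + h n *\<^sub>R (r + s)) - b (x + h n *\<^sub>R r)) / h n * ((c (x + h n *\<^sub>R (r + s + t)) - c (x + h n *\<^sub>R (r + s))) / h n)
          - (b (x + h n *\<^sub>R (r + t)) - b (x + h n *\<^sub>R r)) / h n * ((c (x + h n *\<^sub>R (r + t + s)) - c (x + h n *\<^sub>R (r + t))) / h n))
        = (a (x + h n *\<^sub>R r) - a x) * (cup b c (h n *\<^sub>R s) (h n *\<^sub>R t) (x + h n *\<^sub>R r)
          - cup b c (h n *\<^sub>R t) (h n *\<^sub>R s) (x + h n *\<^sub>R r)) / h n ^ 3" for n
      proof -
        have "A / h n * (B / h n * (C / h n) - D / h n * (E / h n)) = A * (B * C - D * E) / h n ^ 3" for A B C D E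
          by (simp add: power3_eq_cube diff_divide_distrib right_diff_distrib)
        then show ?thesis by (simp add: cup_def scaleR_add_right add.assoc)
      qed
      ultimately show ?thesis by simp
    qed
    have "(\<lambda>n. cup3 a b c (h n *\<^sub>R ?e 1) (h n *\<^sub>R ?e 2) (h n *\<^sub>R ?e 3) x / h n ^ 3)
        \<longlonglongrightarrow> a' x \<bullet> cross3 (b' x) (c' x)"
    proof -
      have lim: "(a' x \<bullet> ?e 1) * ((b' x \<bullet> ?e 2) * (c' x \<bullet> ?e 3) - (b' x \<bullet> ?e 3) * (c' x \<bullet> ?e 2))
        + (a' x \<bullet> ?e 2) * ((b' x \<bullet> ?e 3) * (c' x \<bullet> ?e 1) - (b' x \<bullet> ?e 1) * (c' x \<bullet> ?e 3))
        + (a' x \<bullet> ?e 3) * ((b' x \<bullet> ?e 1) * (c' x \<bullet> ?e 2) - (b' x \<bullet> ?e 2) * (c' x \<bullet> ?e 1))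
        = a' x \<bullet> cross3 (b' x) (c' x)"
        unfolding inner_axis by (simp add: cross3_def inner_vec_def sum_3)
      show ?thesis
        unfolding cup3_def add_divide_distrib lim[symmetric]
        by (intro tendsto_add summand)
    qed
    moreover have "\<forall>\<^sub>F n in sequentially. F (h n) x
        = cup3 a b c (h n *\<^sub>R ?e 1) (h n *\<^sub>R ?e 2) (h n *\<^sub>R ?e 3) x / h n ^ 3"
      using cut_eq by eventually_elim (simp add: F_def cup3_def)
    ultimately show ?thesis using tendsto_cong by force
  qed
  have spike: "(f has_integral y) (\<Omega> - N) \<longleftrightarrow> (f has_integral y) \<Omega>" for f :: "real^3 \<Rightarrow> real" and y
    by (rule has_integral_spike_set_eq) (auto intro: negligible_subset[OF N])
  have F_int': "(F (h n) has_integral 0) (\<Omega> - N)" for n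
    using F_int[OF h(2)] spike by blast
  have dom: "(\<lambda>x. 30 * L ^ 3 * indicator \<Omega> x) integrable_on (\<Omega> - N)"
  proof -
    have "\<Omega> \<in> lmeasurable" using \<Omega> by (simp add: lmeasurable_open)
    then have "(\<lambda>x. 1::real) integrable_on \<Omega>" by (rule integrable_on_const)
    then have "(\<lambda>x. 30 * L ^ 3 * 1) integrable_on \<Omega>" by (rule integrable_on_mult_right)
    then have "(\<lambda>x. 30 * L ^ 3 * indicator \<Omega> x) integrable_on \<Omega>"
      by (rule integrable_eq) simp
    then show ?thesis using spike unfolding integrable_on_def by blast
  qed
  note conv = dominated_convergence[where f = "\<lambda>n. F (h n)", OF has_integral_integrable[OF F_int'] dom _ F_lim]
  have le: "norm (F (h n) x) \<le> 30 * L ^ 3 * indicator \<Omega> x" for n x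
    using F_bound[OF h(2)] by simp
  have "integral (\<Omega> - N) (\<lambda>x. a' x \<bullet> cross3 (b' x) (c' x)) = 0"
    using conv(2)[OF le] by (simp add: integral_unique[OF F_int'] LIMSEQ_const_iff)
  then have "((\<lambda>x. a' x \<bullet> cross3 (b' x) (c' x)) has_integral 0) (\<Omega> - N)"
    using integrable_integral[OF conv(1)[OF le]] by simp
  then show ?thesis using spike by blast
qed


section \<open>Continuously differentiable maps on convex sets\<close>

text \<open>At a boundary point not every direction points into \<open>K\<close>. Segments determine
  the derivative on all \<open>y - x\<close> with \<open>y \<in> K\<close>; since \<open>K\<close>
  contains a ball, every vector is a multiple of a difference of two such directions, and linearity
  concludes.\<close>

lemma has_derivative_within_convex_unique:
  fixes f :: "'a::euclidean_space \<Rightarrow> 'b::real_normed_vector"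
  assumes K: "convex K" "interior K \<noteq> {}" "x \<in> K"
    and A: "(f has_derivative A) (at x within K)" and B: "(f has_derivative B) (at x within K)"
  shows "A = B"
proof -
  have dir: "A (y - x) = B (y - x)" if "y \<in> K" for y
  proof -
    have line: "(\<lambda>t. x + t *\<^sub>R (y - x)) ` {0..1} \<subseteq> K"
      using K(1) \<open>x \<in> K\<close> that by (auto simp: convex_alt algebra_simps)
    have "((\<lambda>t. f (x + t *\<^sub>R (y - x))) has_vector_derivative D (y - x)) (at 0 within {0..1})"
      if D: "(f has_derivative D) (at x within K)" for D
    proof -
      have "((\<lambda>t. f (x + t *\<^sub>R (y - x))) has_derivative (\<lambda>t. D (t *\<^sub>R (y - x)))) (at 0 within {0..1})"
        by (rule has_derivative_in_compose[of "\<lambda>t. x + t *\<^sub>R (y - x)"])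
           (use has_derivative_subset[OF D line] in \<open>auto intro!: derivative_eq_intros\<close>)
      then show ?thesis
        using linear_cmul[OF has_derivative_linear[OF D]] by (simp add: has_vector_derivative_def)
    qed
    from this[OF A] this[OF B] show ?thesis
      using vector_derivative_unique_within_closed_interval[of 0 1 0] by (simp add: box_real)
  qed
  obtain c e where e: "0 < e" "ball c e \<subseteq> K"
    using K(2) by (metis ex_in_conv mem_interior)
  have lin: "linear A" "linear B" using A B has_derivative_linear by blast+
  show ?thesis
  proof
    fix v :: 'a
    \<comment> \<open>Small enough to keep \<open>c + s *\<^sub>R v\<close> in the ball; the added 1
      covers \<open>v = 0\<close>.\<close>
    define s where "s = e / (2 * (norm v + 1))"
    have n: "0 < norm v + 1" using norm_ge_zero[of v] by linarith
    then have s0: "0 < s" using e by (simp add: s_def)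
    have "norm v < 2 * (norm v + 1)" using n by (simp add: add_pos_pos)
    then have "s * norm v < s * (2 * (norm v + 1))" using s0 by (rule mult_strict_left_mono)
    also have "\<dots> = e" using n by (simp add: s_def)
    finally have s: "0 < s" "s * norm v < e" using s0 by auto
    have "c \<in> K" "c + s *\<^sub>R v \<in> K" using e s by (auto simp: dist_norm)
    then have "A (c + s *\<^sub>R v - x) - A (c - x) = B (c + s *\<^sub>R v - x) - B (c - x)" using dir by simp
    then have "s *\<^sub>R A v = s *\<^sub>R B v"
      using lin by (simp add: linear_diff linear_add linear_cmul)
    then show "A v = B v" using s by simp
  qed
qed

text \<open>\<open>jacobian\<close> rests on a choice of derivative, so uniqueness is what allows
  computing it, also on the frontier of a cell, where quadrature nodes may lie.\<close>

lemma jacobian_within_convexI: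
  fixes f :: "real^'n \<Rightarrow> real^'m"
  assumes "convex K" "interior K \<noteq> {}" "x \<in> K" "(f has_derivative (\<lambda>v. A *v v)) (at x within K)"
  shows "jacobian f (at x within K) = A"
proof -
  have "(f has_derivative (\<lambda>v. jacobian f (at x within K) *v v)) (at x within K)"
    using assms(4) jacobian_works differentiableI by blast
  with assms have "(\<lambda>v. jacobian f (at x within K) *v v) = (\<lambda>v. A *v v)"
    by (intro has_derivative_within_convex_unique)
  then show ?thesis by (metis matrix_of_matrix_vector_mul)
qed

lemma jacobian_atI:
  fixes f :: "real^'n \<Rightarrow> real^'m"
  assumes "(f has_derivative (\<lambda>v. A *v v)) (at x)"
  shows "jacobian f (at x) = A"
  using jacobian_within_convexI[of UNIV x f A] assms by simp

lemma C1_on_has_derivative: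
  "C1_on K f \<Longrightarrow> \<xi> \<in> K \<Longrightarrow> (f has_derivative (\<lambda>v. jacobian f (at \<xi> within K) *v v)) (at \<xi> within K)"
  unfolding C1_on_def using jacobian_works by blast

lemma C1_on_continuous_jacobian: "C1_on K f \<Longrightarrow> continuous_on K (\<lambda>\<xi>. jacobian f (at \<xi> within K))"
  by (simp add: C1_on_def)

lemma C1_onI:
  assumes K: "convex K" "interior K \<noteq> {}"
    and f: "\<And>\<xi>. \<xi> \<in> K \<Longrightarrow> (f has_derivative (\<lambda>v. J \<xi> *v v)) (at \<xi> within K)" and J: "continuous_on K J"
  shows "C1_on K f"
proof -
  have "jacobian f (at \<xi> within K) = J \<xi>" if "\<xi> \<in> K" for \<xi>
    using jacobian_within_convexI[OF K that f[OF that]] .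
  with f J show ?thesis
    unfolding C1_on_def by (auto intro: differentiableI cong: continuous_on_cong)
qed

context
  fixes K :: "(real^3) set"
  assumes K: "convex K" "interior K \<noteq> {}"
begin

lemma jacobian_add_scaleR:
  assumes "C1_on K f" "C1_on K g" "\<xi> \<in> K"
  shows "jacobian (\<lambda>x. f x + r *\<^sub>R g x) (at \<xi> within K)
    = jacobian f (at \<xi> within K) + r *\<^sub>R jacobian g (at \<xi> within K)"
  using assms
  by (intro jacobian_within_convexI K)
     (auto intro!: derivative_eq_intros C1_on_has_derivative
        simp: matrix_vector_mult_add_rdistrib scaleR_matrix_vector_assoc)

lemma C1_on_add_scaleR:
  assumes "C1_on K f" "C1_on K g"
  shows "C1_on K (\<lambda>x. f x + r *\<^sub>R g x)"
proof (rule C1_onI[OF K])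
  show "((\<lambda>x. f x + r *\<^sub>R g x) has_derivative
      (\<lambda>v. (jacobian f (at \<xi> within K) + r *\<^sub>R jacobian g (at \<xi> within K)) *v v)) (at \<xi> within K)"
    if "\<xi> \<in> K" for \<xi>
    using assms that
    by (auto intro!: derivative_eq_intros C1_on_has_derivative
        simp: matrix_vector_mult_add_rdistrib scaleR_matrix_vector_assoc)
  show "continuous_on K (\<lambda>\<xi>. jacobian f (at \<xi> within K) + r *\<^sub>R jacobian g (at \<xi> within K))"
    using assms unfolding C1_on_def by (intro continuous_intros) auto
qed

lemma jacobian_cong_on:
  assumes "C1_on K g" "\<And>x. x \<in> K \<Longrightarrow> f x = g x" "\<xi> \<in> K"
  shows "jacobian f (at \<xi> within K) = jacobian g (at \<xi> within K)"
  by (rule jacobian_within_convexI[OF K assms(3)])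
     (rule has_derivative_transform[OF assms(3) _ C1_on_has_derivative[OF assms(1,3)]], use assms(2) in auto)

end

section \<open>Two-sided Lipschitz bounds for continuously differentiable maps\<close>

lemma norm_matrix_vector_mult_le:
  fixes A :: "real^'n^'m"
  shows "norm (A *v x) \<le> norm A * norm x"
proof -
  \<comment> \<open>The norm of a matrix is here the Frobenius norm, so Cauchy-Schwarz in each row
    suffices.\<close>
  have "norm (A *v x) \<le> L2_set (\<lambda>i. norm (A $ i) * norm x) UNIV"
    unfolding norm_vec_def[of "A *v x"]
    by (intro L2_set_mono) (auto simp: matrix_vector_mul_component Cauchy_Schwarz_ineq2)
  also have "\<dots> = norm A * norm x"
    unfolding norm_vec_def[of A] by (simp add: L2_set_left_distrib)
  finally show ?thesis .
qed

lemma onorm_matrix_le: "onorm (\<lambda>v. (A :: real^'n^'m) *v v) \<le> norm A"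
  by (rule onorm_le) (rule norm_matrix_vector_mult_le)

lemma C1_on_lipschitz:
  assumes K: "convex K" "compact K" and f: "C1_on K f"
  obtains L where "0 \<le> L" "\<And>x y. x \<in> K \<Longrightarrow> y \<in> K \<Longrightarrow> norm (f x - f y) \<le> L * norm (x - y)"
proof -
  have "compact ((\<lambda>\<xi>. jacobian f (at \<xi> within K)) ` K)"
    by (rule compact_continuous_image[OF C1_on_continuous_jacobian[OF f] K(2)])
  then obtain B where "\<forall>\<xi>\<in>K. norm (jacobian f (at \<xi> within K)) \<le> B"
    by (auto dest!: compact_imp_bounded simp: bounded_iff)
  then have B: "norm (jacobian f (at \<xi> within K)) \<le> B" if "\<xi> \<in> K" for \<xi>
    using that by blast
  have "norm (f x - f y) \<le> max 0 B * norm (x - y)" if "x \<in> K" "y \<in> K" for x y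
  proof (rule differentiable_bound[OF K(1), where f' = "\<lambda>\<xi> v. jacobian f (at \<xi> within K) *v v"])
    show "onorm ((*v) (jacobian f (at \<xi> within K))) \<le> max 0 B" if "\<xi> \<in> K" for \<xi>
      using onorm_matrix_le[of "jacobian f (at \<xi> within K)"] B[OF that] by linarith
  qed (use that C1_on_has_derivative[OF f] in auto)
  then show thesis using that[of "max 0 B"] by simp
qed

lemma matrix_inv_mult_left:
  assumes "invertible A"
  shows "matrix_inv A ** A = mat 1"
  using someI_ex[OF assms[unfolded invertible_def]] unfolding matrix_inv_def by simp

text \<open>Close pairs are separated because the map is nearly its linearization, which is bounded
  below; distant pairs are separated by injectivity and compactness. The result makes the inverse
  cell map Lipschitz on an image that need not be convex.\<close>

lemma C1_on_expanding:
  assumes K: "convex K" "compact K" and f: "C1_on K f" and inj: "inj_on f K"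
    and inv: "\<And>\<xi>. \<xi> \<in> K \<Longrightarrow> invertible (jacobian f (at \<xi> within K))"
    and B: "\<And>\<xi>. \<xi> \<in> K \<Longrightarrow> norm (matrix_inv (jacobian f (at \<xi> within K))) \<le> B"
  obtains m where "0 < m" "\<And>x y. x \<in> K \<Longrightarrow> y \<in> K \<Longrightarrow> m * norm (x - y) \<le> norm (f x - f y)"
proof -
  let ?J = "\<lambda>\<xi>. jacobian f (at \<xi> within K)"
  define b where "b = \<bar>B\<bar> + 1"
  have b: "0 < b" unfolding b_def by simp
  have lower: "norm v \<le> b * norm (?J \<xi> *v v)" if "\<xi> \<in> K" for \<xi> v
  proof -
    have "v = matrix_inv (?J \<xi>) *v (?J \<xi> *v v)"
      using matrix_inv_mult_left[OF inv[OF that]] by (simp add: matrix_vector_mul_assoc)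
    then have "norm v \<le> norm (matrix_inv (?J \<xi>)) * norm (?J \<xi> *v v)"
      by (metis norm_matrix_vector_mult_le)
    also have "\<dots> \<le> b * norm (?J \<xi> *v v)"
      using B[OF that] by (intro mult_right_mono) (auto simp: b_def)
    finally show ?thesis .
  qed
  have "uniformly_continuous_on K ?J"
    by (rule compact_uniformly_continuous[OF C1_on_continuous_jacobian[OF f] K(2)])
  \<comment> \<open>The tolerance is half of the lower bound \<open>1 / b\<close> given by
    \<open>lower\<close>, so the linearization error cannot cancel the linear part.\<close>
  then obtain d where d: "0 < d" "\<And>x y. x \<in> K \<Longrightarrow> y \<in> K \<Longrightarrow> dist y x < d \<Longrightarrow> dist (?J y) (?J x) < 1 / (2 * b)"
    unfolding uniformly_continuous_on_def using b by (metis zero_less_divide_1_iff zero_less_mult_iff zero_less_numeral)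
  have close: "1 / (2 * b) * norm (x - y) \<le> norm (f x - f y)"
    if xy: "x \<in> K" "y \<in> K" "norm (x - y) < d" for x y
  proof -
    have *: "x \<in> K \<inter> ball x d" "y \<in> K \<inter> ball x d" using xy d by (auto simp: dist_norm)
    have "norm (f y - f x - ?J x *v (y - x)) \<le> norm (y - x) * (1 / (2 * b))"
    proof (rule differentiable_bound_linearization[where S = "K \<inter> ball x d" and f' = "\<lambda>\<xi> v. ?J \<xi> *v v"])
      show "x + t *\<^sub>R (y - x) \<in> K \<inter> ball x d" if "t \<in> {0..1}" for t
      proof -
        have "convex (K \<inter> ball x d)" using K by (intro convex_Int) auto
        then have "(1 - t) *\<^sub>R x + t *\<^sub>R y \<in> K \<inter> ball x d" using * that by (intro convexD) auto
        then show ?thesis by (simp add: algebra_simps)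
      qed
      show "(f has_derivative (*v) (?J \<xi>)) (at \<xi> within K \<inter> ball x d)" if "\<xi> \<in> K \<inter> ball x d" for \<xi>
        using that C1_on_has_derivative[OF f] by (auto intro: has_derivative_subset)
      show "onorm ((*v) (?J \<xi>) - (*v) (?J x)) \<le> 1 / (2 * b)" if "\<xi> \<in> K \<inter> ball x d" for \<xi>
      proof -
        have "(*v) (?J \<xi>) - (*v) (?J x) = (\<lambda>v. (?J \<xi> - ?J x) *v v)"
          by (auto simp: fun_eq_iff matrix_vector_mult_diff_rdistrib)
        then show ?thesis
          using onorm_matrix_le[of "?J \<xi> - ?J x"] d(2)[of x \<xi>] that xy(1) by (simp add: dist_norm norm_minus_commute)
      qed
    qed (use * in auto)
    moreover have "norm (y - x) / b \<le> norm (?J x *v (y - x))"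
      using lower[OF xy(1), of "y - x"] b by (simp add: field_simps)
    moreover have "norm (?J x *v (y - x)) \<le> norm (f y - f x) + norm (f y - f x - ?J x *v (y - x))"
      using norm_triangle_ineq4[of "f y - f x" "f y - f x - ?J x *v (y - x)"] by simp
    ultimately have "norm (y - x) / b - norm (y - x) * (1 / (2 * b)) \<le> norm (f y - f x)"
      by linarith
    then show ?thesis using b by (simp add: norm_minus_commute field_simps)
  qed
  \<comment> \<open>The distant pairs: \<open>P\<close> is compact and avoids the diagonal, so the
    quotient of distances attains a positive minimum there.\<close>
  define P where "P = {p \<in> K \<times> K. d \<le> norm (fst p - snd p)}"
  have comp: "compact P"
  proof -
    have "P = (K \<times> K) \<inter> {p. d \<le> norm (fst p - snd p)}" by (auto simp: P_def)
    moreover have "closed {p :: (real^3) \<times> (real^3). d \<le> norm (fst p - snd p)}"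
      by (intro closed_Collect_le continuous_intros)
    ultimately show ?thesis using K by (simp add: compact_Times compact_Int_closed)
  qed
  have contf: "continuous_on K f"
    using C1_on_has_derivative[OF f] by (meson continuous_on_eq_continuous_within has_derivative_continuous)
  obtain m where m: "0 < m" "\<And>p. p \<in> P \<Longrightarrow> m * norm (fst p - snd p) \<le> norm (f (fst p) - f (snd p))"
  proof (cases "P = {}")
    case True then show ?thesis using that[of 1] by simp
  next
    case False
    have "continuous_on P (\<lambda>p. norm (f (fst p) - f (snd p)) / norm (fst p - snd p))"
      using d(1) by (intro continuous_intros continuous_on_compose2[OF contf]) (auto simp: P_def)
    then obtain q where q: "q \<in> P" "\<And>p. p \<in> P \<Longrightarrow> norm (f (fst q) - f (snd q)) / norm (fst q - snd q)
        \<le> norm (f (fst p) - f (snd p)) / norm (fst p - snd p)"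
      using continuous_attains_inf[OF comp False] by blast
    have qne: "0 < norm (fst q - snd q)" using q(1) d(1) by (auto simp: P_def)
    have "f (fst q) \<noteq> f (snd q)"
    proof
      assume eq: "f (fst q) = f (snd q)"
      have "fst q \<in> K" "snd q \<in> K" using q(1) by (auto simp: P_def)
      then have "fst q = snd q" by (rule inj_onD[OF inj eq])
      with qne show False by simp
    qed
    with qne have pos: "0 < norm (f (fst q) - f (snd q)) / norm (fst q - snd q)" by simp
    show ?thesis
    proof (rule that)
      show "norm (f (fst q) - f (snd q)) / norm (fst q - snd q) * norm (fst p - snd p) \<le> norm (f (fst p) - f (snd p))"
        if "p \<in> P" for p
      proof -
        have "0 < norm (fst p - snd p)" using that d(1) by (auto simp: P_def)
        with q(2)[OF that] show ?thesis by (simp only: pos_le_divide_eq)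
      qed
    qed (rule pos)
  qed
  show thesis
  proof (rule that[of "min m (1 / (2 * b))"])
    show "min m (1 / (2 * b)) * norm (x - y) \<le> norm (f x - f y)" if "x \<in> K" "y \<in> K" for x y
    proof (cases "norm (x - y) < d")
      case True
      have "min m (1 / (2 * b)) * norm (x - y) \<le> 1 / (2 * b) * norm (x - y)"
        by (intro mult_right_mono) simp_all
      then show ?thesis using close[OF that True] by linarith
    next
      case False
      then have "(x, y) \<in> P" using that by (simp add: P_def)
      then have "m * norm (x - y) \<le> norm (f x - f y)" using m(2)[of "(x, y)"] by simp
      moreover have "min m (1 / (2 * b)) * norm (x - y) \<le> m * norm (x - y)"
        by (intro mult_right_mono) simp_all
      ultimately show ?thesis by linarith
    qed
  qed (simp add: m(1) b)
qed


section \<open>Regular fields on the mesh\<close>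

text \<open>A segment may enter and leave a curved piece infinitely often, so it cannot simply be
  cut into finitely many parts. Pulled back to the parameter interval, the pieces form a finite
  closed cover, and this suffices without increasing the constant.\<close>

lemma lipschitz_closed_cover:
  fixes f :: "'a::real_normed_vector \<Rightarrow> real"
  assumes "finite I" "\<And>i. i \<in> I \<Longrightarrow> closed (U i)" "0 \<le> L"
    and L: "\<And>i x y. i \<in> I \<Longrightarrow> x \<in> U i \<Longrightarrow> y \<in> U i \<Longrightarrow> \<bar>f x - f y\<bar> \<le> L * dist x y"
    and seg: "closed_segment x y \<subseteq> (\<Union>i\<in>I. U i)"
  shows "\<bar>f x - f y\<bar> \<le> L * dist x y"
proof -
  let ?p = "\<lambda>t. x + t *\<^sub>R (y - x)"
  have "(L * dist x y)-lipschitz_on {0..1} (\<lambda>t. f (?p t))"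
  proof (rule lipschitz_on_closed_Union[where U = "\<lambda>i. ?p -` U i"])
    show "(L * dist x y)-lipschitz_on (?p -` U i) (\<lambda>t. f (?p t))" if "i \<in> I" for i
    proof (rule lipschitz_onI)
      fix s t assume "s \<in> ?p -` U i" "t \<in> ?p -` U i"
      then have "\<bar>f (?p s) - f (?p t)\<bar> \<le> L * dist (?p s) (?p t)" by (intro L[OF that]) auto
      also have "dist (?p s) (?p t) = \<bar>s - t\<bar> * norm (y - x)"
        by (simp add: dist_norm flip: scaleR_diff_left)
      finally show "dist (f (?p s)) (f (?p t)) \<le> L * dist x y * dist s t"
        by (simp add: dist_norm norm_minus_commute mult_ac)
    qed (use assms(3) in simp)
    show "closed (?p -` U i)" if "i \<in> I" for i
      by (intro closed_vimage assms(2)[OF that] continuous_intros)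
    show "{0..1} \<subseteq> (\<Union>i\<in>I. ?p -` U i)"
    proof
      fix t :: real assume "t \<in> {0..1}"
      then have "?p t \<in> closed_segment x y"
        unfolding closed_segment_def by (intro CollectI exI[of _ t]) (simp add: algebra_simps)
      then show "t \<in> (\<Union>i\<in>I. ?p -` U i)" using seg by auto
    qed
  qed (use assms in auto)
  from lipschitz_onD[OF this, of 0 1] show ?thesis by (simp add: dist_norm)
qed

text \<open>A Lipschitz domain lies on one side of its boundary; hence open images of cells stay inside it.\<close>

lemma lipschitz_domain_interior_closure:
  assumes "lipschitz_domain \<Omega>"
  shows "interior (closure \<Omega>) \<subseteq> \<Omega>"
proof (rule subsetI, rule ccontr)
  fix p assume p: "p \<in> interior (closure \<Omega>)" "p \<notin> \<Omega>"
  have op: "open \<Omega>" using assms by (simp add: lipschitz_domain_def)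
  then have "p \<in> frontier \<Omega>" using p interior_subset by (auto simp: frontier_def interior_open)
  then obtain n \<gamma> L r where n: "norm n = 1" and \<gamma>: "L-lipschitz_on {y. y \<bullet> n = 0} \<gamma>" and r: "r > 0"
    and graph: "\<Omega> \<inter> ball p r = {x \<in> ball p r. \<gamma> (x - (x \<bullet> n) *\<^sub>R n) < x \<bullet> n}"
    using assms unfolding lipschitz_domain_def by blast
  have nn: "n \<bullet> n = 1" using n by (simp add: norm_eq_1)
  obtain s where s: "s > 0" "ball p s \<subseteq> closure \<Omega>" using p(1) by (auto simp: mem_interior)
  define t where "t = min s r / 2"
  have t: "0 < t" "t < s" "t < r" using s r by (auto simp: t_def)
  \<comment> \<open>Stepping from \<open>p\<close> against \<open>n\<close> keeps the tangential
    part and ends strictly below the graph, in an open set that misses \<open>\<Omega>\<close>; yet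
    \<open>q\<close> is close enough to \<open>p\<close> to lie in the closure.\<close>
  define q where "q = p - t *\<^sub>R n"
  have "dist p q = t" using n t by (simp add: q_def dist_norm)
  then have q: "q \<in> ball p s" "q \<in> ball p r" using t by auto
  define U where "U = {x. x \<bullet> n < \<gamma> (x - (x \<bullet> n) *\<^sub>R n)} \<inter> ball p r"
  have "continuous_on UNIV (\<lambda>x. \<gamma> (x - (x \<bullet> n) *\<^sub>R n))"
    by (rule continuous_on_compose2[OF lipschitz_on_continuous_on[OF \<gamma>]])
       (intro continuous_intros, auto simp: inner_diff_left nn)
  then have "open U"
    unfolding U_def by (intro open_Int open_Collect_less continuous_intros) auto
  moreover have "U \<inter> \<Omega> = {}"
  proof (rule equals0I)
    fix x assume x: "x \<in> U \<inter> \<Omega>"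
    then have "x \<in> \<Omega> \<inter> ball p r" by (simp add: U_def)
    then have "\<gamma> (x - (x \<bullet> n) *\<^sub>R n) < x \<bullet> n" unfolding graph by simp
    with x show False by (simp add: U_def)
  qed
  ultimately have "U \<inter> closure \<Omega> = {}" using open_Int_closure_eq_empty by blast
  moreover have "q \<in> U"
  proof -
    have "\<not> \<gamma> (p - (p \<bullet> n) *\<^sub>R n) < p \<bullet> n" using p(2) graph r by (metis (no_types, lifting) IntE centre_in_ball mem_Collect_eq)
    moreover have "q - (q \<bullet> n) *\<^sub>R n = p - (p \<bullet> n) *\<^sub>R n"
      by (simp add: q_def inner_diff_left nn algebra_simps)
    moreover have "q \<bullet> n < p \<bullet> n" using t by (simp add: q_def inner_diff_left nn)
    ultimately show ?thesis using q by (simp add: U_def)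
  qed
  ultimately show False using q s by blast
qed

lemma absolutely_integrable_continuous_compact:
  fixes f :: "'a::euclidean_space \<Rightarrow> 'b::euclidean_space"
  assumes "compact S" "continuous_on S f"
  shows "f absolutely_integrable_on S"
proof -
  have "set_integrable lborel S f"
    using borel_integrable_compact[OF assms] by (simp add: set_integrable_def)
  then show ?thesis by (simp add: absolutely_integrable_on_def set_borel_integral_eq_integral(1) set_integrable_norm)
qed

section \<open>Regular fields on a single cell\<close>

context
  fixes M :: "('e, 'n::finite) fe_model"
  assumes mesh: "conforming_mesh M"
begin

lemma parent_props:
  assumes "e \<in> cells M"
  shows "convex (parent M e)" "compact (parent M e)" "interior (parent M e) \<noteq> {}"
    "C1_on (parent M e) (cell_map M e)" "inj_on (cell_map M e) (parent M e)"
    "continuous_on (parent M e) (cell_map M e)"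
proof -
  have "polytope (parent M e)" using mesh assms by (auto simp: conforming_mesh_def)
  then show "convex (parent M e)" "compact (parent M e)"
    using polytope_imp_convex polytope_imp_compact by auto
  show C1: "C1_on (parent M e) (cell_map M e)" and "interior (parent M e) \<noteq> {}"
    "inj_on (cell_map M e) (parent M e)"
    using mesh assms by (auto simp: conforming_mesh_def)
  show "continuous_on (parent M e) (cell_map M e)"
    using C1_on_has_derivative[OF C1] by (meson continuous_on_eq_continuous_within has_derivative_continuous)
qed

lemma regular_fieldD: "regular_field M u \<Longrightarrow> e \<in> cells M \<Longrightarrow> C1_on (parent M e) (pullback M e u)"
  by (simp add: regular_field_def)

lemma Jf_has_derivative:
  "regular_field M u \<Longrightarrow> e \<in> cells M \<Longrightarrow> \<xi> \<in> parent M e \<Longrightarrow>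
    (pullback M e u has_derivative (\<lambda>v. Jf M u e \<xi> *v v)) (at \<xi> within parent M e)"
  unfolding Jf_def using C1_on_has_derivative regular_fieldD by blast

lemma JX_props:
  assumes "e \<in> cells M" "\<xi> \<in> parent M e"
  shows "0 < det (JX M e \<xi>)" "invertible (JX M e \<xi>)" "matrix_inv (JX M e \<xi>) ** JX M e \<xi> = mat 1"
    "(cell_map M e has_derivative (\<lambda>v. JX M e \<xi> *v v)) (at \<xi> within parent M e)"
proof -
  show d: "0 < det (JX M e \<xi>)" using mesh assms by (auto simp: conforming_mesh_def)
  then show inv: "invertible (JX M e \<xi>)" by (simp add: invertible_det_nz)
  then show "matrix_inv (JX M e \<xi>) ** JX M e \<xi> = mat 1" by (rule matrix_inv_mult_left)
  show "(cell_map M e has_derivative (\<lambda>v. JX M e \<xi> *v v)) (at \<xi> within parent M e)"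
    unfolding JX_def using C1_on_has_derivative parent_props(4) assms by blast
qed

text \<open>On the image of a cell the field is its pullback composed with the inverse cell map. The
  pullback has Lipschitz constant \<open>L\<close> and the inverse \<open>1 / m\<close>.\<close>

lemma regular_field_lipschitz_cell:
  assumes u: "regular_field M u" and e: "e \<in> cells M"
  shows "\<exists>L\<ge>0. \<forall>p\<in>cell_map M e ` parent M e. \<forall>q\<in>cell_map M e ` parent M e. norm (u p - u q) \<le> L * norm (p - q)"
proof -
  note K = parent_props[OF e]
  obtain L where L: "0 \<le> L" "\<And>x y. x \<in> parent M e \<Longrightarrow> y \<in> parent M e \<Longrightarrow>
      norm (pullback M e u x - pullback M e u y) \<le> L * norm (x - y)"
    by (fact C1_on_lipschitz[OF K(1,2) regular_fieldD[OF u e]])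
  have "\<exists>B. \<forall>\<xi>\<in>parent M e. norm (JX M e \<xi>) \<le> B \<and> norm (matrix_inv (JX M e \<xi>)) \<le> B"
    using mesh e by (simp add: conforming_mesh_def)
  then obtain B where "\<forall>\<xi>\<in>parent M e. norm (JX M e \<xi>) \<le> B \<and> norm (matrix_inv (JX M e \<xi>)) \<le> B" ..
  then have B: "norm (matrix_inv (JX M e \<xi>)) \<le> B" if "\<xi> \<in> parent M e" for \<xi>
    using that by simp
  obtain m where m: "0 < m" "\<And>x y. x \<in> parent M e \<Longrightarrow> y \<in> parent M e \<Longrightarrow>
      m * norm (x - y) \<le> norm (cell_map M e x - cell_map M e y)"
  proof (rule C1_on_expanding[OF K(1,2,4,5)])
    show "invertible (jacobian (cell_map M e) (at \<xi> within parent M e))"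
      and "norm (matrix_inv (jacobian (cell_map M e) (at \<xi> within parent M e))) \<le> B"
      if "\<xi> \<in> parent M e" for \<xi>
      using JX_props(2)[OF e that] B[OF that] by (simp_all add: JX_def)
  qed (rule that)
  have "norm (u (cell_map M e x) - u (cell_map M e y)) \<le> L / m * norm (cell_map M e x - cell_map M e y)"
    if "x \<in> parent M e" "y \<in> parent M e" for x y
  proof -
    have "L / m * (m * norm (x - y)) \<le> L / m * norm (cell_map M e x - cell_map M e y)"
      using m(2)[OF that] L(1) m(1) by (intro mult_left_mono) auto
    then show ?thesis using L(2)[OF that] m(1) by (simp add: pullback_def)
  qed
  then show ?thesis using L(1) m(1) by (intro exI[of _ "L / m"]) auto
qed

lemma regular_field_lipschitz_cells:
  assumes u: "regular_field M u"
  obtains L where "0 \<le> L" "\<And>e p q. e \<in> cells M \<Longrightarrow> p \<in> cell_map M e ` parent M e \<Longrightarrow>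
    q \<in> cell_map M e ` parent M e \<Longrightarrow> norm (u p - u q) \<le> L * norm (p - q)"
proof -
  have fin: "finite (cells M)" using mesh by (simp add: conforming_mesh_def)
  obtain l where l: "\<And>e. e \<in> cells M \<Longrightarrow> 0 \<le> l e" "\<And>e p q. e \<in> cells M \<Longrightarrow> p \<in> cell_map M e ` parent M e \<Longrightarrow>
    q \<in> cell_map M e ` parent M e \<Longrightarrow> norm (u p - u q) \<le> l e * norm (p - q)"
    using regular_field_lipschitz_cell[OF u] by metis
  show thesis
  proof (rule that[of "sum l (cells M)"])
    show "0 \<le> sum l (cells M)" using l(1) by (rule sum_nonneg)
    fix e p q assume *: "e \<in> cells M" "p \<in> cell_map M e ` parent M e" "q \<in> cell_map M e ` parent M e"
    have "l e \<le> sum l (cells M)" using *(1) fin l(1) by (intro member_le_sum) auto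
    then have "l e * norm (p - q) \<le> sum l (cells M) * norm (p - q)" by (intro mult_right_mono) auto
    with l(2)[OF *] show "norm (u p - u q) \<le> sum l (cells M) * norm (p - q)" by linarith
  qed
qed

text \<open>The inverse function theorem differentiates the inverse \<open>g\<close> of the cell map
  at the image point. Near that point \<open>u\<close> is the pullback composed with
  \<open>g\<close>, on a neighbourhood that is open by invariance of domain.\<close>

lemma regular_field_has_derivative_physical:
  assumes u: "regular_field M u" and e: "e \<in> cells M" and \<xi>: "\<xi> \<in> interior (parent M e)"
  shows "(u has_derivative (\<lambda>v. jacobian u (at (cell_map M e \<xi>)) *v v)) (at (cell_map M e \<xi>))"
    and "Jf M u e \<xi> = jacobian u (at (cell_map M e \<xi>)) ** JX M e \<xi>"
proof -
  let ?K = "parent M e" and ?X = "cell_map M e"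
  note K = parent_props[OF e]
  have \<xi>K: "\<xi> \<in> ?K" using \<xi> interior_subset by blast
  define g where "g = inv_into ?K ?X"
  have gX: "g (?X x) = x" if "x \<in> ?K" for x using K(5) that by (simp add: g_def)
  have at: "at \<xi> within ?K = at \<xi>" using \<xi> by (rule at_within_interior)
  have dX: "(?X has_derivative (\<lambda>v. JX M e \<xi> *v v)) (at \<xi>)" using JX_props(4)[OF e \<xi>K] by (simp add: at)
  have du: "(pullback M e u has_derivative (\<lambda>v. Jf M u e \<xi> *v v)) (at \<xi>)"
    using Jf_has_derivative[OF u e \<xi>K] by (simp add: at)
  let ?I = "matrix_inv (JX M e \<xi>)"
  have "JX M e \<xi> ** ?I = mat 1"
    using JX_props(3)[OF e \<xi>K] by (simp add: matrix_left_right_inverse)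
  then have id: "(\<lambda>v. JX M e \<xi> *v v) \<circ> (\<lambda>v. ?I *v v) = id"
    by (auto simp: fun_eq_iff matrix_vector_mul_assoc)
  have dg: "(g has_derivative (\<lambda>v. ?I *v v)) (at (?X \<xi>))"
    by (rule has_derivative_inverse_strong[OF _ \<xi> _ _ dX id])
       (use gX interior_subset[of ?K] K(6) in \<open>auto intro: continuous_on_subset\<close>)
  have comp: "((\<lambda>x. pullback M e u (g x)) has_derivative (\<lambda>v. Jf M u e \<xi> *v (?I *v v))) (at (?X \<xi>))"
    by (rule has_derivative_compose[OF dg]) (use du gX[OF \<xi>K] in simp)
  have op: "open (?X ` interior ?K)"
    using K(5,6) interior_subset[of ?K]
    by (intro invariance_of_domain) (auto intro: continuous_on_subset inj_on_subset)
  have phys: "(u has_derivative (\<lambda>v. (Jf M u e \<xi> ** ?I) *v v)) (at (?X \<xi>))"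
  proof (rule has_derivative_transform_within_open[OF _ op])
    show "((\<lambda>x. pullback M e u (g x)) has_derivative (\<lambda>v. (Jf M u e \<xi> ** ?I) *v v)) (at (?X \<xi>))"
      using comp by (simp add: matrix_vector_mul_assoc)
    show "pullback M e u (g x) = u x" if "x \<in> ?X ` interior ?K" for x
      using that gX interior_subset[of ?K] by (auto simp: pullback_def)
  qed (use \<xi> in auto)
  note J = jacobian_atI[OF phys]
  from phys J show "(u has_derivative (\<lambda>v. jacobian u (at (?X \<xi>)) *v v)) (at (?X \<xi>))" by simp
  show "Jf M u e \<xi> = jacobian u (at (?X \<xi>)) ** JX M e \<xi>"
    using JX_props(3)[OF e \<xi>K] by (simp add: J matrix_mul_assoc[symmetric])
qed

end


section \<open>From cell integrals to an integral over the domain\<close>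

lemma has_absolute_integral_change_of_variables_scalar:
  fixes f :: "real^'m::{finite,wellorder} \<Rightarrow> real" and g :: "real^'m::_ \<Rightarrow> real^'m::_"
  assumes "S \<in> sets lebesgue" "\<And>x. x \<in> S \<Longrightarrow> (g has_derivative g' x) (at x within S)" "inj_on g S"
  shows "(\<lambda>x. \<bar>det (matrix (g' x))\<bar> *\<^sub>R f (g x)) absolutely_integrable_on S \<and>
           integral S (\<lambda>x. \<bar>det (matrix (g' x))\<bar> *\<^sub>R f (g x)) = b
     \<longleftrightarrow> f absolutely_integrable_on (g ` S) \<and> integral (g ` S) f = b"
  using has_absolute_integral_change_of_variables[OF assms, of "\<lambda>x. vec (f x) :: real^1" "vec b"]
  by (simp add: absolutely_integrable_on_1_iff integral_on_1_eq vec_eq_iff)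

context
  fixes M :: "('e, 'n::finite) fe_model"
  assumes mesh: "conforming_mesh M"
begin

lemma Omega_props:
  shows "open (Omega M)" "bounded (Omega M)" "compact (closure (Omega M))" "finite (cells M)"
    "closure (Omega M) = (\<Union>e\<in>cells M. cell_map M e ` parent M e)"
proof -
  show bounded: "bounded (Omega M)" and "finite (cells M)"
    and "closure (Omega M) = (\<Union>e\<in>cells M. cell_map M e ` parent M e)"
    using mesh unfolding conforming_mesh_def by blast+
  show "open (Omega M)" using mesh by (simp add: conforming_mesh_def lipschitz_domain_def)
  show "compact (closure (Omega M))" using bounded by (rule compact_closure[THEN iffD2])
qed

lemma open_cell_image: "e \<in> cells M \<Longrightarrow> open (cell_map M e ` interior (parent M e))"
  using continuous_on_subset[OF parent_props(6)[OF mesh] interior_subset] open_interior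
    inj_on_subset[OF parent_props(5)[OF mesh] interior_subset]
  by (rule invariance_of_domain)

lemma cell_image_subset: "e \<in> cells M \<Longrightarrow> cell_map M e ` interior (parent M e) \<subseteq> Omega M"
proof -
  assume e: "e \<in> cells M"
  have "cell_map M e ` interior (parent M e) \<subseteq> cell_map M e ` parent M e"
    by (intro image_mono interior_subset)
  also have "\<dots> \<subseteq> closure (Omega M)"
    unfolding Omega_props(5) using e by (rule UN_upper)
  finally have "cell_map M e ` interior (parent M e) \<subseteq> closure (Omega M)" .
  then have "cell_map M e ` interior (parent M e) \<subseteq> interior (closure (Omega M))"
    using open_cell_image[OF e] by (rule interior_maximal)
  moreover have "lipschitz_domain (Omega M)" using mesh by (simp add: conforming_mesh_def)
  ultimately show ?thesis using lipschitz_domain_interior_closure by blast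
qed

text \<open>Every other point of the domain is the image of an interior point of a parent cell, so
  all regular fields are differentiable there; this is the exceptional set \<open>N\<close> of the
  vanishing theorem.\<close>

definition skeleton :: "(real^3) set" where
  "skeleton = (\<Union>e\<in>cells M. cell_map M e ` frontier (parent M e))"

text \<open>Frontiers of convex sets are null, and differentiable maps between spaces of equal
  dimension preserve null sets.\<close>

lemma negligible_skeleton: "negligible skeleton"
  unfolding skeleton_def
proof (rule negligible_Union)
  show "finite ((\<lambda>e. cell_map M e ` frontier (parent M e)) ` cells M)"
    using Omega_props(4) by simp
  fix S assume "S \<in> (\<lambda>e. cell_map M e ` frontier (parent M e)) ` cells M"
  then obtain e where e: "e \<in> cells M" and S: "S = cell_map M e ` frontier (parent M e)" by blast
  have sub: "frontier (parent M e) \<subseteq> parent M e"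
    using parent_props(2)[OF mesh e] by (simp add: compact_imp_closed frontier_subset_closed)
  have "cell_map M e differentiable_on parent M e"
    unfolding differentiable_on_def using JX_props(4)[OF mesh e, THEN differentiableI] by blast
  then have "cell_map M e differentiable_on frontier (parent M e)"
    using sub by (rule differentiable_on_subset)
  then show "negligible S"
    unfolding S using negligible_convex_frontier[OF parent_props(1)[OF mesh e]]
    by (intro negligible_differentiable_image_negligible) auto
qed

lemma Omega_off_skeleton:
  assumes "x \<in> Omega M - skeleton"
  obtains e \<xi> where "e \<in> cells M" "\<xi> \<in> interior (parent M e)" "x = cell_map M e \<xi>"
proof -
  have "x \<in> closure (Omega M)" using assms closure_subset[of "Omega M"] by blast
  then obtain e \<xi> where e: "e \<in> cells M" and \<xi>: "\<xi> \<in> parent M e" "x = cell_map M e \<xi>"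
    unfolding Omega_props(5) by blast
  then have "\<xi> \<notin> frontier (parent M e)" using assms unfolding skeleton_def by blast
  with \<xi>(1) have int: "\<xi> \<in> interior (parent M e)" using closure_subset[of "parent M e"] unfolding frontier_def by blast
  show thesis by (rule that[OF e int \<xi>(2)])
qed

text \<open>The shifts in \<open>cup3\<close> leave the domain, while the values of a field outside
  the closed domain are arbitrary.\<close>

definition zero_ext :: "(real^3 \<Rightarrow> real^3) \<Rightarrow> 3 \<Rightarrow> real^3 \<Rightarrow> real" where
  "zero_ext u i x = (if x \<in> Omega M then u x $ i else 0)"

text \<open>These are the properties demanded of \<open>b\<close> and \<open>c\<close> in
  \<open>has_integral_triple_gradient_zero\<close>.\<close>

lemma zero_ext_props:
  assumes u: "regular_field M u"
  shows "zero_ext u i \<in> borel_measurable borel"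
    and "\<exists>B. \<forall>x. \<bar>zero_ext u i x\<bar> \<le> B"
    and "\<exists>L\<ge>0. \<forall>x y. closed_segment x y \<subseteq> Omega M \<longrightarrow> \<bar>zero_ext u i x - zero_ext u i y\<bar> \<le> L * dist x y"
    and "x \<in> Omega M - skeleton \<Longrightarrow> (zero_ext u i has_derivative (\<lambda>v. jacobian u (at x) $ i \<bullet> v)) (at x)"
proof -
  have cont: "continuous_on (closure (Omega M)) (\<lambda>x. u x $ i)"
    using u by (intro continuous_on_component) (simp add: regular_field_def)
  then have "continuous_on (Omega M) (\<lambda>x. u x $ i)"
    by (rule continuous_on_subset[OF _ closure_subset])
  then show "zero_ext u i \<in> borel_measurable borel"
    unfolding zero_ext_def[abs_def] using Omega_props(1) by (intro borel_measurable_continuous_on_if) auto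
  have "bounded ((\<lambda>x. u x $ i) ` closure (Omega M))"
    using compact_continuous_image[OF cont Omega_props(3)] by (rule compact_imp_bounded)
  then obtain B where B: "\<forall>x\<in>closure (Omega M). \<bar>u x $ i\<bar> \<le> B" by (auto simp: bounded_iff)
  have "\<bar>zero_ext u i x\<bar> \<le> max 0 B" for x
    using B closure_subset[of "Omega M"] by (cases "x \<in> Omega M") (auto simp: zero_ext_def max_def)
  then show "\<exists>B. \<forall>x. \<bar>zero_ext u i x\<bar> \<le> B" by blast
  obtain L where L: "0 \<le> L" "\<And>e p q. e \<in> cells M \<Longrightarrow> p \<in> cell_map M e ` parent M e \<Longrightarrow>
    q \<in> cell_map M e ` parent M e \<Longrightarrow> norm (u p - u q) \<le> L * norm (p - q)"
    by (fact regular_field_lipschitz_cells[OF mesh u])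
  have "\<bar>zero_ext u i x - zero_ext u i y\<bar> \<le> L * dist x y" if seg: "closed_segment x y \<subseteq> Omega M" for x y
  proof -
    have "\<bar>u x $ i - u y $ i\<bar> \<le> L * dist x y"
    proof (rule lipschitz_closed_cover[where I = "cells M" and U = "\<lambda>e. cell_map M e ` parent M e", OF Omega_props(4) _ L(1)])
      show "closed (cell_map M e ` parent M e)" if "e \<in> cells M" for e
        using parent_props(2,6)[OF mesh that] by (intro compact_imp_closed compact_continuous_image)
      show "\<bar>u p $ i - u q $ i\<bar> \<le> L * dist p q"
        if "e \<in> cells M" "p \<in> cell_map M e ` parent M e" "q \<in> cell_map M e ` parent M e" for e p q
        using L(2)[OF that] component_le_norm_cart[of "u p - u q" i] by (simp add: dist_norm)
      show "closed_segment x y \<subseteq> (\<Union>e\<in>cells M. cell_map M e ` parent M e)"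
        using order_trans[OF seg closure_subset] unfolding Omega_props(5) .
    qed
    moreover have "x \<in> Omega M" "y \<in> Omega M" using seg by auto
    ultimately show ?thesis by (simp add: zero_ext_def)
  qed
  with L(1) show "\<exists>L\<ge>0. \<forall>x y. closed_segment x y \<subseteq> Omega M \<longrightarrow> \<bar>zero_ext u i x - zero_ext u i y\<bar> \<le> L * dist x y"
    by blast
  show "(zero_ext u i has_derivative (\<lambda>v. jacobian u (at x) $ i \<bullet> v)) (at x)" if x: "x \<in> Omega M - skeleton"
  proof -
    obtain e \<xi> where e: "e \<in> cells M" "\<xi> \<in> interior (parent M e)" "x = cell_map M e \<xi>"
      by (fact Omega_off_skeleton[OF x])
    have "(u has_derivative (\<lambda>v. jacobian u (at x) *v v)) (at x)"
      using regular_field_has_derivative_physical(1)[OF mesh u e(1,2)] e(3) by simp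
    then have "((\<lambda>x. u x $ i) has_derivative (\<lambda>v. (jacobian u (at x) *v v) $ i)) (at x)"
      by (rule bounded_linear.has_derivative[OF bounded_linear_vec_nth])
    then have "((\<lambda>x. u x $ i) has_derivative (\<lambda>v. jacobian u (at x) $ i \<bullet> v)) (at x)"
      by (simp only: matrix_vector_mul_component)
    then show ?thesis
      by (rule has_derivative_transform_within_open[OF _ Omega_props(1)]) (use x in \<open>auto simp: zero_ext_def\<close>)
  qed
qed

text \<open>The complement of the domain joins the cell images as one more closed piece, so the
  whole space is covered. The zero trace makes the extension agree with \<open>w\<close> on the
  closed cell images, hence Lipschitz on every piece.\<close>

lemma zero_ext_lipschitz_of_zero_trace:
  assumes w: "regular_field M w" and w0: "\<And>x. x \<in> frontier (Omega M) \<Longrightarrow> w x = 0"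
  shows "\<exists>L. \<forall>x y. \<bar>zero_ext w i x - zero_ext w i y\<bar> \<le> L * dist x y"
proof -
  obtain L where L: "0 \<le> L" "\<And>e p q. e \<in> cells M \<Longrightarrow> p \<in> cell_map M e ` parent M e \<Longrightarrow>
    q \<in> cell_map M e ` parent M e \<Longrightarrow> norm (w p - w q) \<le> L * norm (p - q)"
    by (fact regular_field_lipschitz_cells[OF mesh w])
  have eq: "zero_ext w i x = w x $ i" if "x \<in> closure (Omega M)" for x
    using that w0 Omega_props(1) by (auto simp: zero_ext_def frontier_def interior_open)
  define F where "F = insert (- Omega M) ((\<lambda>e. cell_map M e ` parent M e) ` cells M)"
  have "\<bar>zero_ext w i x - zero_ext w i y\<bar> \<le> L * dist x y" for x y
  proof (rule lipschitz_closed_cover[where I = F and U = "\<lambda>S. S"])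
    show "finite F" using Omega_props(4) by (simp add: F_def)
    have "closed (cell_map M e ` parent M e)" if "e \<in> cells M" for e
      using parent_props(2,6)[OF mesh that] by (intro compact_imp_closed compact_continuous_image)
    then show "closed S" if "S \<in> F" for S using that Omega_props(1) by (auto simp: F_def)
    show "0 \<le> L" by fact
    show "\<bar>zero_ext w i p - zero_ext w i q\<bar> \<le> L * dist p q" if S: "S \<in> F" "p \<in> S" "q \<in> S" for S p q
    proof (cases "S = - Omega M")
      case True
      then show ?thesis using S L(1) by (simp add: zero_ext_def)
    next
      case False
      then obtain e where e: "e \<in> cells M" "S = cell_map M e ` parent M e" using S by (auto simp: F_def)
      then have "p \<in> closure (Omega M)" "q \<in> closure (Omega M)" using S Omega_props(5) by auto
      moreover have "\<bar>w p $ i - w q $ i\<bar> \<le> L * dist p q"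
        using L(2)[OF e(1), of p q] S e(2) component_le_norm_cart[of "w p - w q" i] by (simp add: dist_norm)
      ultimately show ?thesis by (simp add: eq)
    qed
    have "Omega M \<subseteq> (\<Union>e\<in>cells M. cell_map M e ` parent M e)"
      using closure_subset[of "Omega M"] unfolding Omega_props(5) .
    then show "closed_segment x y \<subseteq> (\<Union>S\<in>F. S)" unfolding F_def by blast
  qed
  then show ?thesis by blast
qed

lemma triple_gradient_physical:
  assumes w: "regular_field M w" and u: "regular_field M u" and v: "regular_field M v"
    and w0: "\<And>x. x \<in> frontier (Omega M) \<Longrightarrow> w x = 0"
  shows "((\<lambda>x. jacobian w (at x) $ i \<bullet> cross3 (jacobian u (at x) $ j) (jacobian v (at x) $ k))
    has_integral 0) (Omega M)"
proof -
  obtain B1 where B1: "\<forall>x. \<bar>zero_ext w i x\<bar> \<le> B1" using zero_ext_props(2)[OF w] by blast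
  obtain B2 where B2: "\<forall>x. \<bar>zero_ext u j x\<bar> \<le> B2" using zero_ext_props(2)[OF u] by blast
  obtain B3 where B3: "\<forall>x. \<bar>zero_ext v k x\<bar> \<le> B3" using zero_ext_props(2)[OF v] by blast
  obtain L1 where L1: "\<forall>x y. \<bar>zero_ext w i x - zero_ext w i y\<bar> \<le> L1 * dist x y"
    using zero_ext_lipschitz_of_zero_trace[OF w w0] by blast
  obtain L2 where L2: "\<forall>x y. closed_segment x y \<subseteq> Omega M \<longrightarrow> \<bar>zero_ext u j x - zero_ext u j y\<bar> \<le> L2 * dist x y"
    using zero_ext_props(3)[OF u] by blast
  obtain L3 where L3: "\<forall>x y. closed_segment x y \<subseteq> Omega M \<longrightarrow> \<bar>zero_ext v k x - zero_ext v k y\<bar> \<le> L3 * dist x y"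
    using zero_ext_props(3)[OF v] by blast
  define B where "B = max B1 (max B2 B3)"
  define L where "L = max L1 (max L2 L3)"
  have le: "a \<le> L * dist x y" if "a \<le> L' * dist x y" "L' \<le> L" for a L' and x y :: "real^3"
    using that mult_right_mono[OF that(2) zero_le_dist[of x y]] by linarith
  have Ls: "L1 \<le> L" "L2 \<le> L" "L3 \<le> L" by (simp_all add: L_def)
  show ?thesis
  proof (rule has_integral_triple_gradient_zero[OF Omega_props(1,2) zero_ext_props(1)[OF w] zero_ext_props(1)[OF u]
      zero_ext_props(1)[OF v] _ _ _ _ _ _ _ negligible_skeleton zero_ext_props(4)[OF w] zero_ext_props(4)[OF u] zero_ext_props(4)[OF v]])
    show "\<bar>zero_ext w i x\<bar> \<le> B" for x using B1[rule_format, of x] by (simp add: B_def)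
    show "\<bar>zero_ext u j x\<bar> \<le> B" for x using B2[rule_format, of x] by (simp add: B_def)
    show "\<bar>zero_ext v k x\<bar> \<le> B" for x using B3[rule_format, of x] by (simp add: B_def)
    show "zero_ext w i x = 0" if "x \<notin> Omega M" for x using that by (simp add: zero_ext_def)
    show "\<bar>zero_ext w i x - zero_ext w i y\<bar> \<le> L * dist x y" for x y
      using L1 by (intro le[OF _ Ls(1)]) simp
    show "\<bar>zero_ext u j x - zero_ext u j y\<bar> \<le> L * dist x y" if "closed_segment x y \<subseteq> Omega M" for x y
      using L2 that by (intro le[OF _ Ls(2)]) simp
    show "\<bar>zero_ext v k x - zero_ext v k y\<bar> \<le> L * dist x y" if "closed_segment x y \<subseteq> Omega M" for x y
      using L3 that by (intro le[OF _ Ls(3)]) simp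
  qed
qed

lemma continuous_on_frob_cross_mat:
  fixes S :: "(real^3) set"
  assumes "continuous_on S A" "continuous_on S B" "continuous_on S C"
  shows "continuous_on S (\<lambda>x. A x \<bullet>\<bullet> (B x \<times>\<times> C x))"
  unfolding frob_cross_mat
  by (intro continuous_intros continuous_on_cross assms)

lemma continuous_on_Jf: "regular_field M u \<Longrightarrow> e \<in> cells M \<Longrightarrow> continuous_on (parent M e) (Jf M u e)"
  unfolding Jf_def[abs_def] by (rule C1_on_continuous_jacobian) (rule regular_fieldD[OF mesh])

lemma Jf_triple_integrable:
  assumes "regular_field M w" "regular_field M u" "regular_field M v" "e \<in> cells M"
  shows "(\<lambda>\<xi>. Jf M w e \<xi> \<bullet>\<bullet> (Jf M u e \<xi> \<times>\<times> Jf M v e \<xi>)) absolutely_integrable_on parent M e"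
  using assms parent_props(2)[OF mesh]
  by (intro absolutely_integrable_continuous_compact continuous_on_frob_cross_mat continuous_on_Jf)

lemma sum_exact_int_triple_zero:
  assumes w: "regular_field M w" and u: "regular_field M u" and v: "regular_field M v"
    and w0: "\<And>x. x \<in> frontier (Omega M) \<Longrightarrow> w x = 0"
  shows "(\<Sum>e\<in>cells M. exact_int M e (\<lambda>\<xi>. Jf M w e \<xi> \<bullet>\<bullet> (Jf M u e \<xi> \<times>\<times> Jf M v e \<xi>))) = 0"
proof -
  define G where "G x = jacobian w (at x) \<bullet>\<bullet> (jacobian u (at x) \<times>\<times> jacobian v (at x))" for x
  define D where "D e = cell_map M e ` interior (parent M e)" for e
  have "(G has_integral (\<Sum>l\<in>(UNIV::3 set). 0 + 0)) (Omega M)"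
    unfolding G_def[abs_def] frob_cross_mat
    by (intro has_integral_sum has_integral_add triple_gradient_physical w u v w0) auto
  then have total: "(G has_integral 0) (Omega M)" by simp
  have cell: "(G has_integral exact_int M e (\<lambda>\<xi>. Jf M w e \<xi> \<bullet>\<bullet> (Jf M u e \<xi> \<times>\<times> Jf M v e \<xi>))) (D e)"
    if e: "e \<in> cells M" for e
  proof -
    let ?K = "parent M e" and ?H = "\<lambda>\<xi>. Jf M w e \<xi> \<bullet>\<bullet> (Jf M u e \<xi> \<times>\<times> Jf M v e \<xi>)"
    let ?S = "interior ?K" and ?f = "\<lambda>\<xi>. \<bar>det (matrix (\<lambda>v. JX M e \<xi> *v v))\<bar> *\<^sub>R G (cell_map M e \<xi>)"
    \<comment> \<open>Orientation enters here: the determinant is positive, so its absolute value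
      equals the factor produced by \<open>frob_cross_mat_mult\<close>.\<close>
    have f_eq: "?f \<xi> = ?H \<xi>" if \<xi>: "\<xi> \<in> ?S" for \<xi>
    proof -
      have "\<xi> \<in> ?K" using \<xi> interior_subset[of ?K] by blast
      show ?thesis
        using JX_props(1)[OF mesh e \<open>\<xi> \<in> ?K\<close>] regular_field_has_derivative_physical(2)[OF mesh _ e \<xi>] w u v
        by (simp add: frob_cross_mat_mult G_def abs_of_pos)
    qed
    have H: "?H absolutely_integrable_on ?K" by (rule Jf_triple_integrable[OF w u v e])
    \<comment> \<open>The physical Jacobians in \<open>G\<close> are identified only on images of
      interior points, so the change of variables is carried out on the interior; the omitted
      frontier is null.\<close>
    have HS: "?H absolutely_integrable_on ?S"
      by (rule set_integrable_subset[OF H _ interior_subset]) simp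
    have sub: "{\<xi> \<in> ?K - ?S. ?H \<xi> \<noteq> 0} \<subseteq> frontier ?K"
      using closure_subset[of ?K] unfolding frontier_def by blast
    have emp: "{\<xi> \<in> ?S - ?K. ?H \<xi> \<noteq> 0} = {}" using interior_subset[of ?K] by blast
    have int: "integral ?S ?H = integral ?K ?H"
      by (rule integral_spike_set) (unfold emp, simp,
        rule negligible_subset[OF negligible_convex_frontier[OF parent_props(1)[OF mesh e]] sub])
    have "?f absolutely_integrable_on ?S \<and> integral ?S ?f = integral ?K ?H"
    proof
      show "?f absolutely_integrable_on ?S"
      proof -
        have "?f absolutely_integrable_on ?S \<longleftrightarrow> ?H absolutely_integrable_on ?S"
          by (rule set_integrable_cong[OF refl refl]) (rule f_eq)
        with HS show ?thesis by (rule iffD2[rotated])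
      qed
      show "integral ?S ?f = integral ?K ?H"
        unfolding int[symmetric] by (rule integral_cong) (rule f_eq)
    qed
    moreover have "?f absolutely_integrable_on ?S \<and> integral ?S ?f = integral ?K ?H \<longleftrightarrow>
        G absolutely_integrable_on (cell_map M e ` ?S) \<and> integral (cell_map M e ` ?S) G = integral ?K ?H"
    proof (rule has_absolute_integral_change_of_variables_scalar)
      show "?S \<in> sets lebesgue" by simp
      show "(cell_map M e has_derivative (*v) (JX M e \<xi>)) (at \<xi> within ?S)" if "\<xi> \<in> ?S" for \<xi>
        using has_derivative_subset[OF JX_props(4)[OF mesh e interior_subset[THEN subsetD, OF that]] interior_subset] .
      show "inj_on (cell_map M e) ?S"
        using parent_props(5)[OF mesh e] interior_subset by (rule inj_on_subset)
    qed
    ultimately have "G absolutely_integrable_on D e" "integral (D e) G = integral ?K ?H"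
      unfolding D_def by auto
    then show ?thesis
      unfolding exact_int_def using absolutely_integrable_on_def integrable_integral by metis
  qed
  have disj: "pairwise (\<lambda>e f. negligible (D e \<inter> D f)) (cells M)"
    using mesh unfolding conforming_mesh_def pairwise_def D_def by simp
  have "(G has_integral (\<Sum>e\<in>cells M. exact_int M e (\<lambda>\<xi>. Jf M w e \<xi> \<bullet>\<bullet> (Jf M u e \<xi> \<times>\<times> Jf M v e \<xi>)))) (\<Union>e\<in>cells M. D e)"
    by (rule has_integral_UN[OF Omega_props(4) cell disj])
  moreover have "(G has_integral 0) (\<Union>e\<in>cells M. D e)"
  proof -
    have "x \<in> (\<Union>e\<in>cells M. D e)" if x: "x \<in> Omega M - skeleton" for x
    proof -
      obtain e \<xi> where "e \<in> cells M" "\<xi> \<in> interior (parent M e)" "x = cell_map M e \<xi>"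
        by (fact Omega_off_skeleton[OF x])
      then show ?thesis unfolding D_def by blast
    qed
    \<comment> \<open>Images of interiors exhaust the domain up to the skeleton, so the sum of the
      cell integrals is the integral over the domain.\<close>
    then have sub: "{x \<in> Omega M - (\<Union>e\<in>cells M. D e). G x \<noteq> 0} \<subseteq> skeleton" by blast
    have "(\<Union>e\<in>cells M. D e) \<subseteq> Omega M" unfolding D_def using cell_image_subset by blast
    then have emp: "{x \<in> (\<Union>e\<in>cells M. D e) - Omega M. G x \<noteq> 0} = {}" by blast
    show ?thesis
      using total has_integral_spike_set_eq[OF negligible_subset[OF negligible_skeleton sub], unfolded emp] by simp
  qed
  ultimately show ?thesis by (rule has_integral_unique)
qed

end


section \<open>Hessians of the gauge functionals\<close>

lemma matrix_vector_inner_symmetric: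
  "transpose H = H \<Longrightarrow> a \<bullet> ((H :: real^'n^'n) *v h) = (H *v a) \<bullet> h"
  by (metis dot_lmul_matrix transpose_matrix_vector)

lemma has_derivative_quadratic:
  fixes H :: "real^'n^'n"
  assumes H: "transpose H = H"
  shows "((\<lambda>a. c + l \<bullet> a + (a \<bullet> (H *v a)) / 2) has_derivative (\<lambda>h. (l + H *v a) \<bullet> h)) (at a within S)"
proof -
  have "((\<lambda>a. c + l \<bullet> a + (a \<bullet> (H *v a)) / 2) has_derivative
      (\<lambda>h. 0 + l \<bullet> h + (a \<bullet> (H *v h) + h \<bullet> (H *v a)) / 2)) (at a within S)"
    by (intro has_derivative_add has_derivative_const has_derivative_inner[OF has_derivative_ident]
        bounded_linear_imp_has_derivative[OF matrix_vector_mul_bounded_linear]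
        bounded_linear_imp_has_derivative[OF bounded_linear_inner_right]
        bounded_linear.has_derivative[OF bounded_linear_divide])
  moreover have "0 + l \<bullet> h + (a \<bullet> (H *v h) + h \<bullet> (H *v a)) / 2 = (l + H *v a) \<bullet> h" for h
    using matrix_vector_inner_symmetric[OF H, of a h] inner_commute[of h "H *v a"]
    by (simp add: inner_add_left)
  ultimately show ?thesis by simp
qed

lemma hessian_quadratic:
  fixes H :: "real^'n^'n"
  assumes H: "transpose H = H" and f: "\<And>a. f a = c + l \<bullet> a + (a \<bullet> (H *v a)) / 2"
  shows "hessian f b = H"
proof -
  have feq: "f = (\<lambda>a. c + l \<bullet> a + (a \<bullet> (H *v a)) / 2)" using f by blast
  have "frechet_derivative f (at a) = (\<lambda>h. (l + H *v a) \<bullet> h)" for a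
    unfolding feq by (rule frechet_derivative_at[OF has_derivative_quadratic[OF H], symmetric])
  then have "gradient f = (\<lambda>a. l + H *v a)"
    by (simp add: gradient_def[abs_def] inner_axis vec_eq_iff fun_eq_iff)
  moreover have "((\<lambda>a. l + H *v a) has_derivative (\<lambda>v. H *v v)) (at b)"
    using has_derivative_add[OF has_derivative_const
        bounded_linear_imp_has_derivative[OF matrix_vector_mul_bounded_linear]] by simp
  ultimately show ?thesis unfolding hessian_def by (simp only: jacobian_atI)
qed

lemma frob_diff_left: "(A - B) \<bullet>\<bullet> C = A \<bullet>\<bullet> C - B \<bullet>\<bullet> C"
  by (simp add: frob_eq_sum_rows inner_diff_left sum_subtractf)

lemma frob_cross_mat_commute: "A \<bullet>\<bullet> (B \<times>\<times> C) = A \<bullet>\<bullet> (C \<times>\<times> B)"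
  by (simp add: frob_cross_mat add.commute)

lemma frob_cross_mat_add_scaleR:
  "A \<bullet>\<bullet> ((B + r *\<^sub>R B') \<times>\<times> C) = A \<bullet>\<bullet> (B \<times>\<times> C) + r * (A \<bullet>\<bullet> (B' \<times>\<times> C))"
  by (simp add: frob_cross_mat cross_add_left cross_add_right cross_mult_left cross_mult_right
      inner_add_right sum.distrib sum_distrib_left algebra_simps)

text \<open>Writes the gauge integrand as half of a symmetric bilinear form on the diagonal, so that
  the Hessian is the form itself.\<close>

lemma frob_cof: "A \<bullet>\<bullet> cof B = (A \<bullet>\<bullet> (B \<times>\<times> B)) / 2"
  by (simp add: cross_mat_self frob_eq_sum_rows sum_distrib_left[symmetric])

section \<open>Polar forms of the gauge functionals\<close>

context
  fixes M :: "('e, 'n::finite) fe_model"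
  assumes mesh: "conforming_mesh M"
begin

lemma regular_field_add_scaleR:
  assumes "regular_field M u" "regular_field M v"
  shows "regular_field M (\<lambda>x. u x + r *\<^sub>R v x)"
    and "e \<in> cells M \<Longrightarrow> \<xi> \<in> parent M e \<Longrightarrow> Jf M (\<lambda>x. u x + r *\<^sub>R v x) e \<xi> = Jf M u e \<xi> + r *\<^sub>R Jf M v e \<xi>"
proof -
  have pb: "pullback M e (\<lambda>x. u x + r *\<^sub>R v x) = (\<lambda>\<xi>. pullback M e u \<xi> + r *\<^sub>R pullback M e v \<xi>)" for e
    by (simp add: pullback_def o_def)
  show "regular_field M (\<lambda>x. u x + r *\<^sub>R v x)"
    unfolding regular_field_def pb
  proof (intro conjI ballI)
    show "continuous_on (closure (Omega M)) (\<lambda>x. u x + r *\<^sub>R v x)"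
      using assms by (intro continuous_intros) (auto simp: regular_field_def)
    show "C1_on (parent M e) (\<lambda>\<xi>. pullback M e u \<xi> + r *\<^sub>R pullback M e v \<xi>)" if e: "e \<in> cells M" for e
      by (rule C1_on_add_scaleR[OF parent_props(1,3)[OF mesh e] assms[THEN regular_fieldD[OF mesh _ e]]])
  qed
  show "Jf M (\<lambda>x. u x + r *\<^sub>R v x) e \<xi> = Jf M u e \<xi> + r *\<^sub>R Jf M v e \<xi>" if e: "e \<in> cells M" and "\<xi> \<in> parent M e"
    unfolding Jf_def pb
    by (rule jacobian_add_scaleR[OF parent_props(1,3)[OF mesh e] assms[THEN regular_fieldD[OF mesh _ e]] \<open>\<xi> \<in> parent M e\<close>])
qed

lemma Jf_triple_integrable_on:
  assumes "regular_field M w" "regular_field M u" "regular_field M v" "e \<in> cells M"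
  shows "(\<lambda>\<xi>. Jf M w e \<xi> \<bullet>\<bullet> (Jf M u e \<xi> \<times>\<times> Jf M v e \<xi>)) integrable_on parent M e"
  using Jf_triple_integrable[OF mesh assms] by (rule set_lebesgue_integral_eq_integral(1))

text \<open>Along \<open>y\<close> plus a combination of shapes, a quadratic functional is a
  quadratic polynomial in the coefficients, and the base point affects only its lower-order part.
  Linearity is restricted to regular fields because exact integrals split only for integrable
  terms.\<close>

lemma var_hessian_quadratic_form:
  assumes \<phi>: "\<And>i. regular_field M (shape M i)" and y: "regular_field M y"
    and sym: "\<And>u v. B u v = B v u"
    and lin: "\<And>u v w r. regular_field M u \<Longrightarrow> regular_field M v \<Longrightarrow> regular_field M w \<Longrightarrow>
      B (\<lambda>x. u x + r *\<^sub>R v x) w = B u w + r * B v w"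
    and \<Phi>: "\<And>u. \<Phi> u = B u u / 2"
  shows "var_hessian M \<Phi> y = (\<chi> i j. B (shape M i) (shape M j))"
proof -
  let ?s = "\<lambda>a I x. y x + (\<Sum>i\<in>I. a $ i *\<^sub>R shape M i x)"
  \<comment> \<open>Induction over partial sums: linearity is available one term at a time, and each
    partial sum must itself be regular before the next term is added.\<close>
  have expand: "regular_field M (?s a I) \<and> (\<forall>w. regular_field M w \<longrightarrow> B (?s a I) w = B y w + (\<Sum>i\<in>I. a $ i * B (shape M i) w))"
    if "finite I" for a I
    using that
  proof (induction rule: finite_induct)
    case empty
    show ?case using y by simp
  next
    case (insert i I)
    have eq: "?s a (insert i I) = (\<lambda>x. ?s a I x + a $ i *\<^sub>R shape M i x)"
      using insert.hyps by (simp add: algebra_simps)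
    show ?case
      unfolding eq using insert lin[of "?s a I" "shape M i" _ "a $ i"] \<phi> regular_field_add_scaleR(1)
      by simp
  qed
  define H where "H = (\<chi> i j. B (shape M i) (shape M j))"
  define l where "l = (\<chi> i. B y (shape M i))"
  have "\<Phi> (?s a UNIV) = B y y / 2 + l \<bullet> a + (a \<bullet> (H *v a)) / 2" for a
  proof -
    note e = expand[OF finite_class.finite_UNIV, of a]
    have H': "B (shape M n) (shape M i) = H $ i $ n" for i n
      unfolding H_def using sym[of "shape M n"] by simp
    have "B (?s a UNIV) (?s a UNIV) = B (?s a UNIV) y + (\<Sum>i\<in>UNIV. a $ i * B (?s a UNIV) (shape M i))"
      using e by (simp add: sym[of y "?s a UNIV"] sym[of "shape M _" "?s a UNIV"])
    also have "\<dots> = B y y + 2 * (l \<bullet> a) + a \<bullet> (H *v a)"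
      using e y \<phi>
      by (simp add: l_def H' inner_vec_def matrix_vector_mult_def sum_distrib_left sum.distrib algebra_simps
         sym[of "shape M _" y])
    finally show ?thesis by (simp add: \<Phi> add_divide_distrib)
  qed
  moreover have "transpose H = H"
    unfolding H_def transpose_def using sym by simp
  ultimately have "hessian (\<lambda>a. \<Phi> (?s a UNIV)) 0 = H" by (intro hessian_quadratic)
  then show ?thesis unfolding var_hessian_def lincomb_def H_def .
qed

definition form_I :: "(real^3 \<Rightarrow> real^3) \<Rightarrow> (real^3 \<Rightarrow> real^3) \<Rightarrow> (real^3 \<Rightarrow> real^3) \<Rightarrow> real" where
  "form_I z u v = (\<Sum>e\<in>cells M. exact_int M e (\<lambda>\<xi>. Jf M z e \<xi> \<bullet>\<bullet> (Jf M u e \<xi> \<times>\<times> Jf M v e \<xi>)))"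

definition form_Q :: "(real^3 \<Rightarrow> real^3) \<Rightarrow> (real^3 \<Rightarrow> real^3) \<Rightarrow> (real^3 \<Rightarrow> real^3) \<Rightarrow> real" where
  "form_Q z u v = (\<Sum>e\<in>cells M. quad_int M e (\<lambda>\<xi>. Jf M z e \<xi> \<bullet>\<bullet> (Jf M u e \<xi> \<times>\<times> Jf M v e \<xi>)))"

lemma gauge_I_eq:
  assumes z: "regular_field M z" and \<phi>: "\<And>i. regular_field M (shape M i)" and y: "regular_field M y"
  shows "gauge_I M z y = (\<chi> i j. form_I z (shape M i) (shape M j))"
  unfolding gauge_I_def
proof (rule var_hessian_quadratic_form[OF \<phi> y])
  show "form_I z u v = form_I z v u" for u v
    unfolding form_I_def by (subst frob_cross_mat_commute) (rule refl)
  show "(\<Sum>e\<in>cells M. exact_int M e (\<lambda>\<xi>. Jf M z e \<xi> \<bullet>\<bullet> cof (Jf M u e \<xi>))) = form_I z u u / 2" for u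
    by (simp add: form_I_def exact_int_def frob_cof sum_divide_distrib)
  show "form_I z (\<lambda>x. u x + r *\<^sub>R v x) w = form_I z u w + r * form_I z v w"
    if u: "regular_field M u" and v: "regular_field M v" and w: "regular_field M w" for u v w r
    unfolding form_I_def sum_distrib_left sum.distrib[symmetric]
  proof (rule sum.cong[OF refl])
    fix e assume e: "e \<in> cells M"
    have "exact_int M e (\<lambda>\<xi>. Jf M z e \<xi> \<bullet>\<bullet> (Jf M (\<lambda>x. u x + r *\<^sub>R v x) e \<xi> \<times>\<times> Jf M w e \<xi>))
      = integral (parent M e) (\<lambda>\<xi>. Jf M z e \<xi> \<bullet>\<bullet> (Jf M u e \<xi> \<times>\<times> Jf M w e \<xi>)
          + r * (Jf M z e \<xi> \<bullet>\<bullet> (Jf M v e \<xi> \<times>\<times> Jf M w e \<xi>)))"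
      unfolding exact_int_def
      by (rule integral_cong) (simp add: regular_field_add_scaleR(2)[OF u v e] frob_cross_mat_add_scaleR)
    also have "\<dots> = exact_int M e (\<lambda>\<xi>. Jf M z e \<xi> \<bullet>\<bullet> (Jf M u e \<xi> \<times>\<times> Jf M w e \<xi>))
        + r * exact_int M e (\<lambda>\<xi>. Jf M z e \<xi> \<bullet>\<bullet> (Jf M v e \<xi> \<times>\<times> Jf M w e \<xi>))"
      unfolding exact_int_def
      by (subst integral_add[OF Jf_triple_integrable_on[OF z u w e] integrable_on_mult_right[OF Jf_triple_integrable_on[OF z v w e]]])
         (simp only: integral_mult_right)
    finally show "exact_int M e (\<lambda>\<xi>. Jf M z e \<xi> \<bullet>\<bullet> (Jf M (\<lambda>x. u x + r *\<^sub>R v x) e \<xi> \<times>\<times> Jf M w e \<xi>))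
      = exact_int M e (\<lambda>\<xi>. Jf M z e \<xi> \<bullet>\<bullet> (Jf M u e \<xi> \<times>\<times> Jf M w e \<xi>))
        + r * exact_int M e (\<lambda>\<xi>. Jf M z e \<xi> \<bullet>\<bullet> (Jf M v e \<xi> \<times>\<times> Jf M w e \<xi>))" .
  qed
qed

lemma quad_int_cong:
  assumes "\<And>q. q < qnum M e \<Longrightarrow> f (qnode M e q) = g (qnode M e q)"
  shows "quad_int M e f = quad_int M e g"
  unfolding quad_int_def quad_def using assms by (intro sum.cong) auto

text \<open>\<open>Jf\<close> is additive at points of the parent cell, so the location of the nodes
  takes the place that integrability has in \<open>gauge_I_eq\<close>.\<close>

lemma gauge_Q_eq:
  assumes nodes: "\<And>e q. e \<in> cells M \<Longrightarrow> q < qnum M e \<Longrightarrow> qnode M e q \<in> parent M e"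
    and \<phi>: "\<And>i. regular_field M (shape M i)" and y: "regular_field M y"
  shows "gauge_Q M z y = (\<chi> i j. form_Q z (shape M i) (shape M j))"
  unfolding gauge_Q_def
proof (rule var_hessian_quadratic_form[OF \<phi> y])
  show "form_Q z u v = form_Q z v u" for u v
    unfolding form_Q_def by (subst frob_cross_mat_commute) (rule refl)
  show "(\<Sum>e\<in>cells M. quad_int M e (\<lambda>\<xi>. Jf M z e \<xi> \<bullet>\<bullet> cof (Jf M u e \<xi>))) = form_Q z u u / 2" for u
    by (simp add: form_Q_def quad_int_def quad_def frob_cof sum_divide_distrib)
  show "form_Q z (\<lambda>x. u x + r *\<^sub>R v x) w = form_Q z u w + r * form_Q z v w"
    if u: "regular_field M u" and v: "regular_field M v" and w: "regular_field M w" for u v w r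
    unfolding form_Q_def sum_distrib_left sum.distrib[symmetric]
  proof (rule sum.cong[OF refl])
    fix e assume e: "e \<in> cells M"
    have "quad_int M e (\<lambda>\<xi>. Jf M z e \<xi> \<bullet>\<bullet> (Jf M (\<lambda>x. u x + r *\<^sub>R v x) e \<xi> \<times>\<times> Jf M w e \<xi>))
      = quad_int M e (\<lambda>\<xi>. Jf M z e \<xi> \<bullet>\<bullet> (Jf M u e \<xi> \<times>\<times> Jf M w e \<xi>)
          + r * (Jf M z e \<xi> \<bullet>\<bullet> (Jf M v e \<xi> \<times>\<times> Jf M w e \<xi>)))"
      by (rule quad_int_cong) (simp add: regular_field_add_scaleR(2)[OF u v e nodes[OF e]] frob_cross_mat_add_scaleR)
    also have "\<dots> = quad_int M e (\<lambda>\<xi>. Jf M z e \<xi> \<bullet>\<bullet> (Jf M u e \<xi> \<times>\<times> Jf M w e \<xi>))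
        + r * quad_int M e (\<lambda>\<xi>. Jf M z e \<xi> \<bullet>\<bullet> (Jf M v e \<xi> \<times>\<times> Jf M w e \<xi>))"
      by (simp add: quad_int_def quad_def distrib_left sum.distrib sum_distrib_left mult.left_commute)
    finally show "quad_int M e (\<lambda>\<xi>. Jf M z e \<xi> \<bullet>\<bullet> (Jf M (\<lambda>x. u x + r *\<^sub>R v x) e \<xi> \<times>\<times> Jf M w e \<xi>))
      = quad_int M e (\<lambda>\<xi>. Jf M z e \<xi> \<bullet>\<bullet> (Jf M u e \<xi> \<times>\<times> Jf M w e \<xi>))
        + r * quad_int M e (\<lambda>\<xi>. Jf M z e \<xi> \<bullet>\<bullet> (Jf M v e \<xi> \<times>\<times> Jf M w e \<xi>))" .
  qed
qed

lemma form_I_same_trace: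
  assumes z: "regular_field M z" and z': "regular_field M z'" and tr: "same_trace M z z'"
    and u: "regular_field M u" and v: "regular_field M v"
  shows "form_I z u v = form_I z' u v"
proof -
  \<comment> \<open>The difference of the potentials, written so that
    \<open>regular_field_add_scaleR\<close> covers it; equal traces make it vanish on the
    frontier.\<close>
  let ?w = "\<lambda>x. z x + (- 1) *\<^sub>R z' x"
  have w: "regular_field M ?w" by (rule regular_field_add_scaleR(1)[OF z z'])
  have "form_I ?w u v = 0"
    unfolding form_I_def using tr
    by (intro sum_exact_int_triple_zero[OF mesh w u v]) (simp add: same_trace_def)
  moreover have "form_I ?w u v = form_I z u v - form_I z' u v"
    unfolding form_I_def sum_subtractf[symmetric]
  proof (rule sum.cong[OF refl])
    fix e assume e: "e \<in> cells M"
    have "exact_int M e (\<lambda>\<xi>. Jf M ?w e \<xi> \<bullet>\<bullet> (Jf M u e \<xi> \<times>\<times> Jf M v e \<xi>))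
      = integral (parent M e) (\<lambda>\<xi>. Jf M z e \<xi> \<bullet>\<bullet> (Jf M u e \<xi> \<times>\<times> Jf M v e \<xi>)
          - Jf M z' e \<xi> \<bullet>\<bullet> (Jf M u e \<xi> \<times>\<times> Jf M v e \<xi>))"
      unfolding exact_int_def
      by (rule integral_cong) (simp only: regular_field_add_scaleR(2)[OF z z' e], simp add: frob_diff_left)
    also have "\<dots> = exact_int M e (\<lambda>\<xi>. Jf M z e \<xi> \<bullet>\<bullet> (Jf M u e \<xi> \<times>\<times> Jf M v e \<xi>))
        - exact_int M e (\<lambda>\<xi>. Jf M z' e \<xi> \<bullet>\<bullet> (Jf M u e \<xi> \<times>\<times> Jf M v e \<xi>))"
      unfolding exact_int_def
      by (rule integral_diff[OF Jf_triple_integrable_on[OF z u v e] Jf_triple_integrable_on[OF z' u v e]])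
    finally show "exact_int M e (\<lambda>\<xi>. Jf M ?w e \<xi> \<bullet>\<bullet> (Jf M u e \<xi> \<times>\<times> Jf M v e \<xi>))
      = exact_int M e (\<lambda>\<xi>. Jf M z e \<xi> \<bullet>\<bullet> (Jf M u e \<xi> \<times>\<times> Jf M v e \<xi>))
        - exact_int M e (\<lambda>\<xi>. Jf M z' e \<xi> \<bullet>\<bullet> (Jf M u e \<xi> \<times>\<times> Jf M v e \<xi>))" .
  qed
  ultimately show ?thesis by simp
qed

text \<open>Compatibility is tested on the local spaces, while the pullback of a global variation
  merely coincides with a local field on the parent cell. Jacobians within the parent, and hence
  both integrals, do not see the difference.\<close>

lemma form_Q_compatible:
  assumes nodes: "\<And>e q. e \<in> cells M \<Longrightarrow> q < qnum M e \<Longrightarrow> qnode M e q \<in> parent M e"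
    and space: "conforming_space M" and z: "cellwise_compatible M z"
    and u: "u \<in> var_space M" and v: "v \<in> var_space M"
  shows "form_Q z u v = form_I z u v"
  unfolding form_Q_def form_I_def
proof (rule sum.cong[OF refl])
  fix e assume e: "e \<in> cells M"
  have local_rep: "\<exists>u'\<in>local_space M e. \<forall>\<xi>\<in>parent M e. jacobian u' (at \<xi> within parent M e) = Jf M u e \<xi>"
    if "u \<in> var_space M" for u
  proof -
    have "\<exists>u'\<in>local_space M e. \<forall>\<xi>\<in>parent M e. pullback M e u \<xi> = u' \<xi>"
      using space that e by (simp add: conforming_space_def)
    then obtain u' where u': "u' \<in> local_space M e" "\<forall>\<xi>\<in>parent M e. pullback M e u \<xi> = u' \<xi>"
      by blast
    have "C1_on (parent M e) u'" using space u'(1) e by (simp add: conforming_space_def)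
    then have "jacobian (pullback M e u) (at \<xi> within parent M e) = jacobian u' (at \<xi> within parent M e)"
      if "\<xi> \<in> parent M e" for \<xi>
      using u'(2) that by (intro jacobian_cong_on[OF parent_props(1,3)[OF mesh e]]) auto
    with u'(1) show ?thesis unfolding Jf_def by (intro bexI[of _ u']) auto
  qed
  obtain u' where u': "u' \<in> local_space M e" "\<forall>\<xi>\<in>parent M e. jacobian u' (at \<xi> within parent M e) = Jf M u e \<xi>"
    using local_rep[OF u] by blast
  obtain v' where v': "v' \<in> local_space M e" "\<forall>\<xi>\<in>parent M e. jacobian v' (at \<xi> within parent M e) = Jf M v e \<xi>"
    using local_rep[OF v] by blast
  let ?g = "\<lambda>\<xi>. jacobian (pullback M e z) (at \<xi> within parent M e) \<bullet>\<bullet>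
    (jacobian u' (at \<xi> within parent M e) \<times>\<times> jacobian v' (at \<xi> within parent M e))"
  let ?f = "\<lambda>\<xi>. Jf M z e \<xi> \<bullet>\<bullet> (Jf M u e \<xi> \<times>\<times> Jf M v e \<xi>)"
  have eq: "?g \<xi> = ?f \<xi>" if "\<xi> \<in> parent M e" for \<xi>
    using u'(2) v'(2) that by (simp add: Jf_def)
  have "defect (parent M e) (quad_int M e) (pullback M e z) u' v' = 0"
    using z e u'(1) v'(1) unfolding cellwise_compatible_def by blast
  then have "quad_int M e ?g = integral (parent M e) ?g" unfolding defect_def Let_def by simp
  moreover have "quad_int M e ?g = quad_int M e ?f"
    by (rule quad_int_cong) (rule eq[OF nodes[OF e]])
  moreover have "integral (parent M e) ?g = integral (parent M e) ?f"
    by (rule integral_cong) (rule eq)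
  ultimately show "quad_int M e ?f = exact_int M e ?f" unfolding exact_int_def by simp
qed

end

lemma reference_forms:
  fixes M :: "('e, 'n::finite) fe_model"
  assumes fe: "fe_setting M" and z: "regular_field M z" and z': "regular_field M z'" and tr: "same_trace M z z'"
    and y: "regular_field M y"
  shows "gauge_I M z y = gauge_I M z' y"
    and "cellwise_compatible M z \<Longrightarrow> gauge_Q M z y = gauge_I M z y"
proof -
  have mesh: "conforming_mesh M" and space: "conforming_space M"
    and nodes: "\<And>e q. e \<in> cells M \<Longrightarrow> q < qnum M e \<Longrightarrow> qnode M e q \<in> parent M e"
    using fe by (auto simp: fe_setting_def)
  have \<phi>V: "shape M i \<in> var_space M" for i
  proof -
    have "lincomb (shape M) (axis i 1) = shape M i"
      by (rule ext) (simp add: lincomb_def axis_def if_distrib[of "\<lambda>c. c *\<^sub>R _"] cong: if_cong)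
    then show ?thesis unfolding var_space_def by (metis rangeI)
  qed
  have \<phi>: "regular_field M (shape M i)" for i
    using space \<phi>V[of i] by (simp add: conforming_space_def)
  show "gauge_I M z y = gauge_I M z' y"
    using form_I_same_trace[OF mesh z z' tr \<phi> \<phi>]
    by (simp add: gauge_I_eq[OF mesh z \<phi> y] gauge_I_eq[OF mesh z' \<phi> y])
  show "gauge_Q M z y = gauge_I M z y" if "cellwise_compatible M z"
    using form_Q_compatible[OF mesh nodes space that \<phi>V \<phi>V]
    by (simp add: gauge_I_eq[OF mesh z \<phi> y] gauge_Q_eq[OF mesh nodes \<phi> y])
qed


section \<open>Moments of the parent tetrahedron\<close>

lemma mem_T_hat: "\<xi> \<in> T_hat \<longleftrightarrow> 0 \<le> \<xi> $ 1 \<and> 0 \<le> \<xi> $ 2 \<and> 0 \<le> \<xi> $ 3 \<and> \<xi> $ 1 + \<xi> $ 2 + \<xi> $ 3 \<le> 1"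
  by (simp add: T_hat_def forall_3)

lemma T_hat_eq_simplex: "T_hat = convex hull (insert 0 Basis)"
proof -
  have B: "Basis = {axis 1 1, axis 2 1, axis 3 1 :: real^3}"
    by (auto simp: Basis_vec_def UNIV_3)
  have ne: "axis 1 1 \<noteq> (axis 2 1 :: real^3)" "axis 1 1 \<noteq> (axis 3 1 :: real^3)" "axis 2 1 \<noteq> (axis 3 1 :: real^3)"
    by (simp_all add: axis_eq_axis)
  show ?thesis
    unfolding std_simplex using ne by (auto simp: mem_T_hat B inner_axis add.assoc)
qed

lemma T_hat_props: "convex T_hat" "compact T_hat" "interior T_hat \<noteq> {}" "measure lborel T_hat = 1 / 6"
proof -
  show "convex T_hat" "compact T_hat" "interior T_hat \<noteq> {}"
    unfolding T_hat_eq_simplex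
    using interior_std_simplex_nonempty[where 'a = "real^3", of False]
    by (auto intro!: finite_imp_compact_convex_hull)
  show "measure lborel T_hat = 1 / 6"
    unfolding T_hat_eq_simplex by (simp add: content_std_simplex fact_numeral)
qed

lemma T_hat_integrable: "continuous_on UNIV f \<Longrightarrow> (f :: real^3 \<Rightarrow> real) absolutely_integrable_on T_hat"
  using T_hat_props(2) by (intro absolutely_integrable_continuous_compact) (auto intro: continuous_on_subset)

section \<open>Affine images, symmetries and bisection of the tetrahedron\<close>

lemma has_integral_affine_image:
  fixes A :: "real^3^3" and f :: "real^3 \<Rightarrow> real"
  assumes f: "continuous_on UNIV f" and d: "det A \<noteq> 0"
    and i: "((\<lambda>\<xi>. f (c + A *v \<xi>)) has_integral i) T_hat"
  shows "(f has_integral (\<bar>det A\<bar> * i)) ((\<lambda>\<xi>. c + A *v \<xi>) ` T_hat)"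
proof -
  have cont: "continuous_on UNIV (\<lambda>\<xi>. f (c + A *v \<xi>))"
    by (rule continuous_on_compose2[OF f])
       (intro continuous_on_add continuous_on_const linear_continuous_on[OF matrix_vector_mul_bounded_linear], simp)
  have "(\<lambda>\<xi>. \<bar>det (matrix (\<lambda>v. A *v v))\<bar> *\<^sub>R f (c + A *v \<xi>)) absolutely_integrable_on T_hat \<and>
      integral T_hat (\<lambda>\<xi>. \<bar>det (matrix (\<lambda>v. A *v v))\<bar> *\<^sub>R f (c + A *v \<xi>)) = \<bar>det A\<bar> * i \<longleftrightarrow>
      f absolutely_integrable_on ((\<lambda>\<xi>. c + A *v \<xi>) ` T_hat) \<and> integral ((\<lambda>\<xi>. c + A *v \<xi>) ` T_hat) f = \<bar>det A\<bar> * i"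
  proof (rule has_absolute_integral_change_of_variables_scalar)
    show "T_hat \<in> sets lebesgue" using T_hat_props(2) by (simp add: lmeasurable_compact fmeasurableD)
    show "((\<lambda>\<xi>. c + A *v \<xi>) has_derivative (*v) A) (at \<xi> within T_hat)" for \<xi>
      using has_derivative_add[OF has_derivative_const bounded_linear_imp_has_derivative[OF matrix_vector_mul_bounded_linear]]
      by fastforce
    show "inj_on (\<lambda>\<xi>. c + A *v \<xi>) T_hat"
      using d det_nz_iff_inj[OF matrix_vector_mul_linear, of A] by (simp add: inj_on_def)
  qed
  moreover have "(\<lambda>\<xi>. \<bar>det A\<bar> *\<^sub>R f (c + A *v \<xi>)) absolutely_integrable_on T_hat"
    by (rule T_hat_integrable) (intro continuous_intros cont)
  moreover have "integral T_hat (\<lambda>\<xi>. \<bar>det A\<bar> *\<^sub>R f (c + A *v \<xi>)) = \<bar>det A\<bar> * i"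
    using integral_unique[OF has_integral_mult_right[OF i]] by simp
  ultimately have "f absolutely_integrable_on ((\<lambda>\<xi>. c + A *v \<xi>) ` T_hat)"
    "integral ((\<lambda>\<xi>. c + A *v \<xi>) ` T_hat) f = \<bar>det A\<bar> * i" by auto
  then show ?thesis
    by (metis absolutely_integrable_on_def integrable_integral)
qed

lemma matrix_vector_3:
  "(vector [vector [a, b, c], vector [d, e, f], vector [g, h, i]] :: real^3^3) *v \<xi>
    = vector [a * \<xi> $ 1 + b * \<xi> $ 2 + c * \<xi> $ 3, d * \<xi> $ 1 + e * \<xi> $ 2 + f * \<xi> $ 3, g * \<xi> $ 1 + h * \<xi> $ 2 + i * \<xi> $ 3]"
  by (simp add: vec_eq_iff forall_3 matrix_vector_mult_def sum_3)

text \<open>The affine symmetries of the tetrahedron together with the bisection of the edge from vertex 1 to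
  vertex 2 yield enough linear equations between the moments to determine them up to degree three.
  Vertex 0 is the origin.\<close>

definition swap12 :: "real^3 \<Rightarrow> real^3" where "swap12 \<xi> = vector [\<xi> $ 2, \<xi> $ 1, \<xi> $ 3]"
definition swap23 :: "real^3 \<Rightarrow> real^3" where "swap23 \<xi> = vector [\<xi> $ 1, \<xi> $ 3, \<xi> $ 2]"
definition swap01 :: "real^3 \<Rightarrow> real^3" where "swap01 \<xi> = vector [1 - \<xi> $ 1 - \<xi> $ 2 - \<xi> $ 3, \<xi> $ 2, \<xi> $ 3]"
definition bisect :: "real^3 \<Rightarrow> real^3" where "bisect \<xi> = vector [\<xi> $ 1 + \<xi> $ 2 / 2, \<xi> $ 2 / 2, \<xi> $ 3]"

lemma has_integral_T_hat_symmetry: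
  fixes f :: "real^3 \<Rightarrow> real"
  assumes f: "continuous_on UNIV f"
    and s: "s \<in> {swap12, swap23, swap01}"
    and i: "((\<lambda>\<xi>. f (s \<xi>)) has_integral i) T_hat"
  shows "(f has_integral i) T_hat"
proof -
  have involution: "s (s \<xi>) = \<xi>" "\<xi> \<in> T_hat \<Longrightarrow> s \<xi> \<in> T_hat" for \<xi>
    using s by (auto simp: swap12_def swap23_def swap01_def vec_eq_iff forall_3 mem_T_hat)
  then have img: "s ` T_hat = T_hat" by (metis image_eqI subsetI image_subsetI subset_antisym)
  obtain c A where s_eq: "s = (\<lambda>\<xi>. c + A *v \<xi>)" and det: "\<bar>det A\<bar> = 1"
  proof -
    consider "s = swap12" | "s = swap23" | "s = swap01" using s by blast
    then show thesis
    proof cases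
      case 1
      show thesis
        by (rule that[of 0 "vector [vector [0, 1, 0], vector [1, 0, 0], vector [0, 0, 1]]"])
           (auto simp: 1 fun_eq_iff swap12_def matrix_vector_3 det_3)
    next
      case 2
      show thesis
        by (rule that[of 0 "vector [vector [1, 0, 0], vector [0, 0, 1], vector [0, 1, 0]]"])
           (auto simp: 2 fun_eq_iff swap23_def matrix_vector_3 det_3)
    next
      case 3
      show thesis
        by (rule that[of "vector [1, 0, 0]" "vector [vector [-1, -1, -1], vector [0, 1, 0], vector [0, 0, 1]]"])
           (auto simp: 3 fun_eq_iff swap01_def matrix_vector_3 det_3 vec_eq_iff forall_3)
    qed
  qed
  have "det A \<noteq> 0" using det by auto
  from has_integral_affine_image[OF f this, of c i] i img show ?thesis
    unfolding s_eq by (simp add: det)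
qed

text \<open>\<open>bisect\<close> and its mirror image parametrise the two halves cut out by the
  plane of equal first and second coordinates. Each has a determinant of absolute value 1/2, and the
  overlap is null.\<close>

lemma has_integral_T_hat_bisect:
  fixes f :: "real^3 \<Rightarrow> real"
  assumes f: "continuous_on UNIV f"
    and i: "((\<lambda>\<xi>. f (bisect \<xi>)) has_integral i) T_hat" and j: "((\<lambda>\<xi>. f (swap12 (bisect \<xi>))) has_integral j) T_hat"
  shows "(f has_integral (i / 2 + j / 2)) T_hat"
proof -
  let ?A = "vector [vector [1, 1/2, 0], vector [0, 1/2, 0], vector [0, 0, 1]] :: real^3^3"
  let ?B = "vector [vector [0, 1/2, 0], vector [1, 1/2, 0], vector [0, 0, 1]] :: real^3^3"
  let ?S1 = "{\<xi> \<in> T_hat. \<xi> $ 2 \<le> \<xi> $ 1}" and ?S2 = "{\<xi> \<in> T_hat. \<xi> $ 1 \<le> \<xi> $ 2}"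
  have eqA: "0 + ?A *v \<xi> = bisect \<xi>" and eqB: "0 + ?B *v \<xi> = swap12 (bisect \<xi>)" for \<xi>
    by (simp_all add: matrix_vector_3 bisect_def swap12_def vec_eq_iff forall_3)
  have det: "det ?A = 1 / 2" "det ?B = - 1 / 2" by (simp_all add: det_3)
  have bij: "bisect ` T_hat = ?S1"
  proof (intro equalityI subsetI)
    fix \<xi> assume "\<xi> \<in> ?S1"
    then show "\<xi> \<in> bisect ` T_hat"
      by (intro image_eqI[of _ _ "vector [\<xi> $ 1 - \<xi> $ 2, 2 * \<xi> $ 2, \<xi> $ 3]"])
         (auto simp: bisect_def mem_T_hat vec_eq_iff forall_3)
  qed (auto simp: bisect_def mem_T_hat)
  have bij': "(\<lambda>\<xi>. swap12 (bisect \<xi>)) ` T_hat = ?S2"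
  proof (intro equalityI subsetI)
    fix \<xi> assume "\<xi> \<in> ?S2"
    then show "\<xi> \<in> (\<lambda>\<xi>. swap12 (bisect \<xi>)) ` T_hat"
      by (intro image_eqI[of _ _ "vector [\<xi> $ 2 - \<xi> $ 1, 2 * \<xi> $ 1, \<xi> $ 3]"])
         (auto simp: bisect_def swap12_def mem_T_hat vec_eq_iff forall_3)
  qed (auto simp: bisect_def swap12_def mem_T_hat)
  have 1: "(f has_integral (i / 2)) ?S1"
    using has_integral_affine_image[OF f, of ?A 0 i] i unfolding eqA det bij by simp
  have 2: "(f has_integral (j / 2)) ?S2"
    using has_integral_affine_image[OF f, of ?B 0 j] j unfolding eqB det bij' by simp
  have "negligible (?S1 \<inter> ?S2)"
  proof (rule negligible_subset)
    show "negligible {\<xi> :: real^3. (axis 1 1 - axis 2 1) \<bullet> \<xi> = 0}"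
      by (rule negligible_hyperplane) (simp add: axis_eq_axis)
    show "?S1 \<inter> ?S2 \<subseteq> {\<xi> :: real^3. (axis 1 1 - axis 2 1) \<bullet> \<xi> = 0}"
      by (auto simp: inner_diff_left inner_axis')
  qed
  from has_integral_Un[OF 1 2 this] show ?thesis
    by (rule back_subst[of "\<lambda>S. (f has_integral (i / 2 + j / 2)) S"]) auto
qed

definition monomial :: "nat \<Rightarrow> nat \<Rightarrow> nat \<Rightarrow> real^3 \<Rightarrow> real" where
  "monomial i j k \<xi> = \<xi> $ 1 ^ i * \<xi> $ 2 ^ j * \<xi> $ 3 ^ k"

abbreviation moment :: "nat \<Rightarrow> nat \<Rightarrow> nat \<Rightarrow> real" where
  "moment i j k \<equiv> integral T_hat (monomial i j k)"

lemma continuous_on_monomial: "continuous_on UNIV (monomial i j k)"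
  unfolding monomial_def[abs_def] by (intro continuous_intros)

lemma has_integral_monomial: "(monomial i j k has_integral moment i j k) T_hat"
  using T_hat_integrable[OF continuous_on_monomial] by (simp add: absolutely_integrable_on_def integrable_integral)

lemma moment_swap12: "moment i j k = moment j i k"
  by (rule integral_unique, rule has_integral_T_hat_symmetry[OF continuous_on_monomial, of swap12])
     (use has_integral_monomial[of j i k] in \<open>auto simp: monomial_def[abs_def] swap12_def mult_ac\<close>)

lemma moment_swap23: "moment i j k = moment i k j"
  by (rule integral_unique, rule has_integral_T_hat_symmetry[OF continuous_on_monomial, of swap23])
     (use has_integral_monomial[of i k j] in \<open>auto simp: monomial_def[abs_def] swap23_def mult_ac\<close>)

lemma moment_swap01:
  "moment (Suc i) j k = integral T_hat (\<lambda>\<xi>. monomial 0 j k \<xi> * (1 - \<xi> $ 1 - \<xi> $ 2 - \<xi> $ 3) ^ Suc i)"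
proof (rule integral_unique, rule has_integral_T_hat_symmetry[OF continuous_on_monomial, of swap01])
  let ?g = "\<lambda>\<xi>. monomial 0 j k \<xi> * (1 - \<xi> $ 1 - \<xi> $ 2 - \<xi> $ 3) ^ Suc i"
  have "continuous_on UNIV ?g" by (intro continuous_intros continuous_on_monomial)
  then have "(?g has_integral integral T_hat ?g) T_hat"
    using T_hat_integrable by (simp add: absolutely_integrable_on_def integrable_integral)
  then show "((\<lambda>\<xi>. monomial (Suc i) j k (swap01 \<xi>)) has_integral integral T_hat ?g) T_hat"
    by (simp add: monomial_def swap01_def mult_ac)
qed simp

text \<open>By symmetry the first coordinate may be exchanged for the barycentric coordinate of the
  origin, which is 1 minus the sum of the coordinates. This ties moments of one degree to those of
  the degree below.\<close>

lemma moment_swap01_1: "moment 1 j k = moment 0 j k - moment 1 j k - moment 0 (Suc j) k - moment 0 j (Suc k)"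
proof -
  have "((\<lambda>\<xi>. monomial 0 j k \<xi> - monomial 1 j k \<xi> - monomial 0 (Suc j) k \<xi> - monomial 0 j (Suc k) \<xi>)
     has_integral (moment 0 j k - moment 1 j k - moment 0 (Suc j) k - moment 0 j (Suc k))) T_hat"
    by (intro has_integral_diff has_integral_monomial)
  moreover have "(\<lambda>\<xi>. monomial 0 j k \<xi> - monomial 1 j k \<xi> - monomial 0 (Suc j) k \<xi> - monomial 0 j (Suc k) \<xi>)
      = (\<lambda>\<xi>. monomial 0 j k \<xi> * (1 - \<xi> $ 1 - \<xi> $ 2 - \<xi> $ 3) ^ Suc 0)"
    by (simp add: fun_eq_iff monomial_def algebra_simps)
  ultimately have "integral T_hat (\<lambda>\<xi>. monomial 0 j k \<xi> * (1 - \<xi> $ 1 - \<xi> $ 2 - \<xi> $ 3) ^ Suc 0)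
      = moment 0 j k - moment 1 j k - moment 0 (Suc j) k - moment 0 j (Suc k)"
    by (simp only: integral_unique)
  then show ?thesis
    using moment_swap01[of 0 j k] by (simp only: One_nat_def)
qed

text \<open>Up to permutation degree two has two unknown moments, and the barycentric exchange
  yields one equation for them; comparing the square of a coordinate with its two halves gives the
  second.\<close>

lemma moment_bisect_2: "moment 2 0 0 = 2 * moment 1 1 0"
proof -
  have eq: "(\<lambda>\<xi>. monomial 2 0 0 (bisect \<xi>)) = (\<lambda>\<xi>. monomial 2 0 0 \<xi> + monomial 1 1 0 \<xi> + 1 / 4 * monomial 0 2 0 \<xi>)"
    "(\<lambda>\<xi>. monomial 2 0 0 (swap12 (bisect \<xi>))) = (\<lambda>\<xi>. 1 / 4 * monomial 0 2 0 \<xi>)"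
    by (simp_all add: fun_eq_iff monomial_def bisect_def swap12_def power2_eq_square algebra_simps)
  have "((\<lambda>\<xi>. monomial 2 0 0 (bisect \<xi>)) has_integral (moment 2 0 0 + moment 1 1 0 + 1 / 4 * moment 0 2 0)) T_hat"
    "((\<lambda>\<xi>. monomial 2 0 0 (swap12 (bisect \<xi>))) has_integral (1 / 4 * moment 0 2 0)) T_hat"
    unfolding eq by (intro has_integral_add has_integral_mult_right has_integral_monomial)+
  from integral_unique[OF has_integral_T_hat_bisect[OF continuous_on_monomial this]]
  show ?thesis using moment_swap12[of 2 0 0] by (simp add: field_simps)
qed

text \<open>Degree three has three unknown moments up to permutation and two equations from the
  barycentric exchange; the bisection supplies the missing one.\<close>

lemma moment_bisect_3: "moment 3 0 0 = 3 * moment 2 1 0"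
proof -
  have eq: "(\<lambda>\<xi>. monomial 3 0 0 (bisect \<xi>))
      = (\<lambda>\<xi>. monomial 3 0 0 \<xi> + 3 / 2 * monomial 2 1 0 \<xi> + 3 / 4 * monomial 1 2 0 \<xi> + 1 / 8 * monomial 0 3 0 \<xi>)"
    "(\<lambda>\<xi>. monomial 3 0 0 (swap12 (bisect \<xi>))) = (\<lambda>\<xi>. 1 / 8 * monomial 0 3 0 \<xi>)"
    by (simp_all add: fun_eq_iff monomial_def bisect_def swap12_def power2_eq_square power3_eq_cube field_simps)
  have "((\<lambda>\<xi>. monomial 3 0 0 (bisect \<xi>)) has_integral
      (moment 3 0 0 + 3 / 2 * moment 2 1 0 + 3 / 4 * moment 1 2 0 + 1 / 8 * moment 0 3 0)) T_hat"
    "((\<lambda>\<xi>. monomial 3 0 0 (swap12 (bisect \<xi>))) has_integral (1 / 8 * moment 0 3 0)) T_hat"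
    unfolding eq by (intro has_integral_add has_integral_mult_right has_integral_monomial)+
  from integral_unique[OF has_integral_T_hat_bisect[OF continuous_on_monomial this]]
  show ?thesis using moment_swap12[of 3 0 0] moment_swap12[of 1 2 0] by (simp add: field_simps)
qed

lemma moments:
  "moment 0 0 0 = 1 / 6" "moment 1 0 0 = 1 / 24" "moment 2 0 0 = 1 / 60" "moment 1 1 0 = 1 / 120"
  "moment 3 0 0 = 1 / 120" "moment 2 1 0 = 1 / 360" "moment 1 1 1 = 1 / 720"
proof -
  have "T_hat \<in> lmeasurable" using T_hat_props(2) by (rule lmeasurable_compact)
  then have "integral T_hat (\<lambda>x. 1 :: real) = measure lebesgue T_hat"
    by (simp add: lmeasure_integral)
  then show m0: "moment 0 0 0 = 1 / 6"
    using T_hat_props(4) T_hat_props(2) by (simp add: monomial_def[abs_def] measure_completion compact_imp_closed borel_closed)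
  show m1: "moment 1 0 0 = 1 / 24"
    using moment_swap01_1[of 0 0] m0 moment_swap12[of 0 1 0] moment_swap23[of 0 0 1] unfolding One_nat_def by linarith
  have "moment 1 1 0 = moment 1 0 0 - moment 1 1 0 - moment 2 0 0 - moment 1 1 0"
    using moment_swap01_1[of 1 0] moment_swap12[of 0 1 0] moment_swap12[of 0 2 0] moment_swap12[of 0 1 1]
      moment_swap23[of 1 0 1] unfolding numeral_2_eq_2 One_nat_def by linarith
  then show m11: "moment 1 1 0 = 1 / 120" and m2: "moment 2 0 0 = 1 / 60" using m1 moment_bisect_2 by linarith+
  have "3 * moment 2 1 0 + moment 3 0 0 = moment 2 0 0"
    using moment_swap01_1[of 2 0] moment_swap12[of 1 2 0] moment_swap12[of 0 2 0] moment_swap12[of 0 3 0]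
      moment_swap12[of 0 2 1] moment_swap23[of 2 0 1]
    unfolding numeral_2_eq_2 numeral_3_eq_3 One_nat_def by linarith
  then show m21: "moment 2 1 0 = 1 / 360" and m3: "moment 3 0 0 = 1 / 120" using m2 moment_bisect_3 by linarith+
  have "moment 1 1 1 = moment 1 1 0 - moment 1 1 1 - moment 2 1 0 - moment 2 1 0"
    using moment_swap01_1[of 1 1] moment_swap12[of 0 1 1] moment_swap23[of 1 0 1] moment_swap12[of 0 2 1]
      moment_swap23[of 2 0 1] moment_swap23[of 0 1 2]
    unfolding numeral_2_eq_2 One_nat_def by linarith
  then show "moment 1 1 1 = 1 / 720" using m11 m21 by linarith
qed


section \<open>The error of the four-point rule\<close>

definition quad_err :: "(real^3 \<Rightarrow> real) \<Rightarrow> real" where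
  "quad_err f = Q4 f - integral T_hat f"

lemma quad_err_add_mult:
  assumes "continuous_on UNIV f" "continuous_on UNIV g"
  shows "quad_err (\<lambda>\<xi>. f \<xi> + r * g \<xi>) = quad_err f + r * quad_err g"
proof -
  have "f integrable_on T_hat" "g integrable_on T_hat"
    using assms T_hat_integrable set_lebesgue_integral_eq_integral(1) by blast+
  then have "integral T_hat (\<lambda>\<xi>. f \<xi> + r * g \<xi>) = integral T_hat f + r * integral T_hat g"
    by (subst integral_add) (auto intro: integrable_on_mult_right)
  then show ?thesis
    by (simp add: quad_err_def Q4_def quad_def sum.distrib sum_distrib_left algebra_simps)
qed

lemma quad_err_sum:
  assumes "finite I" "\<And>i. i \<in> I \<Longrightarrow> continuous_on UNIV (f i)"
  shows "quad_err (\<lambda>\<xi>. \<Sum>i\<in>I. c i * f i \<xi>) = (\<Sum>i\<in>I. c i * quad_err (f i))"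
  using assms
proof (induction rule: finite_induct)
  case empty
  show ?case by (simp add: quad_err_def Q4_def quad_def)
next
  case (insert i I)
  have "continuous_on UNIV (\<lambda>\<xi>. \<Sum>i\<in>I. c i * f i \<xi>)"
    using insert.prems by (intro continuous_intros) auto
  then show ?case
    using insert quad_err_add_mult[of "\<lambda>\<xi>. \<Sum>i\<in>I. c i * f i \<xi>" "f i" "c i"] by (simp add: add.commute)
qed

section \<open>Nodes of the rule and its errors on monomials\<close>

definition Q4_a :: real where "Q4_a = (5 + 3 * sqrt 5) / 20"
definition Q4_b :: real where "Q4_b = (5 - sqrt 5) / 20"

lemma Q4_nodes:
  "Q4_node 0 = vector [Q4_b, Q4_b, Q4_b]" "Q4_node 1 = vector [Q4_a, Q4_b, Q4_b]"
  "Q4_node 2 = vector [Q4_b, Q4_a, Q4_b]" "Q4_node 3 = vector [Q4_b, Q4_b, Q4_a]"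
  unfolding Q4_node_def tet_vertex_def Q4_a_def[symmetric] Q4_b_def[symmetric]
  by (simp_all add: vec_eq_iff forall_3 eval_nat_numeral axis_def)

lemma Q4_eq:
  "Q4 f = (f (vector [Q4_b, Q4_b, Q4_b]) + f (vector [Q4_a, Q4_b, Q4_b])
    + f (vector [Q4_b, Q4_a, Q4_b]) + f (vector [Q4_b, Q4_b, Q4_a])) / 24"
proof -
  have "{..<4::nat} = {0, 1, 2, 3}" by auto
  then show ?thesis by (simp add: Q4_def quad_def Q4_nodes[unfolded One_nat_def])
qed

lemma Q4_node_mem: "q < 4 \<Longrightarrow> Q4_node q \<in> T_hat"
proof -
  have "sqrt 5 \<le> 5" by (rule real_le_lsqrt) auto
  then have "0 \<le> Q4_b" "0 \<le> Q4_a" "Q4_a + 3 * Q4_b = 1" by (auto simp: Q4_a_def Q4_b_def field_simps)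
  moreover assume "q < 4"
  then have "q = 0 \<or> q = 1 \<or> q = 2 \<or> q = 3" by auto
  ultimately show ?thesis by (auto simp: Q4_nodes[unfolded One_nat_def] mem_T_hat)
qed

text \<open>The nodes lie in \<open>T_hat\<close>, so agreement there controls both terms of the
  error. This matters for integrands built from Jacobians within \<open>T_hat\<close>.\<close>

lemma quad_err_cong:
  assumes "\<And>\<xi>. \<xi> \<in> T_hat \<Longrightarrow> f \<xi> = g \<xi>"
  shows "quad_err f = quad_err g"
proof -
  have "Q4 f = Q4 g" unfolding Q4_def quad_def using assms Q4_node_mem by (intro sum.cong) auto
  moreover have "integral T_hat f = integral T_hat g" using assms by (rule integral_cong)
  ultimately show ?thesis by (simp add: quad_err_def)
qed

text \<open>Unweighted sums over the four nodes of the monomials with exponents (1,0,0), (2,0,0),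
  (1,1,0), (3,0,0), (2,1,0) and (1,1,1), in this order.\<close>

lemma Q4_powers:
  "Q4_a + 3 * Q4_b = 1" "Q4_a ^ 2 + 3 * Q4_b ^ 2 = 2 / 5" "2 * (Q4_a * Q4_b) + 2 * Q4_b ^ 2 = 1 / 5"
  "Q4_a ^ 3 + 3 * Q4_b ^ 3 = (35 + 3 * sqrt 5) / 200"
  "Q4_a ^ 2 * Q4_b + Q4_a * Q4_b ^ 2 + 2 * Q4_b ^ 3 = (15 - sqrt 5) / 200"
  "3 * (Q4_a * Q4_b ^ 2) + Q4_b ^ 3 = (5 + sqrt 5) / 200"
proof -
  have s: "sqrt 5 ^ 2 = 5" "sqrt 5 ^ 3 = 5 * sqrt 5" by (simp_all add: power3_eq_cube)
  show "Q4_a + 3 * Q4_b = 1" "Q4_a ^ 2 + 3 * Q4_b ^ 2 = 2 / 5" "2 * (Q4_a * Q4_b) + 2 * Q4_b ^ 2 = 1 / 5"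
    "Q4_a ^ 3 + 3 * Q4_b ^ 3 = (35 + 3 * sqrt 5) / 200"
    "Q4_a ^ 2 * Q4_b + Q4_a * Q4_b ^ 2 + 2 * Q4_b ^ 3 = (15 - sqrt 5) / 200"
    "3 * (Q4_a * Q4_b ^ 2) + Q4_b ^ 3 = (5 + sqrt 5) / 200"
    by (simp_all add: Q4_a_def Q4_b_def power2_eq_square power3_eq_cube field_simps)
qed

lemma moment_table:
  "moment 0 0 0 = 1 / 6"
  "moment 1 0 0 = 1 / 24" "moment 0 1 0 = 1 / 24" "moment 0 0 1 = 1 / 24"
  "moment 2 0 0 = 1 / 60" "moment 0 2 0 = 1 / 60" "moment 0 0 2 = 1 / 60"
  "moment 1 1 0 = 1 / 120" "moment 1 0 1 = 1 / 120" "moment 0 1 1 = 1 / 120"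
  "moment 3 0 0 = 1 / 120" "moment 0 3 0 = 1 / 120" "moment 0 0 3 = 1 / 120"
  "moment 2 1 0 = 1 / 360" "moment 2 0 1 = 1 / 360" "moment 1 2 0 = 1 / 360"
  "moment 0 2 1 = 1 / 360" "moment 1 0 2 = 1 / 360" "moment 0 1 2 = 1 / 360"
  "moment 1 1 1 = 1 / 720"
  using moments moment_swap12[of 0 1 0] moment_swap23[of 0 0 1] moment_swap12[of 0 2 0] moment_swap23[of 0 0 2]
    moment_swap23[of 1 0 1] moment_swap12[of 0 1 1] moment_swap12[of 0 3 0] moment_swap23[of 0 0 3]
    moment_swap23[of 2 0 1] moment_swap12[of 1 2 0] moment_swap12[of 0 2 1] moment_swap23[of 1 0 2]
    moment_swap23[of 0 1 2]
  by linarith+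

text \<open>On the cube of a coordinate the rule gives (35 + 3 sqrt 5) / 4800, against the exact
  moment 1/120 = 40/4800.\<close>

definition cubic_err :: real where "cubic_err = (3 * sqrt 5 - 5) / 4800"

lemma quad_err_monomials:
  "quad_err (monomial 0 0 0) = 0"
  "quad_err (monomial 1 0 0) = 0" "quad_err (monomial 0 1 0) = 0" "quad_err (monomial 0 0 1) = 0"
  "quad_err (monomial 2 0 0) = 0" "quad_err (monomial 0 2 0) = 0" "quad_err (monomial 0 0 2) = 0"
  "quad_err (monomial 1 1 0) = 0" "quad_err (monomial 1 0 1) = 0" "quad_err (monomial 0 1 1) = 0"
  "quad_err (monomial 3 0 0) = cubic_err" "quad_err (monomial 0 3 0) = cubic_err" "quad_err (monomial 0 0 3) = cubic_err"
  "quad_err (monomial 2 1 0) = - cubic_err / 3" "quad_err (monomial 2 0 1) = - cubic_err / 3" "quad_err (monomial 1 2 0) = - cubic_err / 3"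
  "quad_err (monomial 0 2 1) = - cubic_err / 3" "quad_err (monomial 1 0 2) = - cubic_err / 3" "quad_err (monomial 0 1 2) = - cubic_err / 3"
  "quad_err (monomial 1 1 1) = cubic_err / 3"
  using Q4_powers unfolding quad_err_def Q4_eq moment_table
  by (simp_all add: monomial_def cubic_err_def power2_eq_square power3_eq_cube field_simps)

text \<open>Since the error vanishes in degree two and is invariant under permutations of the barycentric
  coordinates, the errors of all cubic monomials are fixed multiples of that of \<open>\<xi>\<^sub>1\<^sup>3\<close>.\<close>

definition cubic_coeff :: "3 \<Rightarrow> 3 \<Rightarrow> 3 \<Rightarrow> real" where
  "cubic_coeff i j k = (if i = j \<and> j = k then 1 else if i = j \<or> j = k \<or> i = k then - 1 / 3 else 1 / 3)"

text \<open>\<open>of_bool\<close> counts how often each coordinate occurs, so that arbitrary index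
  triples reach the table of monomials.\<close>

lemma component_products:
  "(\<lambda>\<xi>. 1) = monomial 0 0 0"
  "(\<lambda>\<xi>. \<xi> $ i) = monomial (of_bool (i = 1)) (of_bool (i = 2)) (of_bool (i = 3))"
  "(\<lambda>\<xi>. \<xi> $ i * \<xi> $ j) = monomial (of_bool (i = 1) + of_bool (j = 1)) (of_bool (i = 2) + of_bool (j = 2))
     (of_bool (i = 3) + of_bool (j = 3))"
  "(\<lambda>\<xi>. \<xi> $ i * \<xi> $ j * \<xi> $ k) = monomial (of_bool (i = 1) + of_bool (j = 1) + of_bool (k = 1))
     (of_bool (i = 2) + of_bool (j = 2) + of_bool (k = 2)) (of_bool (i = 3) + of_bool (j = 3) + of_bool (k = 3))"
  using exhaust_3[of i] exhaust_3[of j] exhaust_3[of k]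
  by (auto simp: fun_eq_iff monomial_def power_add)

lemma quad_err_components:
  "quad_err (\<lambda>\<xi>. 1) = 0" "quad_err (\<lambda>\<xi>. \<xi> $ i) = 0" "quad_err (\<lambda>\<xi>. \<xi> $ i * \<xi> $ j) = 0"
  "quad_err (\<lambda>\<xi>. \<xi> $ i * \<xi> $ j * \<xi> $ k) = cubic_err * cubic_coeff i j k"
proof -
  show "quad_err (\<lambda>\<xi>. 1) = 0" by (simp only: component_products(1) quad_err_monomials)
  have "\<forall>i. quad_err (\<lambda>\<xi>. \<xi> $ i) = 0"
    unfolding forall_3 component_products(2) by (simp add: quad_err_monomials del: One_nat_def)
  then show "quad_err (\<lambda>\<xi>. \<xi> $ i) = 0" ..
  have "\<forall>i j. quad_err (\<lambda>\<xi>. \<xi> $ i * \<xi> $ j) = 0"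
    unfolding forall_3 component_products(3) by (simp add: quad_err_monomials del: One_nat_def)
  then show "quad_err (\<lambda>\<xi>. \<xi> $ i * \<xi> $ j) = 0" by blast
  have "\<forall>i j k. quad_err (\<lambda>\<xi>. \<xi> $ i * \<xi> $ j * \<xi> $ k) = cubic_err * cubic_coeff i j k"
    unfolding forall_3 component_products(4) by (simp add: quad_err_monomials cubic_coeff_def del: One_nat_def)
  then show "quad_err (\<lambda>\<xi>. \<xi> $ i * \<xi> $ j * \<xi> $ k) = cubic_err * cubic_coeff i j k" by blast
qed

text \<open>The nesting of the sums lets \<open>quad_err_sum\<close> be applied to one index at a
  time.\<close>

definition cubic_form :: "real^3 \<Rightarrow> real^3 \<Rightarrow> real^3 \<Rightarrow> real" where
  "cubic_form p q r = (\<Sum>i\<in>UNIV. p $ i * (\<Sum>j\<in>UNIV. q $ j * (\<Sum>k\<in>UNIV. r $ k * cubic_coeff i j k)))"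

lemma quad_err_inner_prods:
  "quad_err (\<lambda>\<xi>. p \<bullet> \<xi>) = 0" "quad_err (\<lambda>\<xi>. (p \<bullet> \<xi>) * (q \<bullet> \<xi>)) = 0"
  "quad_err (\<lambda>\<xi>. (p \<bullet> \<xi>) * (q \<bullet> \<xi>) * (r \<bullet> \<xi>)) = cubic_err * cubic_form p q r"
proof -
  have "quad_err (\<lambda>\<xi>. \<Sum>i\<in>UNIV. p $ i * \<xi> $ i) = 0"
    by (subst quad_err_sum) (intro continuous_intros | simp add: quad_err_components)+
  then show "quad_err (\<lambda>\<xi>. p \<bullet> \<xi>) = 0" by (simp add: inner_vec_def)
  have "quad_err (\<lambda>\<xi>. \<Sum>i\<in>UNIV. p $ i * (\<Sum>j\<in>UNIV. q $ j * (\<xi> $ i * \<xi> $ j))) = 0"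
    by (subst quad_err_sum, simp, (intro continuous_intros)[1], subst quad_err_sum)
       (intro continuous_intros | simp add: quad_err_components)+
  moreover have "(\<lambda>\<xi>. (p \<bullet> \<xi>) * (q \<bullet> \<xi>)) = (\<lambda>\<xi>. \<Sum>i\<in>UNIV. p $ i * (\<Sum>j\<in>UNIV. q $ j * (\<xi> $ i * \<xi> $ j)))"
    by (simp add: fun_eq_iff inner_vec_def sum_3 algebra_simps)
  ultimately show "quad_err (\<lambda>\<xi>. (p \<bullet> \<xi>) * (q \<bullet> \<xi>)) = 0" by simp
  have "quad_err (\<lambda>\<xi>. \<Sum>i\<in>UNIV. p $ i * (\<Sum>j\<in>UNIV. q $ j * (\<Sum>k\<in>UNIV. r $ k * (\<xi> $ i * \<xi> $ j * \<xi> $ k))))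
      = (\<Sum>i\<in>UNIV. p $ i * quad_err (\<lambda>\<xi>. \<Sum>j\<in>UNIV. q $ j * (\<Sum>k\<in>UNIV. r $ k * (\<xi> $ i * \<xi> $ j * \<xi> $ k))))"
    by (rule quad_err_sum) (intro continuous_intros | simp)+
  also have "\<dots> = (\<Sum>i\<in>UNIV. p $ i * (\<Sum>j\<in>UNIV. q $ j * quad_err (\<lambda>\<xi>. \<Sum>k\<in>UNIV. r $ k * (\<xi> $ i * \<xi> $ j * \<xi> $ k))))"
    by (intro sum.cong refl arg_cong2[of _ _ _ _ "(*)"] quad_err_sum) (intro continuous_intros | simp)+
  also have "\<dots> = (\<Sum>i\<in>UNIV. p $ i * (\<Sum>j\<in>UNIV. q $ j * (\<Sum>k\<in>UNIV. r $ k * (cubic_err * cubic_coeff i j k))))"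
    unfolding quad_err_components(4)[symmetric]
    by (intro sum.cong refl arg_cong2[of _ _ _ _ "(*)"] quad_err_sum) (intro continuous_intros | simp)+
  also have "\<dots> = cubic_err * cubic_form p q r"
    by (simp add: cubic_form_def sum_distrib_left mult_ac)
  finally have "quad_err (\<lambda>\<xi>. \<Sum>i\<in>UNIV. p $ i * (\<Sum>j\<in>UNIV. q $ j * (\<Sum>k\<in>UNIV. r $ k * (\<xi> $ i * \<xi> $ j * \<xi> $ k))))
    = cubic_err * cubic_form p q r" .
  moreover have "(\<lambda>\<xi>. (p \<bullet> \<xi>) * (q \<bullet> \<xi>) * (r \<bullet> \<xi>))
      = (\<lambda>\<xi>. \<Sum>i\<in>UNIV. p $ i * (\<Sum>j\<in>UNIV. q $ j * (\<Sum>k\<in>UNIV. r $ k * (\<xi> $ i * \<xi> $ j * \<xi> $ k))))"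
    by (simp add: fun_eq_iff inner_vec_def sum_3 algebra_simps)
  ultimately show "quad_err (\<lambda>\<xi>. (p \<bullet> \<xi>) * (q \<bullet> \<xi>) * (r \<bullet> \<xi>)) = cubic_err * cubic_form p q r" by simp
qed

lemma quad_err_affine_mult:
  assumes "continuous_on UNIV g"
  shows "quad_err (\<lambda>\<xi>. (\<beta> + q \<bullet> \<xi>) * g \<xi>) = quad_err (\<lambda>\<xi>. (q \<bullet> \<xi>) * g \<xi>) + \<beta> * quad_err g"
proof -
  have "quad_err (\<lambda>\<xi>. (q \<bullet> \<xi>) * g \<xi> + \<beta> * g \<xi>) = quad_err (\<lambda>\<xi>. (q \<bullet> \<xi>) * g \<xi>) + \<beta> * quad_err g"
    by (intro quad_err_add_mult continuous_intros assms)
  then show ?thesis by (simp add: distrib_right add.commute)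
qed

text \<open>After expansion, every term containing one of the constants has degree at most two and
  hence error zero; only the product of the three linear parts survives. The proof peels off one
  constant at a time.\<close>

lemma quad_err_affine_prod:
  "quad_err (\<lambda>\<xi>. (\<alpha> + p \<bullet> \<xi>) * ((\<beta> + q \<bullet> \<xi>) * (\<gamma> + r \<bullet> \<xi>))) = cubic_err * cubic_form p q r"
proof -
  have aff: "quad_err (\<lambda>\<xi>. \<alpha> + p \<bullet> \<xi>) = 0" for \<alpha> p
    using quad_err_affine_mult[of "\<lambda>\<xi>. 1" \<alpha> p] by (simp add: quad_err_components(1) quad_err_inner_prods(1))
  have lin_aff: "quad_err (\<lambda>\<xi>. (p \<bullet> \<xi>) * (\<beta> + q \<bullet> \<xi>)) = 0" for \<beta> p q
  proof -
    have "quad_err (\<lambda>\<xi>. (\<beta> + q \<bullet> \<xi>) * (p \<bullet> \<xi>)) = 0"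
      by (subst quad_err_affine_mult) (intro continuous_intros, simp add: quad_err_inner_prods)
    then show ?thesis by (simp only: mult.commute)
  qed
  have aff_aff: "quad_err (\<lambda>\<xi>. (\<alpha> + p \<bullet> \<xi>) * (\<beta> + q \<bullet> \<xi>)) = 0" for \<alpha> \<beta> p q
    by (subst quad_err_affine_mult) (intro continuous_intros, simp add: lin_aff aff)
  have "quad_err (\<lambda>\<xi>. (\<alpha> + p \<bullet> \<xi>) * ((\<beta> + q \<bullet> \<xi>) * (\<gamma> + r \<bullet> \<xi>)))
      = quad_err (\<lambda>\<xi>. (p \<bullet> \<xi>) * ((\<beta> + q \<bullet> \<xi>) * (\<gamma> + r \<bullet> \<xi>)))"
    by (subst quad_err_affine_mult) (intro continuous_intros, simp add: aff_aff)
  also have "\<dots> = quad_err (\<lambda>\<xi>. (\<beta> + q \<bullet> \<xi>) * ((p \<bullet> \<xi>) * (\<gamma> + r \<bullet> \<xi>)))"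
    by (simp only: mult.left_commute)
  also have "\<dots> = quad_err (\<lambda>\<xi>. (q \<bullet> \<xi>) * ((p \<bullet> \<xi>) * (\<gamma> + r \<bullet> \<xi>)))"
    by (subst quad_err_affine_mult) (intro continuous_intros, simp add: lin_aff)
  also have "\<dots> = quad_err (\<lambda>\<xi>. (\<gamma> + r \<bullet> \<xi>) * ((p \<bullet> \<xi>) * (q \<bullet> \<xi>)))"
    by (simp only: mult_ac)
  also have "\<dots> = quad_err (\<lambda>\<xi>. (r \<bullet> \<xi>) * ((p \<bullet> \<xi>) * (q \<bullet> \<xi>)))"
    by (subst quad_err_affine_mult) (intro continuous_intros, simp add: quad_err_inner_prods)
  also have "\<dots> = cubic_err * cubic_form p q r"
    unfolding quad_err_inner_prods(3)[symmetric] by (simp only: mult_ac)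
  finally show "quad_err (\<lambda>\<xi>. (\<alpha> + p \<bullet> \<xi>) * ((\<beta> + q \<bullet> \<xi>) * (\<gamma> + r \<bullet> \<xi>))) = cubic_err * cubic_form p q r" .
qed


section \<open>Quadratic fields on the parent tetrahedron\<close>

text \<open>The expansion of a 3 by 3 determinant with products of entries replaced by
  \<open>cubic_form\<close> of matrix rows. It measures the error on a triple product of affine
  gradients whose Hessians are \<open>A\<close>, \<open>B\<close>, \<open>C\<close>.\<close>

definition triple_form :: "real^3^3 \<Rightarrow> real^3^3 \<Rightarrow> real^3^3 \<Rightarrow> real" where
  "triple_form A B C =
     cubic_form (A $ 1) (B $ 2) (C $ 3) - cubic_form (A $ 1) (B $ 3) (C $ 2)
   + cubic_form (A $ 2) (B $ 3) (C $ 1) - cubic_form (A $ 2) (B $ 1) (C $ 3)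
   + cubic_form (A $ 3) (B $ 1) (C $ 2) - cubic_form (A $ 3) (B $ 2) (C $ 1)"

lemma triple_form_zero [simp]: "triple_form 0 B C = 0" "triple_form A 0 C = 0" "triple_form A B 0 = 0"
  by (simp_all add: triple_form_def cubic_form_def)

lemma continuous_on_affine_triple:
  "continuous_on UNIV (\<lambda>\<xi>::real^3. (a + A *v \<xi>) \<bullet> cross3 (b + B *v \<xi>) (c + C *v \<xi>))"
  by (intro continuous_on_inner continuous_on_cross continuous_on_add continuous_on_const
      linear_continuous_on[OF matrix_vector_mul_bounded_linear])

lemma quad_err_triple:
  "quad_err (\<lambda>\<xi>. (a + A *v \<xi>) \<bullet> cross3 (b + B *v \<xi>) (c + C *v \<xi>)) = cubic_err * triple_form A B C"
proof -
  define g where "g i j k \<xi> = (a $ i + A $ i \<bullet> \<xi>) * ((b $ j + B $ j \<bullet> \<xi>) * (c $ k + C $ k \<bullet> \<xi>))" for i j k \<xi>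
  have g: "quad_err (g i j k) = cubic_err * cubic_form (A $ i) (B $ j) (C $ k)" for i j k
    unfolding g_def[abs_def] by (rule quad_err_affine_prod)
  have cont: "continuous_on UNIV (g i j k)" for i j k
    unfolding g_def[abs_def] by (intro continuous_intros)
  \<comment> \<open>The signs are written as scalar factors so that \<open>quad_err_add_mult\<close>
    can strip one summand after another.\<close>
  have eq: "(\<lambda>\<xi>. (a + A *v \<xi>) \<bullet> cross3 (b + B *v \<xi>) (c + C *v \<xi>))
    = (\<lambda>\<xi>. g 1 2 3 \<xi> + (- 1) * g 1 3 2 \<xi> + 1 * g 2 3 1 \<xi> + (- 1) * g 2 1 3 \<xi> + 1 * g 3 1 2 \<xi> + (- 1) * g 3 2 1 \<xi>)"
    by (simp add: fun_eq_iff inner_vec_def[of "a + _"] sum_3 cross3_def g_def matrix_vector_mul_component right_diff_distrib)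
  show ?thesis
    unfolding eq by (subst quad_err_add_mult, (intro continuous_intros cont)+)+
       (simp add: g triple_form_def algebra_simps)
qed

text \<open>The factor 1/2 makes \<open>H l\<close> the Hessian of component \<open>l\<close> when
  it is symmetric, with affine gradient \<open>b $ l + H l *v x\<close>.\<close>

definition quadratic_field :: "real^3 \<Rightarrow> real^3^3 \<Rightarrow> (3 \<Rightarrow> real^3^3) \<Rightarrow> real^3 \<Rightarrow> real^3" where
  "quadratic_field c b H x = (\<chi> l. c $ l + b $ l \<bullet> x + (x \<bullet> (H l *v x)) / 2)"

lemma jacobian_quadratic_field:
  assumes H: "\<And>l. transpose (H l) = H l" and \<xi>: "\<xi> \<in> T_hat"
  shows "jacobian (quadratic_field c b H) (at \<xi> within T_hat) = (\<chi> l. b $ l + H l *v \<xi>)"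
proof (rule jacobian_within_convexI[OF T_hat_props(1,3) \<xi>])
  show "(quadratic_field c b H has_derivative (*v) (\<chi> l. b $ l + H l *v \<xi>)) (at \<xi> within T_hat)"
  proof (rule has_derivative_componentwise_within[THEN iffD2], rule ballI)
    fix i :: "real^3" assume "i \<in> Basis"
    then obtain l where i: "i = axis l 1" by (auto simp: Basis_vec_def)
    show "((\<lambda>x. quadratic_field c b H x \<bullet> i) has_derivative (\<lambda>x. ((\<chi> l. b $ l + H l *v \<xi>) *v x) \<bullet> i)) (at \<xi> within T_hat)"
      using has_derivative_quadratic[OF H[of l], of "c $ l" "b $ l" \<xi> T_hat]
      by (simp add: i inner_axis quadratic_field_def matrix_vector_mul_component)
  qed
qed

text \<open>Gradients of quadratic components are affine, so \<open>quad_err_triple\<close>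
  evaluates each triple product of the integrand, and only the Hessians remain.\<close>

lemma defect_quadratic_fields:
  assumes H: "\<And>l. transpose (Hw l) = Hw l" "\<And>l. transpose (Hu l) = Hu l" "\<And>l. transpose (Hv l) = Hv l"
  shows "defect T_hat Q4 (quadratic_field cw bw Hw) (quadratic_field cu bu Hu) (quadratic_field cv bv Hv)
    = cubic_err * (\<Sum>l\<in>UNIV. triple_form (Hw l) (Hu (l + 1)) (Hv (l + 2)) + triple_form (Hw l) (Hv (l + 1)) (Hu (l + 2)))"
proof -
  let ?f = "\<lambda>l \<xi>. (bw $ l + Hw l *v \<xi>) \<bullet> cross3 (bu $ (l + 1) + Hu (l + 1) *v \<xi>) (bv $ (l + 2) + Hv (l + 2) *v \<xi>)"
  let ?g = "\<lambda>l \<xi>. (bw $ l + Hw l *v \<xi>) \<bullet> cross3 (bv $ (l + 1) + Hv (l + 1) *v \<xi>) (bu $ (l + 2) + Hu (l + 2) *v \<xi>)"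
  have "defect T_hat Q4 (quadratic_field cw bw Hw) (quadratic_field cu bu Hu) (quadratic_field cv bv Hv)
    = quad_err (\<lambda>\<xi>. jacobian (quadratic_field cw bw Hw) (at \<xi> within T_hat) \<bullet>\<bullet>
        (jacobian (quadratic_field cu bu Hu) (at \<xi> within T_hat) \<times>\<times> jacobian (quadratic_field cv bv Hv) (at \<xi> within T_hat)))"
    by (simp add: defect_def quad_err_def Let_def)
  also have "\<dots> = quad_err (\<lambda>\<xi>. \<Sum>l\<in>UNIV. 1 * (?f l \<xi> + 1 * ?g l \<xi>))"
    by (rule quad_err_cong) (simp add: jacobian_quadratic_field H frob_cross_mat)
  also have "\<dots> = (\<Sum>l\<in>UNIV. 1 * quad_err (\<lambda>\<xi>. ?f l \<xi> + 1 * ?g l \<xi>))"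
    by (rule quad_err_sum) (auto intro!: continuous_on_add continuous_on_mult continuous_on_const continuous_on_affine_triple)
  also have "\<dots> = (\<Sum>l\<in>UNIV. 1 * (quad_err (?f l) + 1 * quad_err (?g l)))"
    by (subst quad_err_add_mult[OF continuous_on_affine_triple continuous_on_affine_triple]) (rule refl)
  finally show ?thesis by (simp only: quad_err_triple sum_distrib_left distrib_left mult_1)
qed

lemma exponents_le_2:
  "{(i, j, k). i + j + k \<le> (2::nat)} = {(0, 0, 0), (1, 0, 0), (0, 1, 0), (0, 0, 1), (2, 0, 0), (0, 2, 0), (0, 0, 2), (1, 1, 0), (1, 0, 1), (0, 1, 1)}"
    (is "?L = ?R")
proof
  show "?L \<subseteq> ?R"
  proof
    fix p :: "nat \<times> nat \<times> nat" assume "p \<in> ?L"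
    then obtain i j k where p: "p = (i, j, k)" and le: "i + j + k \<le> 2" by blast
    then have "i = 0 \<or> i = 1 \<or> i = 2" "j = 0 \<or> j = 1 \<or> j = 2" "k = 0 \<or> k = 1 \<or> k = 2" by linarith+
    then show "p \<in> ?R" unfolding p by (elim disjE) (use le in simp_all)
  qed
qed simp

lemma exponents_le_1:
  "{(i, j, k). i + j + k \<le> (1::nat)} = {(0, 0, 0), (1, 0, 0), (0, 1, 0), (0, 0, 1)}" (is "?L = ?R")
proof
  show "?L \<subseteq> ?R"
  proof
    fix p :: "nat \<times> nat \<times> nat" assume "p \<in> ?L"
    then obtain i j k where p: "p = (i, j, k)" and le: "i + j + k \<le> 1" by blast
    then have "i = 0 \<or> i = 1" "j = 0 \<or> j = 1" "k = 0 \<or> k = 1" by linarith+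
    then show "p \<in> ?R" unfolding p by (elim disjE) (use le in simp_all)
  qed
qed simp

lemma scalar_quadratic_iff:
  "(\<exists>c :: nat \<Rightarrow> nat \<Rightarrow> nat \<Rightarrow> real. \<forall>x :: real^3. g x =
      (\<Sum>(i, j, k) \<in> {(i, j, k). i + j + k \<le> 2}. c i j k * x $ 1 ^ i * x $ 2 ^ j * x $ 3 ^ k)) \<longleftrightarrow>
   (\<exists>c b H. transpose H = H \<and> (\<forall>x. g x = c + b \<bullet> x + (x \<bullet> (H *v x)) / 2))"
proof safe
  fix c :: "nat \<Rightarrow> nat \<Rightarrow> nat \<Rightarrow> real"
  assume g: "\<forall>x. g x = (\<Sum>(i, j, k) \<in> {(i, j, k). i + j + k \<le> 2}. c i j k * x $ 1 ^ i * x $ 2 ^ j * x $ 3 ^ k)"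
  \<comment> \<open>Diagonal coefficients are doubled to compensate for the factor 1/2; off-diagonal
    ones are not, since each occurs twice in the quadratic form.\<close>
  let ?H = "vector [vector [2 * c 2 0 0, c 1 1 0, c 1 0 1], vector [c 1 1 0, 2 * c 0 2 0, c 0 1 1],
    vector [c 1 0 1, c 0 1 1, 2 * c 0 0 2]] :: real^3^3"
  have "transpose ?H = ?H" by (simp add: vec_eq_iff forall_3 transpose_def)
  moreover have "g x = c 0 0 0 + vector [c 1 0 0, c 0 1 0, c 0 0 1] \<bullet> x + (x \<bullet> (?H *v x)) / 2" for x
    unfolding g[rule_format] exponents_le_2
    by (simp add: matrix_vector_3 inner_vec_def sum_3 power2_eq_square field_simps)
  ultimately show "\<exists>c b H. transpose H = H \<and> (\<forall>x. g x = c + b \<bullet> x + (x \<bullet> (H *v x)) / 2)" by blast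
next
  fix c :: real and b :: "real^3" and H :: "real^3^3"
  assume H: "transpose H = H" and g: "\<forall>x. g x = c + b \<bullet> x + (x \<bullet> (H *v x)) / 2"
  have sym: "H $ 2 $ 1 = H $ 1 $ 2" "H $ 3 $ 1 = H $ 1 $ 3" "H $ 3 $ 2 = H $ 2 $ 3"
    using H by (auto simp: transpose_def vec_eq_iff)
  define d where "d i j k = (if (i, j, k) = (0, 0, 0) then c else if (i, j, k) = (1, 0, 0) then b $ 1
    else if (i, j, k) = (0, 1, 0) then b $ 2 else if (i, j, k) = (0, 0, 1) then b $ 3
    else if (i, j, k) = (2, 0, 0) then H $ 1 $ 1 / 2 else if (i, j, k) = (0, 2, 0) then H $ 2 $ 2 / 2
    else if (i, j, k) = (0, 0, 2) then H $ 3 $ 3 / 2 else if (i, j, k) = (1, 1, 0) then H $ 1 $ 2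
    else if (i, j, k) = (1, 0, 1) then H $ 1 $ 3 else H $ 2 $ 3)" for i j k :: nat
  have "g x = (\<Sum>(i, j, k) \<in> {(i, j, k). i + j + k \<le> 2}. d i j k * x $ 1 ^ i * x $ 2 ^ j * x $ 3 ^ k)" for x
    unfolding g[rule_format] exponents_le_2
    by (simp add: d_def matrix_vector_mult_def inner_vec_def sum_3 sym power2_eq_square field_simps)
  then show "\<exists>c. \<forall>x. g x = (\<Sum>(i, j, k) \<in> {(i, j, k). i + j + k \<le> 2}. c i j k * x $ 1 ^ i * x $ 2 ^ j * x $ 3 ^ k)"
    by blast
qed

lemma scalar_affine_iff:
  "(\<exists>c :: nat \<Rightarrow> nat \<Rightarrow> nat \<Rightarrow> real. \<forall>x :: real^3. g x =
      (\<Sum>(i, j, k) \<in> {(i, j, k). i + j + k \<le> 1}. c i j k * x $ 1 ^ i * x $ 2 ^ j * x $ 3 ^ k)) \<longleftrightarrow>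
   (\<exists>c b. \<forall>x. g x = c + b \<bullet> x)"
proof safe
  fix c :: "nat \<Rightarrow> nat \<Rightarrow> nat \<Rightarrow> real"
  assume g: "\<forall>x. g x = (\<Sum>(i, j, k) \<in> {(i, j, k). i + j + k \<le> 1}. c i j k * x $ 1 ^ i * x $ 2 ^ j * x $ 3 ^ k)"
  have "g x = c 0 0 0 + vector [c 1 0 0, c 0 1 0, c 0 0 1] \<bullet> x" for x
    unfolding g[rule_format] exponents_le_1 by (simp add: inner_vec_def sum_3)
  then show "\<exists>c b. \<forall>x. g x = c + b \<bullet> x" by blast
next
  fix c :: real and b :: "real^3"
  assume g: "\<forall>x. g x = c + b \<bullet> x"
  define d where "d i j k = (if (i, j, k) = (0, 0, 0) then c else if (i, j, k) = (1, 0, 0) then b $ 1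
    else if (i, j, k) = (0, 1, 0) then b $ 2 else b $ 3)" for i j k :: nat
  have "g x = (\<Sum>(i, j, k) \<in> {(i, j, k). i + j + k \<le> 1}. d i j k * x $ 1 ^ i * x $ 2 ^ j * x $ 3 ^ k)" for x
    unfolding g[rule_format] exponents_le_1 by (simp add: d_def inner_vec_def sum_3)
  then show "\<exists>c. \<forall>x. g x = (\<Sum>(i, j, k) \<in> {(i, j, k). i + j + k \<le> 1}. c i j k * x $ 1 ^ i * x $ 2 ^ j * x $ 3 ^ k)"
    by blast
qed

lemma poly_fields_2_iff:
  "f \<in> poly_fields 2 \<longleftrightarrow> (\<exists>c b H. (\<forall>l. transpose (H l) = H l) \<and> f = quadratic_field c b H)"
proof -
  have "f \<in> poly_fields 2 \<longleftrightarrow> (\<forall>l. \<exists>c b H. transpose H = H \<and> (\<forall>x. f x $ l = c + b \<bullet> x + (x \<bullet> (H *v x)) / 2))"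
    unfolding poly_fields_def mem_Collect_eq scalar_quadratic_iff ..
  also have "\<dots> \<longleftrightarrow> (\<exists>c b H. \<forall>l. transpose (H l) = H l \<and> (\<forall>x. f x $ l = c l + b l \<bullet> x + (x \<bullet> (H l *v x)) / 2))"
    by (simp only: choice_iff)
  also have "\<dots> \<longleftrightarrow> (\<exists>c b H. (\<forall>l. transpose (H l) = H l) \<and> f = quadratic_field c b H)"
  proof
    assume "\<exists>c b H. \<forall>l. transpose (H l) = H l \<and> (\<forall>x. f x $ l = c l + b l \<bullet> x + (x \<bullet> (H l *v x)) / 2)"
    then obtain c b H where *: "\<And>l. transpose (H l) = H l" "\<And>l x. f x $ l = c l + b l \<bullet> x + (x \<bullet> (H l *v x)) / 2"
      by blast
    then have "f = quadratic_field (vec_lambda c) (vec_lambda b) H"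
      by (simp add: quadratic_field_def fun_eq_iff vec_eq_iff)
    with *(1) show "\<exists>c b H. (\<forall>l. transpose (H l) = H l) \<and> f = quadratic_field c b H" by blast
  next
    assume "\<exists>c b H. (\<forall>l. transpose (H l) = H l) \<and> f = quadratic_field c b H"
    then obtain c b H where "\<forall>l. transpose (H l) = H l" "f = quadratic_field c b H" by blast
    then show "\<exists>c b H. \<forall>l. transpose (H l) = H l \<and> (\<forall>x. f x $ l = c l + b l \<bullet> x + (x \<bullet> (H l *v x)) / 2)"
      by (intro exI[of _ "vec_nth c"] exI[of _ "vec_nth b"] exI[of _ H]) (simp add: quadratic_field_def)
  qed
  finally show ?thesis .
qed

lemma poly_fields_1_iff: "f \<in> poly_fields 1 \<longleftrightarrow> (\<exists>c b. f = quadratic_field c b (\<lambda>l. 0))"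
proof -
  have "f \<in> poly_fields 1 \<longleftrightarrow> (\<forall>l. \<exists>c b. \<forall>x. f x $ l = c + b \<bullet> x)"
    unfolding poly_fields_def mem_Collect_eq scalar_affine_iff ..
  also have "\<dots> \<longleftrightarrow> (\<exists>c b. \<forall>l x. f x $ l = c l + b l \<bullet> x)"
    by (simp only: choice_iff)
  also have "\<dots> \<longleftrightarrow> (\<exists>c b. f = quadratic_field c b (\<lambda>l. 0))"
  proof
    assume "\<exists>c b. \<forall>l x. f x $ l = c l + b l \<bullet> x"
    then obtain c b where "\<And>l x. f x $ l = c l + b l \<bullet> x" by blast
    then have "f = quadratic_field (vec_lambda c) (vec_lambda b) (\<lambda>l. 0)"
      by (simp add: quadratic_field_def fun_eq_iff vec_eq_iff)
    then show "\<exists>c b. f = quadratic_field c b (\<lambda>l. 0)" by blast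
  next
    assume "\<exists>c b. f = quadratic_field c b (\<lambda>l. 0)"
    then obtain c b where "f = quadratic_field c b (\<lambda>l. 0)" by blast
    then show "\<exists>c b. \<forall>l x. f x $ l = c l + b l \<bullet> x"
      by (intro exI[of _ "vec_nth c"] exI[of _ "vec_nth b"]) (simp add: quadratic_field_def)
  qed
  finally show ?thesis .
qed

section \<open>Nondegeneracy and the space of compatible quadratic fields\<close>

definition sym_unit :: "3 \<Rightarrow> 3 \<Rightarrow> real^3^3" where
  "sym_unit i j = (\<chi> k l. if (k = i \<and> l = j) \<or> (k = j \<and> l = i) then 1 else 0)"

lemma transpose_sym_unit: "transpose (sym_unit i j) = sym_unit i j"
  by (auto simp: sym_unit_def transpose_def vec_eq_iff)

text \<open>The Hessians of \<open>\<xi>\<^sub>i\<^sup>2 / 2\<close> and \<open>\<xi>\<^sub>i \<xi>\<^sub>k\<close> isolate the error of \<open>\<xi>\<^sub>i\<^sup>2\<close> times the third component of \<open>H \<xi>\<close>.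
  These six equations leave only the multiples of the matrix with diagonal entries 2 and off-diagonal
  entries 1, which the pair \<open>\<xi>\<^sub>1 \<xi>\<^sub>2\<close>, \<open>\<xi>\<^sub>1 \<xi>\<^sub>3\<close> excludes.\<close>

lemma triple_form_nondegenerate:
  assumes H: "transpose H = H"
    and zero: "\<And>S R. transpose S = S \<Longrightarrow> transpose R = R \<Longrightarrow> triple_form H S R = 0"
  shows "H = 0"
proof -
  have sym: "H $ 2 $ 1 = H $ 1 $ 2" "H $ 3 $ 1 = H $ 1 $ 3" "H $ 3 $ 2 = H $ 2 $ 3"
    using H by (auto simp: transpose_def vec_eq_iff)
  note z = zero[OF transpose_sym_unit transpose_sym_unit]
  note simps = triple_form_def cubic_form_def sum_3 cubic_coeff_def sym_unit_def sym
  have "3 * H $ 1 $ 3 - H $ 2 $ 3 - H $ 3 $ 3 = 0" using z[of 1 1 1 2] by (simp add: simps)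
  moreover have "3 * H $ 2 $ 3 - H $ 1 $ 3 - H $ 3 $ 3 = 0" using z[of 2 2 1 2] by (simp add: simps)
  moreover have "3 * H $ 1 $ 2 - H $ 2 $ 3 - H $ 2 $ 2 = 0" using z[of 1 1 1 3] by (simp add: simps)
  moreover have "3 * H $ 2 $ 3 - H $ 1 $ 2 - H $ 2 $ 2 = 0" using z[of 3 3 1 3] by (simp add: simps)
  moreover have "3 * H $ 1 $ 2 - H $ 1 $ 3 - H $ 1 $ 1 = 0" using z[of 2 2 2 3] by (simp add: simps)
  moreover have "3 * H $ 1 $ 3 - H $ 1 $ 2 - H $ 1 $ 1 = 0" using z[of 3 3 2 3] by (simp add: simps)
  moreover have "3 * H $ 1 $ 1 + H $ 2 $ 2 + H $ 3 $ 3 - 2 * H $ 2 $ 3 = 0" using z[of 1 2 1 3] by (simp add: simps)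
  ultimately have "H $ 1 $ 1 = 0 \<and> H $ 2 $ 2 = 0 \<and> H $ 3 $ 3 = 0 \<and> H $ 1 $ 2 = 0 \<and> H $ 1 $ 3 = 0 \<and> H $ 2 $ 3 = 0"
    by linarith
  then show ?thesis by (simp add: vec_eq_iff forall_3 sym)
qed

lemma cubic_err_nonzero: "cubic_err \<noteq> 0"
proof
  assume "cubic_err = 0"
  then have "3 * sqrt 5 = 5" by (simp add: cubic_err_def)
  then have "(3 * sqrt 5)^2 = 5^2" by simp
  then show False by (simp add: power_mult_distrib)
qed

lemma compatible_quadratic_fields:
  "{w \<in> poly_fields 2. \<forall>u\<in>poly_fields 2. \<forall>v\<in>poly_fields 2. defect T_hat Q4 w u v = 0} = poly_fields 1"
proof (intro equalityI subsetI)
  fix w assume "w \<in> poly_fields 1"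
  then obtain c b where w: "w = quadratic_field c b (\<lambda>l. 0)" unfolding poly_fields_1_iff by blast
  have t0: "transpose (0 :: real^3^3) = 0" by (simp add: transpose_def vec_eq_iff)
  then have "w \<in> poly_fields 2"
    unfolding poly_fields_2_iff w by (intro exI[of _ c] exI[of _ b] exI[of _ "\<lambda>l. 0"]) simp
  moreover have "defect T_hat Q4 w u v = 0" if uv: "u \<in> poly_fields 2" "v \<in> poly_fields 2" for u v
  proof -
    obtain cu bu Hu where u: "\<And>l. transpose (Hu l) = Hu l" "u = quadratic_field cu bu Hu"
      using uv(1) unfolding poly_fields_2_iff by blast
    obtain cv bv Hv where v: "\<And>l. transpose (Hv l) = Hv l" "v = quadratic_field cv bv Hv"
      using uv(2) unfolding poly_fields_2_iff by blast
    show ?thesis unfolding w u(2) v(2) by (subst defect_quadratic_fields[OF t0 u(1) v(1)]) simp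
  qed
  ultimately show "w \<in> {w \<in> poly_fields 2. \<forall>u\<in>poly_fields 2. \<forall>v\<in>poly_fields 2. defect T_hat Q4 w u v = 0}"
    by blast
next
  fix w assume "w \<in> {w \<in> poly_fields 2. \<forall>u\<in>poly_fields 2. \<forall>v\<in>poly_fields 2. defect T_hat Q4 w u v = 0}"
  then have w2: "w \<in> poly_fields 2"
    and w0: "\<And>u v. u \<in> poly_fields 2 \<Longrightarrow> v \<in> poly_fields 2 \<Longrightarrow> defect T_hat Q4 w u v = 0" by auto
  obtain c b H where H: "\<And>l. transpose (H l) = H l" and w: "w = quadratic_field c b H"
    using w2 unfolding poly_fields_2_iff by blast
  have "H l = 0" for l
  proof (rule triple_form_nondegenerate[OF H])
    fix S R :: "real^3^3" assume S: "transpose S = S" and R: "transpose R = R"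
    \<comment> \<open>One variation lives in component \<open>l + 1\<close> only and the other in
      component \<open>l + 2\<close> only. In the cyclic sum just the summand that pairs them with
      component \<open>l\<close> of the candidate survives.\<close>
    let ?S = "\<lambda>m. if m = l + 1 then S else 0" and ?R = "\<lambda>m. if m = l + 2 then R else 0"
    have tS: "transpose (?S m) = ?S m" and tR: "transpose (?R m) = ?R m" for m
      using S R by (simp_all add: transpose_def vec_eq_iff)
    have "quadratic_field 0 0 ?S \<in> poly_fields 2" "quadratic_field 0 0 ?R \<in> poly_fields 2"
      unfolding poly_fields_2_iff
      by (intro exI[of _ 0] exI[of _ ?S] conjI allI tS refl, intro exI[of _ 0] exI[of _ ?R] conjI allI tR refl)
    from w0[OF this] have "cubic_err * (\<Sum>m\<in>UNIV. triple_form (H m) (?S (m + 1)) (?R (m + 2))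
        + triple_form (H m) (?R (m + 1)) (?S (m + 2))) = 0"
      unfolding w defect_quadratic_fields[OF H tS tR] .
    moreover have "(\<Sum>m\<in>UNIV. triple_form (H m) (?S (m + 1)) (?R (m + 2))
        + triple_form (H m) (?R (m + 1)) (?S (m + 2))) = triple_form (H l) S R"
      using exhaust_3[of l] by (auto simp: sum_3 three_wraparound)
    ultimately show "triple_form (H l) S R = 0" using cubic_err_nonzero by simp
  qed
  then have "H = (\<lambda>l. 0)" by (simp add: fun_eq_iff)
  then show "w \<in> poly_fields 1" unfolding poly_fields_1_iff w by blast
qed

theorem corollary15:
  fixes M :: "('e, 'n::finite) fe_model" and z z' :: "real^3 \<Rightarrow> real^3"
  shows
    "(fe_setting M \<and> regular_field M z \<and> regular_field M z' \<and> same_trace M z z' \<longrightarrow>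
        (\<forall>y. regular_field M y \<longrightarrow> gauge_I M z y = gauge_I M z' y) \<and>
        (cellwise_compatible M z \<and> cellwise_compatible M z' \<longrightarrow>
          (\<forall>y. admissible_deformation M y \<longrightarrow>
            K_h M y + gauge_Q M z y = K_h M y + gauge_Q M z' y)) \<and>
        (cellwise_compatible M z \<longrightarrow>
          (\<forall>y. admissible_deformation M y \<longrightarrow>
            K_h M y + gauge_Q M z y = K_h M y + gauge_Q M z' y - gauge_defect M z' y))) \<and>
     {w \<in> poly_fields 2. \<forall>u\<in>poly_fields 2. \<forall>v\<in>poly_fields 2. defect T_hat Q4 w u v = 0}
       = poly_fields 1"
proof -
  \<comment> \<open>Stated for arbitrary potentials, because compatibility is also applied with the
    two exchanged.\<close>
  have trace: "gauge_I M z y = gauge_I M z' y" and compat: "cellwise_compatible M z \<Longrightarrow> gauge_Q M z y = gauge_I M z y"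
    if "fe_setting M" "regular_field M z" "regular_field M z'" "same_trace M z z'" "regular_field M y" for z z' y
    by (fact reference_forms(1)[OF that], fact reference_forms(2)[OF that])
  have sym: "same_trace M z' z" if "same_trace M z z'"
    using that by (simp add: same_trace_def)
  have adm: "regular_field M y" if "admissible_deformation M y" for y
    using that by (simp add: admissible_deformation_def)
  show ?thesis
  proof (intro conjI impI allI compatible_quadratic_fields)
    fix y assume "fe_setting M \<and> regular_field M z \<and> regular_field M z' \<and> same_trace M z z'" "regular_field M y"
    then show "gauge_I M z y = gauge_I M z' y" using trace by blast
  next
    fix y assume *: "fe_setting M \<and> regular_field M z \<and> regular_field M z' \<and> same_trace M z z'"
      "cellwise_compatible M z \<and> cellwise_compatible M z'" "admissible_deformation M y"
    then have "gauge_Q M z y = gauge_I M z y" "gauge_Q M z' y = gauge_I M z' y" "gauge_I M z y = gauge_I M z' y"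
      using compat[of z z' y] compat[of z' z y] trace[of z z' y] sym adm by simp_all
    then show "K_h M y + gauge_Q M z y = K_h M y + gauge_Q M z' y" by simp
  next
    \<comment> \<open>Unfolding \<open>gauge_defect\<close> reduces the right-hand side to
      \<open>K_h M y + gauge_I M z' y\<close>, so only compatibility of \<open>z\<close> and
      equality of the exact Hessians enter.\<close>
    fix y assume *: "fe_setting M \<and> regular_field M z \<and> regular_field M z' \<and> same_trace M z z'"
      "cellwise_compatible M z" "admissible_deformation M y"
    then have "gauge_Q M z y = gauge_I M z y" "gauge_I M z y = gauge_I M z' y"
      using compat[of z z' y] trace[of z z' y] adm by simp_all
    then show "K_h M y + gauge_Q M z y = K_h M y + gauge_Q M z' y - gauge_defect M z' y"
      by (simp add: gauge_defect_def)
  qed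
qed

end
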